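(* Let $M>0$, $\delta\in(0,1)$. Let $V^*\in H^3_{2N}(\Omega)$ be a solution of $$L(V^* )=0\ \text{in }\Omega,\qquad V^*|_{\partial\Omega}=\psi_0^*,\qquad V^*_z|_\Gamma=\psi_1^*$$ (the ideal solution with noiseless data $\psi_0^*,\psi_1^*$). Suppose that there exist $G,G^*\in H^3_{2N}(\Omega)$ such that $$G|_{\partial\Omega}=\psi_0,\quad G_z|_\Gamma=\psi_1,\qquad G^*|_{\partial\Omega}=\psi_0^*,\quad G^*_z|_\Gamma=\psi_1^*,$$ $$\|G-G^*\|_{H^3_{2N}(\Omega)}<\delta,\qquad \|V^*\|_{H^3_{2N}(\Omega)}<M-\delta,\quad\|G^*\|_{H^3_{2N}(\Omega)}<M-\delta .$$ Let $\lambda_2=\lambda_2(M,N,r,\Omega)>1$ be the strict convexity threshold defined in the context, and choose $\lambda_3=\lambda_2(3M,N,r,\Omega)>\lambda_2>1$. Let $\lambda=\lambda_3$ and $\gamma=\delta^2$, and let $V_{\min,\lambda,\gamma}\in\overline{B(M)}$ be the unique minimizer of $J_{\lambda,\gamma}$ on $\overline{B(M)}$. Then $$\|V_{\min,\lambda,\gamma}-V^*\|_{H^2_{2N}(\Omega)}\le C_1\delta,$$ where the constant $C_1=C_1(\Omega,N,M)>0$ depends only on the listed parameters.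
   Context: Fix throughout real numbers $R>0$, $d>R$, $a>0$, $k>0$, $r>R$ and an integer $N\ge1$ (constants $C_1$ may depend on the fixed parameters $k,a,d,r$ without this being indicated). Write $\mathbf{x}=(x,y,z)\in\mathbb{R}^3$, and let $\Omega=\{|x|,|y|,|z|<R\}$, $\Gamma=\{|x|,|y|<R,\ z=-R\}\subset\partial\Omega$. For $\alpha\in[-a,a]$ let $\mathbf{x}_\alpha=(\alpha,0,-d)$ and define the $\mathbb{C}^3$-valued functions $$\tilde{\mathbf{x}}_\alpha=\frac{\mathrm{i}k(\mathbf{x}-\mathbf{x}_\alpha)}{|\mathbf{x}-\mathbf{x}_\alpha|}-\frac{\mathbf{x}-\mathbf{x}_\alpha}{|\mathbf{x}-\mathbf{x}_\alpha|^2},\qquad \widehat{\mathbf{x}}_\alpha=\partial_\alpha\tilde{\mathbf{x}}_\alpha .$$ Let $\{\Psi_n\}_{n\ge0}$ be the orthonormal basis of $L^2(-a,a)$ obtained by Gram–Schmidt orthonormalization of the functions $\alpha^ne^\alpha$, $n=0,1,2,\dots$. Let $S_N=(s_{mn})_{m,n=0}^{N-1}$, $s_{mn}=\int_{-a}^a\Psi_n'\Psi_m\,d\alpha$; this matrix is upper triangular with ones on the diagonal, hence invertible. For a complex vector function $V=(v_0,\dots,v_{N-1})^T$ on $\Omega$ define $f(\nabla V)=(f_0,\dots,f_{N-1})^T$ by $$f_m(\nabla V)=2\sum_{n,l=0}^{N-1}\nabla v_n\cdot\nabla v_l\int_{-a}^a\Psi_m\Psi_n\Psi_l'\,d\alpha+2\sum_{n=0}^{N-1}\int_{-a}^a\Psi_m\Psi_n'\,\nabla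 v_n\cdot\tilde{\mathbf{x}}_\alpha\,d\alpha+2\sum_{n=0}^{N-1}\int_{-a}^a\Psi_m\Psi_n\,\widehat{\mathbf{x}}_\alpha\cdot\nabla v_n\,d\alpha,$$ where $A\cdot B=\sum_jA_jB_j$ without complex conjugation, and set $K(\nabla V)=S_N^{-1}f(\nabla V)$, $L(V)=\Delta V+K(\nabla V)$. $H^s_X(\Omega)$ denotes $X$-component vector functions with components in $H^s(\Omega)$, with norm $\|g\|=(\sum_j\|g_j\|^2_{H^s(\Omega)})^{1/2}$. Every complex $N$-dimensional vector function $V$ is identified with the real $2N$-dimensional one $(\mathrm{Re}\,V,\mathrm{Im}\,V)$. Let $\mu_\lambda(z)=\exp[2\lambda(z-r)^2]$. For $\lambda>0$, $\gamma\in(0,1)$, the functional $J_{\lambda,\gamma}:H^3_{2N}(\Omega)\to[0,\infty)$ is $$J_{\lambda,\gamma}(V)=e^{-2\lambda(R+r)^2}\int_\Omega|L(V)|^2\mu_\lambda(z)\,d\mathbf{x}+\gamma\|V\|^2_{H^3_{2N}(\Omega)}.$$ Given (possibly noisy) boundary data $\psi_0$ on $\partial\Omega$ and $\psi_1$ on $\Gamma$, $$B(M)=\{V\in H^3_{2N}(\Omega):\|V\|_{H^3_{2N}(\Omega)}<M,\ V|_{\partial\Omega}=\psi_0,\ V_z|_\Gamma=\psi_1\},$$ and $\overline{B(M)}$ is its closure in $H^3_{2N}(\Omega)$. Let $H^3_{0,2N}(\Omega)=\{h\in H^3_{2N}(\Omega):h|_{\partial\Omega}=0,\ h_z|_\Gamma=0\}$.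 The Fréchet derivative $J'_{\lambda,\gamma}(V)$ is taken with respect to increments in $H^3_{0,2N}(\Omega)$. Strict convexity threshold: for each $M>0$, $\lambda_2(M,N,r,\Omega)>1$ is a number depending only on the listed parameters such that for every $\lambda\ge\lambda_2(M,N,r,\Omega)$ there is a constant $C_1>0$ (independent of $\gamma$, $\psi_0$, $\psi_1$ and the functions below) with $$J_{\lambda,\gamma}(V^{(2)})-J_{\lambda,\gamma}(V^{(1)})-J'_{\lambda,\gamma}(V^{(1)})(V^{(2)}-V^{(1)})\ge C_1\|V^{(2)}-V^{(1)}\|^2_{H^2_{2N}(\Omega)}+\gamma\|V^{(2)}-V^{(1)}\|^2_{H^3_{2N}(\Omega)}$$ for all $V^{(1)},V^{(2)}\in\overline{B(M)}$. For $\lambda\ge\lambda_2(M,N,r,\Omega)$ the functional has a unique minimizer on $\overline{B(M)}$. *)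

theory Defs
  imports "HOL-Analysis.Analysis" "Jordan_Normal_Form.Gauss_Jordan_Elimination"
begin

no_notation vec_index (infixl "$" 100)

section \<open>The domain\<close>

definition cube :: "real \<Rightarrow> (real^3) set" where
  "cube R = {x. \<bar>x $ 1\<bar> < R \<and> \<bar>x $ 2\<bar> < R \<and> \<bar>x $ 3\<bar> < R}"

definition bottom_face :: "real \<Rightarrow> (real^3) set" where
  "bottom_face R = {x. \<bar>x $ 1\<bar> < R \<and> \<bar>x $ 2\<bar> < R \<and> x $ 3 = - R}"

section \<open>Weak derivatives and Sobolev spaces\<close>

definition pderiv_dir :: "3 \<Rightarrow> (real^3 \<Rightarrow> real) \<Rightarrow> real^3 \<Rightarrow> real" where
  "pderiv_dir j f x = frechet_derivative f (at x) (axis j 1)"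

text \<open>\<open>C\<^sup>\<infinity>(\<real>\<^sup>3)\<close>: every iterated partial derivative is again (totally) differentiable.\<close>
definition smooth_fun :: "(real^3 \<Rightarrow> real) \<Rightarrow> bool" where
  "smooth_fun f \<longleftrightarrow> (\<forall>js x. foldr pderiv_dir js f differentiable (at x))"

definition test_fun :: "(real^3) set \<Rightarrow> (real^3 \<Rightarrow> real) \<Rightarrow> bool" where
  "test_fun \<Omega> \<phi> \<longleftrightarrow> smooth_fun \<phi> \<and>
     compact (closure {x. \<phi> x \<noteq> 0}) \<and> closure {x. \<phi> x \<noteq> 0} \<subseteq> \<Omega>"

text \<open>Multi-indices are elements of \<open>nat^3\<close>; the \<open>j\<close>-th unit multi-index is \<open>axis j 1\<close>.\<close>
definition mi_order :: "nat^3 \<Rightarrow> nat" where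
  "mi_order \<beta> = (\<Sum>j\<in>UNIV. \<beta> $ j)"

definition mi_deriv :: "nat^3 \<Rightarrow> (real^3 \<Rightarrow> real) \<Rightarrow> real^3 \<Rightarrow> real" where
  "mi_deriv \<beta> \<phi> =
     (pderiv_dir 1 ^^ (\<beta> $ 1)) ((pderiv_dir 2 ^^ (\<beta> $ 2)) ((pderiv_dir 3 ^^ (\<beta> $ 3)) \<phi>))"

definition locally_integrable :: "(real^3) set \<Rightarrow> (real^3 \<Rightarrow> real) \<Rightarrow> bool" where
  "locally_integrable \<Omega> u \<longleftrightarrow> (\<forall>K. compact K \<and> K \<subseteq> \<Omega> \<longrightarrow> u absolutely_integrable_on K)"

definition has_weak_deriv ::
    "(real^3) set \<Rightarrow> nat^3 \<Rightarrow> (real^3 \<Rightarrow> real) \<Rightarrow> (real^3 \<Rightarrow> real) \<Rightarrow> bool" where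
  "has_weak_deriv \<Omega> \<beta> u w \<longleftrightarrow>
     locally_integrable \<Omega> u \<and> locally_integrable \<Omega> w \<and>
     (\<forall>\<phi>. test_fun \<Omega> \<phi> \<longrightarrow>
        (\<integral>x. u x * mi_deriv \<beta> \<phi> x \<partial>lebesgue_on \<Omega>) =
        (-1) ^ mi_order \<beta> * (\<integral>x. w x * \<phi> x \<partial>lebesgue_on \<Omega>))"

text \<open>Elements of Lebesgue and Sobolev spaces are handled through representatives, whose values
  outside \<open>\<Omega>\<close> are irrelevant. The weak derivative is determined up to a null set; \<open>weak_deriv\<close>
  picks a representative, and it is only used where null sets do not matter.\<close>
definition weak_deriv ::
    "(real^3) set \<Rightarrow> nat^3 \<Rightarrow> (real^3 \<Rightarrow> real) \<Rightarrow> real^3 \<Rightarrow> real" where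
  "weak_deriv \<Omega> \<beta> u = (SOME w. has_weak_deriv \<Omega> \<beta> u w)"

definition square_integrable :: "(real^3) set \<Rightarrow> (real^3 \<Rightarrow> real) \<Rightarrow> bool" where
  "square_integrable \<Omega> u \<longleftrightarrow>
     u \<in> borel_measurable (lebesgue_on \<Omega>) \<and> integrable (lebesgue_on \<Omega>) (\<lambda>x. (u x)\<^sup>2)"

definition in_sobolev :: "(real^3) set \<Rightarrow> nat \<Rightarrow> (real^3 \<Rightarrow> real) \<Rightarrow> bool" where
  "in_sobolev \<Omega> s u \<longleftrightarrow> square_integrable \<Omega> u \<and>
     (\<forall>\<beta>. mi_order \<beta> \<le> s \<longrightarrow> (\<exists>w. has_weak_deriv \<Omega> \<beta> u w \<and> square_integrable \<Omega> w))"

definition sobolev_norm :: "(real^3) set \<Rightarrow> nat \<Rightarrow> (real^3 \<Rightarrow> real) \<Rightarrow> real" where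
  "sobolev_norm \<Omega> s u =
     sqrt (\<Sum>\<beta> | mi_order \<beta> \<le> s. \<integral>x. (weak_deriv \<Omega> \<beta> u x)\<^sup>2 \<partial>lebesgue_on \<Omega>)"

text \<open>A complex vector function \<open>(v\<^sub>0, \<dots>, v\<^sub>N\<^sub>-\<^sub>1)\<close> is a function on indices, of which only the
  components with index below \<open>N\<close> are used. It is identified with the real vector
  function with \<open>2N\<close> components formed by its real and imaginary parts.\<close>
type_synonym vecfun = "nat \<Rightarrow> real^3 \<Rightarrow> complex"

definition sobolev_vec :: "(real^3) set \<Rightarrow> nat \<Rightarrow> nat \<Rightarrow> vecfun set" where
  "sobolev_vec \<Omega> s N = {V. \<forall>n<N.
     in_sobolev \<Omega> s (\<lambda>x. Re (V n x)) \<and> in_sobolev \<Omega> s (\<lambda>x. Im (V n x))}"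

definition sobolev_vec_norm :: "(real^3) set \<Rightarrow> nat \<Rightarrow> nat \<Rightarrow> vecfun \<Rightarrow> real" where
  "sobolev_vec_norm \<Omega> s N V = sqrt (\<Sum>n<N.
     (sobolev_norm \<Omega> s (\<lambda>x. Re (V n x)))\<^sup>2 + (sobolev_norm \<Omega> s (\<lambda>x. Im (V n x)))\<^sup>2)"

definition weak_cderiv ::
    "(real^3) set \<Rightarrow> nat^3 \<Rightarrow> (real^3 \<Rightarrow> complex) \<Rightarrow> real^3 \<Rightarrow> complex" where
  "weak_cderiv \<Omega> \<beta> v x =
     Complex (weak_deriv \<Omega> \<beta> (\<lambda>x. Re (v x)) x) (weak_deriv \<Omega> \<beta> (\<lambda>x. Im (v x)) x)"

definition weak_grad :: "(real^3) set \<Rightarrow> (real^3 \<Rightarrow> complex) \<Rightarrow> real^3 \<Rightarrow> complex^3" where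
  "weak_grad \<Omega> v x = (\<chi> j. weak_cderiv \<Omega> (axis j 1) v x)"

definition weak_laplacian :: "(real^3) set \<Rightarrow> (real^3 \<Rightarrow> complex) \<Rightarrow> real^3 \<Rightarrow> complex" where
  "weak_laplacian \<Omega> v x = (\<Sum>j\<in>UNIV. weak_cderiv \<Omega> (axis j 2) v x)"

section \<open>The differential operator \<open>L\<close>\<close>

text \<open>Gram--Schmidt orthonormalization of \<open>\<alpha>\<^sup>n e\<^sup>\<alpha>\<close> in \<open>L\<^sup>2(-a,a)\<close>.\<close>
definition ip :: "real \<Rightarrow> (real \<Rightarrow> real) \<Rightarrow> (real \<Rightarrow> real) \<Rightarrow> real" where
  "ip a f g = integral {-a..a} (\<lambda>t. f t * g t)"

fun Psi :: "real \<Rightarrow> nat \<Rightarrow> real \<Rightarrow> real" where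
  "Psi a n = (let u = (\<lambda>t. t ^ n * exp t -
                 (\<Sum>j<n. ip a (\<lambda>t. t ^ n * exp t) (Psi a j) * Psi a j t))
              in (\<lambda>t. u t / sqrt (ip a u u)))"

declare Psi.simps [simp del]

definition S_mat :: "real \<Rightarrow> nat \<Rightarrow> real mat" where
  "S_mat a N = Matrix.mat N N (\<lambda>(m, n). integral {-a..a} (\<lambda>\<alpha>. deriv (Psi a n) \<alpha> * Psi a m \<alpha>))"

definition cdot :: "complex^3 \<Rightarrow> complex^3 \<Rightarrow> complex" where
  "cdot A B = (\<Sum>j\<in>UNIV. A $ j * B $ j)"

definition source_pos :: "real \<Rightarrow> real \<Rightarrow> real^3" where
  "source_pos d \<alpha> = vector [\<alpha>, 0, - d]"

definition x_tilde :: "real \<Rightarrow> real \<Rightarrow> real^3 \<Rightarrow> real \<Rightarrow> complex^3" where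
  "x_tilde k d x \<alpha> = (\<chi> j.
      \<i> * of_real k * of_real ((x - source_pos d \<alpha>) $ j) / of_real (norm (x - source_pos d \<alpha>))
      - of_real ((x - source_pos d \<alpha>) $ j) / of_real ((norm (x - source_pos d \<alpha>))\<^sup>2))"

definition x_hat :: "real \<Rightarrow> real \<Rightarrow> real^3 \<Rightarrow> real \<Rightarrow> complex^3" where
  "x_hat k d x \<alpha> = vector_derivative (x_tilde k d x) (at \<alpha>)"

definition f_op :: "real \<Rightarrow> real \<Rightarrow> real \<Rightarrow> real \<Rightarrow> nat \<Rightarrow> vecfun \<Rightarrow> vecfun" where
  "f_op R d a k N V m x =
     2 * (\<Sum>n<N. \<Sum>l<N. cdot (weak_grad (cube R) (V n) x) (weak_grad (cube R) (V l) x) *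
            of_real (integral {-a..a} (\<lambda>\<alpha>. Psi a m \<alpha> * Psi a n \<alpha> * deriv (Psi a l) \<alpha>)))
   + 2 * (\<Sum>n<N. integral {-a..a} (\<lambda>\<alpha>. of_real (Psi a m \<alpha> * deriv (Psi a n) \<alpha>) *
            cdot (weak_grad (cube R) (V n) x) (x_tilde k d x \<alpha>)))
   + 2 * (\<Sum>n<N. integral {-a..a} (\<lambda>\<alpha>. of_real (Psi a m \<alpha> * Psi a n \<alpha>) *
            cdot (x_hat k d x \<alpha>) (weak_grad (cube R) (V n) x)))"

definition K_op :: "real \<Rightarrow> real \<Rightarrow> real \<Rightarrow> real \<Rightarrow> nat \<Rightarrow> vecfun \<Rightarrow> vecfun" where
  "K_op R d a k N V m x =
     (\<Sum>l<N. of_real (the (mat_inverse (S_mat a N)) $$ (m, l)) * f_op R d a k N V l x)"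

definition L_op :: "real \<Rightarrow> real \<Rightarrow> real \<Rightarrow> real \<Rightarrow> nat \<Rightarrow> vecfun \<Rightarrow> vecfun" where
  "L_op R d a k N V m x = weak_laplacian (cube R) (V m) x + K_op R d a k N V m x"

section \<open>The functional \<open>J\<close> and its admissible sets\<close>

definition J_fun ::
    "real \<Rightarrow> real \<Rightarrow> real \<Rightarrow> real \<Rightarrow> real \<Rightarrow> nat \<Rightarrow> real \<Rightarrow> real \<Rightarrow> vecfun \<Rightarrow> real" where
  "J_fun R d a k r N lam \<gamma> V =
     exp (- 2 * lam * (R + r)\<^sup>2) *
       (\<integral>x. (\<Sum>m<N. (cmod (L_op R d a k N V m x))\<^sup>2) * exp (2 * lam * (x $ 3 - r)\<^sup>2)
          \<partial>lebesgue_on (cube R))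
     + \<gamma> * (sobolev_vec_norm (cube R) 3 N V)\<^sup>2"

text \<open>Boundary values on \<open>S \<subseteq> \<partial>\<Omega>\<close>. Since \<open>H\<^sup>3(\<Omega>)\<close> embeds into \<open>C\<^sup>1\<close> up to the boundary in dimension
  three, \<open>V\<close> and \<open>V\<^sub>z\<close> have representatives that are continuous on the closure of \<open>\<Omega>\<close>; the boundary
  values are those of the (unique) continuous representative.\<close>
definition has_bdry_values ::
    "(real^3) set \<Rightarrow> nat \<Rightarrow> (real^3) set \<Rightarrow> vecfun \<Rightarrow> vecfun \<Rightarrow> bool" where
  "has_bdry_values \<Omega> N S V g \<longleftrightarrow> (\<forall>n<N. \<exists>w. continuous_on (closure \<Omega>) w \<and>
     (AE x in lebesgue_on \<Omega>. w x = V n x) \<and> (\<forall>x\<in>S. w x = g n x))"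

definition cauchy_data :: "real \<Rightarrow> nat \<Rightarrow> vecfun \<Rightarrow> vecfun \<Rightarrow> vecfun \<Rightarrow> bool" where
  "cauchy_data R N V \<psi>0 \<psi>1 \<longleftrightarrow>
     has_bdry_values (cube R) N (frontier (cube R)) V \<psi>0 \<and>
     has_bdry_values (cube R) N (bottom_face R) (\<lambda>n. weak_cderiv (cube R) (axis 3 1) (V n)) \<psi>1"

definition B_set :: "real \<Rightarrow> nat \<Rightarrow> real \<Rightarrow> vecfun \<Rightarrow> vecfun \<Rightarrow> vecfun set" where
  "B_set R N M \<psi>0 \<psi>1 = {V \<in> sobolev_vec (cube R) 3 N.
     sobolev_vec_norm (cube R) 3 N V < M \<and> cauchy_data R N V \<psi>0 \<psi>1}"

definition B_closure :: "real \<Rightarrow> nat \<Rightarrow> real \<Rightarrow> vecfun \<Rightarrow> vecfun \<Rightarrow> vecfun set" where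
  "B_closure R N M \<psi>0 \<psi>1 = {V \<in> sobolev_vec (cube R) 3 N.
     \<forall>\<epsilon>>0. \<exists>W \<in> B_set R N M \<psi>0 \<psi>1. sobolev_vec_norm (cube R) 3 N (V - W) < \<epsilon>}"

definition H30 :: "real \<Rightarrow> nat \<Rightarrow> vecfun set" where
  "H30 R N = {h \<in> sobolev_vec (cube R) 3 N. cauchy_data R N h (\<lambda>n x. 0) (\<lambda>n x. 0)}"

text \<open>\<open>D\<close> is the Frechet derivative of \<open>J\<close> at \<open>V\<close> with respect to increments in \<open>H30\<close>: a bounded
  real-linear functional on \<open>H30\<close>, with the norm of \<open>H\<^sup>3\<close>. Its values outside \<open>H30\<close> are irrelevant.\<close>
definition has_frechet_deriv_H30 ::
    "real \<Rightarrow> nat \<Rightarrow> (vecfun \<Rightarrow> real) \<Rightarrow> vecfun \<Rightarrow> (vecfun \<Rightarrow> real) \<Rightarrow> bool" where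
  "has_frechet_deriv_H30 R N J V D \<longleftrightarrow>
     (\<forall>h\<in>H30 R N. \<forall>g\<in>H30 R N. D (\<lambda>n x. h n x + g n x) = D h + D g) \<and>
     (\<forall>h\<in>H30 R N. \<forall>c::real. D (\<lambda>n x. of_real c * h n x) = c * D h) \<and>
     (\<exists>C. \<forall>h\<in>H30 R N. \<bar>D h\<bar> \<le> C * sobolev_vec_norm (cube R) 3 N h) \<and>
     (\<forall>\<epsilon>>0. \<exists>\<eta>>0. \<forall>h\<in>H30 R N. sobolev_vec_norm (cube R) 3 N h < \<eta> \<longrightarrow>
        \<bar>J (\<lambda>n x. V n x + h n x) - J V - D h\<bar> \<le> \<epsilon> * sobolev_vec_norm (cube R) 3 N h)"

text \<open>The number \<open>l\<close> is a strict convexity threshold for the radius \<open>M\<close>. The constant \<open>C1\<close> may depend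
  on \<open>lam\<close> but not on \<open>\<gamma>\<close>, the boundary data or the functions \<open>V1\<close>, \<open>V2\<close>.\<close>
definition convexity_threshold ::
    "real \<Rightarrow> real \<Rightarrow> real \<Rightarrow> real \<Rightarrow> real \<Rightarrow> nat \<Rightarrow> real \<Rightarrow> real \<Rightarrow> bool" where
  "convexity_threshold R d a k r N M l \<longleftrightarrow> 1 < l \<and>
     (\<forall>lam\<ge>l. \<exists>C1>0. \<forall>\<gamma> \<psi>0 \<psi>1 V1 V2.
        0 < \<gamma> \<and> \<gamma> < 1 \<and> V1 \<in> B_closure R N M \<psi>0 \<psi>1 \<and> V2 \<in> B_closure R N M \<psi>0 \<psi>1 \<longrightarrow>
        (\<exists>D. has_frechet_deriv_H30 R N (J_fun R d a k r N lam \<gamma>) V1 D \<and>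
             J_fun R d a k r N lam \<gamma> V2 - J_fun R d a k r N lam \<gamma> V1 - D (V2 - V1)
               \<ge> C1 * (sobolev_vec_norm (cube R) 2 N (V2 - V1))\<^sup>2
                 + \<gamma> * (sobolev_vec_norm (cube R) 3 N (V2 - V1))\<^sup>2))"

end

theory Submission
  imports Defs "HOL-Real_Asymp.Real_Asymp"
begin

text \<open>The ideal solution \<open>V\<^sup>*\<close> has the noiseless boundary data and therefore does not compete with the
  minimizer. It is shifted: \<open>V' = V\<^sup>* + (G - G\<^sup>*)\<close> has the noisy data, lies in \<open>B(M)\<close> and is within
  \<open>\<delta>\<close> of \<open>V\<^sup>*\<close> in \<open>H\<^sup>3\<close>. Since \<open>L(V\<^sup>*) = 0\<close>, only the increment contributes to \<open>L(V')\<close>, so that with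
  \<open>\<gamma> = \<delta>\<^sup>2\<close> the value \<open>J(V')\<close> is at most a constant times \<open>\<delta>\<^sup>2\<close>. By strict convexity, a function
  whose value exceeds the minimum by \<open>O(\<delta>\<^sup>2)\<close> is within \<open>O(\<delta>)\<close> of the minimizer in \<open>H\<^sup>2\<close>.

  The derivative of \<open>J\<close> is linear only on increments with vanishing Cauchy data, while the minimizer
  is merely a limit of functions with the prescribed data. To bridge this gap, the minimizer is
  replaced by an element \<open>W\<close> of \<open>B(M)\<close> that is close to it in \<open>H\<^sup>3\<close>. Then \<open>V'\<close>,
  \<open>W\<close> and their midpoint lie in \<open>B(M)\<close>, the derivative terms at the midpoint cancel, and
  \<open>midpoint_convexity\<close> bounds \<open>\<parallel>V' - W\<parallel>\<^sup>2\<close> by \<open>J(V') + J(W)\<close> minus twice the minimum. The value \<open>J(W)\<close>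
  exceeds the minimum only slightly by \<open>J_fun_upper_semicontinuous\<close>.

  Both the size of \<open>J(V')\<close> and the semicontinuity rest on an \<open>L\<^sup>2\<close> bound of \<open>L(V + U) - L(V)\<close> by the
  \<open>H\<^sup>3\<close> norms of \<open>U\<close> and \<open>V\<close> (\<open>L_op_difference_bound\<close>). As \<open>L\<close> is quadratic in the gradient, this is
  a bound for the integral of \<open>f\<^sup>2 g\<^sup>2\<close>, where \<open>f\<close> and \<open>g\<close> are first derivatives. It is
  obtained one direction at a time: along almost every line a function is bounded by the integrals of itself and of its
  derivative along that line (\<open>slice_bound\<close>). Used in the directions \<open>x\<close> and \<open>y\<close>, this dominates
  \<open>f\<close> by a function of \<open>z\<close>; used in the direction \<open>z\<close>, it dominates \<open>g\<close> by a function of \<open>(x, y)\<close>.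
  The integral of a product of functions of complementary variables factorizes
  (\<open>mixed_product_bound\<close>).

  Weak derivatives are tested with tensor products of bumps in one variable. These
  suffice to separate locally integrable functions (\<open>AE_zero_if_tensor_integrals_zero\<close>), which makes
  weak derivatives unique, and their partial derivatives are again tensor products.\<close>

abbreviation leb_cube :: "real \<Rightarrow> (real^3) measure" where
  "leb_cube R \<equiv> lebesgue_on (cube R)"

abbreviation H3 :: "real \<Rightarrow> nat \<Rightarrow> vecfun set" where
  "H3 R N \<equiv> sobolev_vec (cube R) 3 N"

abbreviation H3_norm :: "real \<Rightarrow> nat \<Rightarrow> vecfun \<Rightarrow> real" where
  "H3_norm R N \<equiv> sobolev_vec_norm (cube R) 3 N"

abbreviation wderiv :: "real \<Rightarrow> nat^3 \<Rightarrow> (real^3 \<Rightarrow> real) \<Rightarrow> real^3 \<Rightarrow> real" where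
  "wderiv R \<equiv> weak_deriv (cube R)"

abbreviation wcderiv :: "real \<Rightarrow> nat^3 \<Rightarrow> (real^3 \<Rightarrow> complex) \<Rightarrow> real^3 \<Rightarrow> complex" where
  "wcderiv R \<equiv> weak_cderiv (cube R)"

section \<open>Smooth functions of one variable\<close>

text \<open>Recursion on the derivative makes closure under products an immediate induction.\<close>
fun kdiff :: "nat \<Rightarrow> (real \<Rightarrow> real) \<Rightarrow> bool" where
  "kdiff 0 f = True"
| "kdiff (Suc n) f = (\<exists>f'. (\<forall>x. (f has_real_derivative f' x) (at x)) \<and> kdiff n f')"

definition smooth1 :: "(real \<Rightarrow> real) \<Rightarrow> bool" where
  "smooth1 f \<longleftrightarrow> (\<forall>n. kdiff n f)"

lemma kdiff_Suc_D: "kdiff (Suc n) f \<Longrightarrow> kdiff n f"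
  by (induction n arbitrary: f) auto

lemma kdiff_SucI:
  "(\<And>x. (f has_real_derivative f' x) (at x)) \<Longrightarrow> kdiff n f' \<Longrightarrow> kdiff (Suc n) f"
  by auto

lemma kdiff_const: "kdiff n (\<lambda>x. c)"
proof (induction n arbitrary: c)
  case (Suc n)
  show ?case by (rule kdiff_SucI[OF _ Suc[of 0]]) auto
qed simp

lemma kdiff_add: "kdiff n f \<Longrightarrow> kdiff n g \<Longrightarrow> kdiff n (\<lambda>x. f x + g x)"
proof (induction n arbitrary: f g)
  case (Suc n)
  then obtain f' g' where *: "\<forall>x. (f has_real_derivative f' x) (at x)" "kdiff n f'"
    "\<forall>x. (g has_real_derivative g' x) (at x)" "kdiff n g'" by auto
  then show ?case using Suc.IH[OF *(2,4)] by (intro kdiff_SucI[where f'="\<lambda>x. f' x + g' x"]) (auto intro: DERIV_add)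
qed simp

lemma kdiff_mult: "kdiff n f \<Longrightarrow> kdiff n g \<Longrightarrow> kdiff n (\<lambda>x. f x * g x)"
proof (induction n arbitrary: f g)
  case (Suc n)
  then obtain f' g' where *: "\<forall>x. (f has_real_derivative f' x) (at x)" "kdiff n f'"
    "\<forall>x. (g has_real_derivative g' x) (at x)" "kdiff n g'" by auto
  have "kdiff n (\<lambda>x. f' x * g x + g' x * f x)"
    using Suc.IH * kdiff_Suc_D[OF Suc.prems(1)] kdiff_Suc_D[OF Suc.prems(2)]
    by (intro kdiff_add) blast+
  then show ?case using * by (intro kdiff_SucI[where f'="\<lambda>x. f' x * g x + g' x * f x"]) (auto intro: DERIV_mult)
qed simp

lemma kdiff_affine: "kdiff n f \<Longrightarrow> kdiff n (\<lambda>x. f (c * x + d))"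
proof (induction n arbitrary: f)
  case (Suc n)
  then obtain f' where *: "\<forall>x. (f has_real_derivative f' x) (at x)" "kdiff n f'" by auto
  have d: "((\<lambda>x. f (c * x + d)) has_real_derivative f' (c * x + d) * c) (at x)" for x
    using *(1) by (intro DERIV_chain2[where f=f]) (auto intro!: derivative_eq_intros)
  show ?case by (rule kdiff_SucI[OF d kdiff_mult[OF Suc.IH[OF *(2)] kdiff_const]])
qed simp

lemma smooth1_const [intro]: "smooth1 (\<lambda>x. c)"
  and smooth1_add [intro]: "smooth1 f \<Longrightarrow> smooth1 g \<Longrightarrow> smooth1 (\<lambda>x. f x + g x)"
  and smooth1_mult [intro]: "smooth1 f \<Longrightarrow> smooth1 g \<Longrightarrow> smooth1 (\<lambda>x. f x * g x)"
  and smooth1_affine: "smooth1 f \<Longrightarrow> smooth1 (\<lambda>x. f (c * x + d))"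
  by (auto simp: smooth1_def intro: kdiff_const kdiff_add kdiff_mult kdiff_affine)

lemma smooth1_antideriv:
  assumes "\<And>x. (f has_real_derivative f' x) (at x)" "smooth1 f'"
  shows "smooth1 f"
  unfolding smooth1_def
proof
  fix n show "kdiff n f" using assms by (cases n) (auto simp: smooth1_def)
qed

lemma smooth1_has_deriv: "smooth1 f \<Longrightarrow> (f has_real_derivative deriv f x) (at x)"
  using DERIV_imp_deriv[of f _ x] by (auto simp: smooth1_def dest!: spec[of _ "Suc 0"]) metis

lemma smooth1_deriv [intro]: assumes "smooth1 f" shows "smooth1 (deriv f)"
  unfolding smooth1_def
proof
  fix n
  obtain f' where *: "\<forall>x. (f has_real_derivative f' x) (at x)" "kdiff n f'"
    using assms by (auto simp: smooth1_def dest!: spec[of _ "Suc n"])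
  then have "f' = deriv f" by (metis DERIV_imp_deriv ext)
  with * show "kdiff n (deriv f)" by simp
qed

lemma smooth1_funpow_deriv: "smooth1 f \<Longrightarrow> smooth1 ((deriv ^^ n) f)"
  by (induction n) auto

lemma smooth1_sum: "(\<And>i. i \<in> A \<Longrightarrow> smooth1 (f i)) \<Longrightarrow> smooth1 (\<lambda>x. \<Sum>i\<in>A. f i x)"
  by (induction A rule: infinite_finite_induct) auto

lemma smooth1_continuous: "smooth1 f \<Longrightarrow> continuous_on S f"
  by (meson DERIV_continuous_on smooth1_has_deriv has_field_derivative_at_within)

lemma smooth1_power: "smooth1 (\<lambda>t. t ^ n)"
proof (induction n)
  case (Suc n)
  have "smooth1 (\<lambda>x::real. x)"
    by (rule smooth1_antideriv[where f'="\<lambda>x. 1"]) auto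
  then show ?case using smooth1_mult[OF _ Suc] by simp
qed auto

lemma smooth1_exp: "smooth1 exp"
proof -
  have "kdiff n exp" for n
    by (induction n) (auto intro!: exI[of _ exp] derivative_eq_intros)
  then show ?thesis by (simp add: smooth1_def)
qed

text \<open>For \<open>P = 1\<close> the classical function that is flat at the origin. The polynomial in \<open>1 / t\<close> makes the
  family closed under differentiation.\<close>
definition flat_exp :: "real poly \<Rightarrow> real \<Rightarrow> real" where
  "flat_exp P t = (if t > 0 then poly P (1 / t) * exp (- 1 / t) else 0)"

lemma poly_exp_decay: "((\<lambda>s. poly P s * exp (- s)) \<longlongrightarrow> (0::real)) at_top"
proof (induction P)
  case (pCons a P)
  have "((\<lambda>s. s * (poly P s * exp (- s))) \<longlongrightarrow> 0) at_top"
  proof -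
    have "((\<lambda>s. \<Sum>i\<le>degree P. coeff P i * (s ^ Suc i / exp s)) \<longlongrightarrow> (\<Sum>i\<le>degree P. coeff P i * 0)) at_top"
      by (intro tendsto_intros tendsto_power_div_exp_0)
    moreover have "(\<Sum>i\<le>degree P. coeff P i * (s ^ Suc i / exp s)) = s * (poly P s * exp (- s))" for s
      by (simp add: poly_altdef sum_distrib_left sum_distrib_right exp_minus field_simps)
    ultimately show ?thesis by simp
  qed
  moreover have "((\<lambda>s. a * (s ^ 0 / exp s)) \<longlongrightarrow> a * 0) at_top"
    by (intro tendsto_intros tendsto_power_div_exp_0)
  ultimately have "((\<lambda>s. a * (s ^ 0 / exp s) + s * (poly P s * exp (- s))) \<longlongrightarrow> a * 0 + 0) at_top"
    by (intro tendsto_add)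
  then show ?case by (simp add: algebra_simps exp_minus divide_inverse)
qed simp

text \<open>At the origin, the difference quotient from the right is a polynomial in \<open>1 / t\<close> times \<open>exp (- 1 / t)\<close> and tends to
  zero; elsewhere this is the chain rule.\<close>
lemma flat_exp_has_deriv:
  "(flat_exp P has_real_derivative flat_exp ([:0, 0, 1:] * (P - pderiv P)) t) (at t)"
proof -
  consider "t > 0" | "t < 0" | "t = 0" by linarith
  then show ?thesis
  proof cases
    case 1
    have "((\<lambda>t. poly P (1 / t) * exp (- 1 / t)) has_real_derivative
        flat_exp ([:0, 0, 1:] * (P - pderiv P)) t) (at t)"
      using 1 by (auto simp: flat_exp_def field_simps power2_eq_square
            intro!: derivative_eq_intros DERIV_chain2[OF poly_DERIV])
    moreover have "eventually (\<lambda>s. flat_exp P s = poly P (1 / s) * exp (- 1 / s)) (nhds t)"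
      using eventually_nhds_in_open[of "{0<..}" t] 1
      by (auto elim!: eventually_mono simp: flat_exp_def)
    ultimately show ?thesis by (subst DERIV_cong_ev[OF refl _ refl])
  next
    case 2
    have "eventually (\<lambda>s. flat_exp P s = 0) (nhds t)"
      using eventually_nhds_in_open[of "{..<0}" t] 2
      by (auto elim!: eventually_mono simp: flat_exp_def)
    moreover have "flat_exp ([:0, 0, 1:] * (P - pderiv P)) t = 0" using 2 by (simp add: flat_exp_def)
    ultimately show ?thesis by (subst DERIV_cong_ev[OF refl _ refl]) auto
  next
    case 3
    have *: "((\<lambda>h. flat_exp P h / h) \<longlongrightarrow> 0) (at_right 0)"
    proof -
      have "filterlim (\<lambda>h::real. inverse h) at_top (at_right 0)" by (rule filterlim_inverse_at_top_right)
      from filterlim_compose[OF poly_exp_decay[of "pCons 0 P"] this]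
      have "((\<lambda>h. poly (pCons 0 P) (inverse h) * exp (- inverse h)) \<longlongrightarrow> 0) (at_right 0)" .
      moreover have "eventually (\<lambda>h. poly (pCons 0 P) (inverse h) * exp (- inverse h) = flat_exp P h / h) (at_right (0::real))"
        using eventually_at_right_less[of 0]
        by eventually_elim (auto simp: flat_exp_def field_simps)
      ultimately show ?thesis using tendsto_cong by force
    qed
    have "((\<lambda>h. flat_exp P h / h) \<longlongrightarrow> 0) (at_left 0)"
      by (rule tendsto_eventually) (auto simp: eventually_at_filter flat_exp_def)
    with * have "((\<lambda>h. flat_exp P h / h) \<longlongrightarrow> 0) (at 0)"
      using filterlim_split_at by blast
    then show ?thesis using 3 by (auto simp: DERIV_def flat_exp_def)
  qed
qed

lemma smooth1_flat_exp: "smooth1 (flat_exp P)"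
proof -
  have "kdiff n (flat_exp P)" for n
    by (induction n arbitrary: P) (auto intro: flat_exp_has_deriv)
  then show ?thesis by (simp add: smooth1_def)
qed

text \<open>For \<open>n > 0\<close> the function is positive exactly on \<open>(a, b)\<close>. The dilation by \<open>n\<close> drives both factors to
  1 there, so that indicators of open intervals are limits of bumps that vanish outside of the interval.\<close>
definition bump :: "real \<Rightarrow> real \<Rightarrow> nat \<Rightarrow> real \<Rightarrow> real" where
  "bump a b n t = flat_exp 1 (real n * (t - a)) * flat_exp 1 (real n * (b - t))"

lemma smooth1_bump: "smooth1 (bump a b n)"
proof -
  have "smooth1 (\<lambda>t. flat_exp 1 (real n * t + (- real n * a)) * flat_exp 1 ((- real n) * t + real n * b))"
    by (intro smooth1_mult smooth1_affine smooth1_flat_exp)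
  then show ?thesis unfolding bump_def by (simp add: algebra_simps)
qed

lemma flat_exp_1_bounds: "0 \<le> flat_exp 1 t" "flat_exp 1 t \<le> 1" by (auto simp: flat_exp_def)

lemma bump_bounds: "0 \<le> bump a b n t" "bump a b n t \<le> 1"
  by (auto simp: bump_def intro!: mult_le_one flat_exp_1_bounds mult_nonneg_nonneg)

lemma bump_eq_0: "t \<le> a \<or> b \<le> t \<Longrightarrow> bump a b n t = 0"
  by (auto simp: bump_def flat_exp_def zero_less_mult_iff)

lemma bump_pos: "a < t \<Longrightarrow> t < b \<Longrightarrow> n > 0 \<Longrightarrow> bump a b n t > 0"
  by (auto simp: bump_def flat_exp_def)

lemma bump_tendsto: "(\<lambda>n. bump a b n t) \<longlonglongrightarrow> indicator {a<..<b} t"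
proof (cases "a < t \<and> t < b")
  case True
  have *: "(\<lambda>n. flat_exp 1 (real n * c)) \<longlonglongrightarrow> 1" if "c > 0" for c
  proof -
    have "(\<lambda>n. exp (- (inverse (real n) * inverse c))) \<longlonglongrightarrow> exp (- (0 * inverse c))"
      by (intro tendsto_intros lim_inverse_n)
    moreover have "eventually (\<lambda>n. exp (- (inverse (real n) * inverse c)) = flat_exp 1 (real n * c)) sequentially"
      using eventually_gt_at_top[of 0] by eventually_elim (use that in \<open>auto simp: flat_exp_def field_simps\<close>)
    ultimately show ?thesis using tendsto_cong by force
  qed
  have "(\<lambda>n. bump a b n t) \<longlonglongrightarrow> 1 * 1"
    unfolding bump_def using True by (intro tendsto_mult *) auto
  then show ?thesis using True by simp
next
  case False
  then have "bump a b n t = 0" for n by (intro bump_eq_0) auto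
  then show ?thesis using False by auto
qed

definition test1 :: "real \<Rightarrow> (real \<Rightarrow> real) \<Rightarrow> bool" where
  "test1 R p \<longleftrightarrow> smooth1 p \<and> (\<exists>c. 0 < c \<and> c < R \<and> (\<forall>t. \<bar>t\<bar> \<ge> c \<longrightarrow> p t = 0))"

lemma test1_bump:
  assumes "- R < a" "b < R" "0 < R" shows "test1 R (bump a b n)"
  unfolding test1_def
proof (intro conjI smooth1_bump exI allI impI)
  let ?c = "max (R/2) (max (-a) b)"
  show "0 < ?c" "?c < R" using assms by auto
  fix t assume "?c \<le> \<bar>t\<bar>"
  then show "bump a b n t = 0" by (intro bump_eq_0) linarith
qed

lemma test1_deriv: assumes "test1 R p" shows "test1 R (deriv p)"
proof -
  obtain c where c: "0 < c" "c < R" "\<And>t. \<bar>t\<bar> \<ge> c \<Longrightarrow> p t = 0" using assms by (auto simp: test1_def)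
  have "deriv p t = 0" if "\<bar>t\<bar> \<ge> (c + R) / 2" for t
  proof -
    have "t \<in> {s. \<bar>s\<bar> > c}" "open {s::real. \<bar>s\<bar> > c}"
      using that c by (auto intro!: open_Collect_less continuous_intros)
    then have "eventually (\<lambda>s. p s = 0) (nhds t)"
      using eventually_nhds_in_open c by (metis (mono_tags, lifting) eventually_mono less_imp_le mem_Collect_eq)
    then have "(p has_real_derivative 0) (at t)" by (subst DERIV_cong_ev[OF refl _ refl]) auto
    then show ?thesis by (rule DERIV_imp_deriv)
  qed
  then show ?thesis using assms c unfolding test1_def
    by (intro conjI smooth1_deriv exI[of _ "(c+R)/2"]) auto
qed

lemma test1_lin: assumes "test1 R p" "test1 R q" shows "test1 R (\<lambda>t. p t - m * q t)"
proof -
  obtain c where c: "0 < c" "c < R" "\<And>t. \<bar>t\<bar> \<ge> c \<Longrightarrow> p t = 0" using assms by (auto simp: test1_def)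
  obtain c' where c': "0 < c'" "c' < R" "\<And>t. \<bar>t\<bar> \<ge> c' \<Longrightarrow> q t = 0" using assms by (auto simp: test1_def)
  have "smooth1 (\<lambda>t. p t + (- m) * q t)" using assms
    by (intro smooth1_add smooth1_mult smooth1_const) (auto simp: test1_def)
  then show ?thesis using c c' unfolding test1_def by (auto intro!: exI[of _ "max c c'"])
qed

lemma test1_bounded: assumes "test1 R p" obtains B where "B \<ge> 0" "\<And>t. \<bar>p t\<bar> \<le> B"
proof -
  obtain c where c: "0 < c" "c < R" "\<And>t. \<bar>t\<bar> \<ge> c \<Longrightarrow> p t = 0" using assms by (auto simp: test1_def)
  have "bounded (p ` {-c..c})"
    using assms by (intro compact_imp_bounded compact_continuous_image smooth1_continuous) (auto simp: test1_def)
  then obtain B where B: "\<And>t. t \<in> {-c..c} \<Longrightarrow> \<bar>p t\<bar> \<le> B" unfolding bounded_iff by force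
  have "\<bar>p t\<bar> \<le> max B 0" for t using B[of t] c(3)[of t] by (cases "t \<in> {-c..c}") auto
  then show ?thesis using that[of "max B 0"] by auto
qed

lemma test1_continuous: "test1 R p \<Longrightarrow> continuous_on S p"
  by (auto simp: test1_def intro: smooth1_continuous)

lemma test1_borel: "test1 R p \<Longrightarrow> p \<in> borel_measurable borel"
  by (intro borel_measurable_continuous_onI test1_continuous)

lemma test1_integrable:
  assumes "test1 R p" shows "integrable lborel p"
proof -
  obtain c where c: "0 < c" "c < R" "\<And>t. \<bar>t\<bar> \<ge> c \<Longrightarrow> p t = 0" using assms by (auto simp: test1_def)
  have "integrable lborel (\<lambda>t. indicator {-c..c} t *\<^sub>R p t)"
    by (rule borel_integrable_compact) (auto intro: test1_continuous[OF assms])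
  moreover have "(\<lambda>t. indicator {-c..c} t *\<^sub>R p t) = p"
  proof
    fix t show "indicator {-c..c} t *\<^sub>R p t = p t" using c(3)[of t] by (cases "t \<in> {-c..c}") auto
  qed
  ultimately show ?thesis by simp
qed

text \<open>To the left of the support the primitive vanishes identically, which leaves the fundamental theorem of
  calculus on a bounded interval.\<close>
lemma test1_primitive:
  assumes p: "test1 R p"
  shows "((\<lambda>t. \<integral>z. p z * indicator {z. z < t} z \<partial>lborel) has_real_derivative p t) (at t)"
proof -
  obtain c where c: "0 < c" "c < R" "\<And>t. \<bar>t\<bar> \<ge> c \<Longrightarrow> p t = 0" using p by (auto simp: test1_def)
  define Q where "Q t = (\<integral>z. p z * indicator {z. z < t} z \<partial>lborel)" for t
  have QI: "Q t = integral {-R..t} p" for t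
  proof -
    have "Q t = (\<integral>z. indicator {-R..t} z *\<^sub>R p z \<partial>lborel)"
      unfolding Q_def
    proof (rule integral_cong_AE)
      show "(\<lambda>z. p z * indicator {z. z < t} z) \<in> borel_measurable lborel"
        using test1_borel[OF p] by measurable
      show "(\<lambda>z. indicator {-R..t} z *\<^sub>R p z) \<in> borel_measurable lborel"
        using test1_borel[OF p] by measurable
      show "AE z in lborel. p z * indicator {z. z < t} z = indicator {- R..t} z *\<^sub>R p z"
        using AE_lborel_singleton[of t] by eventually_elim (use c in \<open>auto simp: indicator_def\<close>)
    qed
    also have "\<dots> = integral {-R..t} p"
      using set_borel_integral_eq_integral(2)[of "{-R..t}" p] borel_integrable_compact[of "{-R..t}" p] test1_continuous[OF p]
      by (simp add: set_lebesgue_integral_def set_integrable_def)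
    finally show ?thesis .
  qed
  have "(Q has_real_derivative p t) (at t)"
  proof (cases "t < - c")
    case True
    have "Q s = 0" if "s < -c" for s
      unfolding Q_def using c that by (intro integral_eq_zero_AE) (auto simp: indicator_def)
    then have "eventually (\<lambda>s. Q s = 0) (nhds t)"
      using eventually_nhds_in_open[of "{..< -c}" t] True by (auto elim!: eventually_mono)
    then have "(Q has_real_derivative 0) (at t)" by (subst DERIV_cong_ev[OF refl _ refl]) auto
    then show ?thesis using True c by simp
  next
    case False
    have "((\<lambda>t. integral {-R..t} p) has_real_derivative p t) (at t within {-R..t+1})"
      using False c by (intro integral_has_real_derivative test1_continuous[OF p]) auto
    then have "(Q has_real_derivative p t) (at t within {-R<..<t+1})"
      unfolding QI[abs_def] by (rule DERIV_subset) auto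
    then show ?thesis using False c by (subst (asm) at_within_open) auto
  qed
  then show ?thesis unfolding Q_def[abs_def] .
qed

section \<open>Tensor products as test functions\<close>

definition tens :: "(3 \<Rightarrow> real \<Rightarrow> real) \<Rightarrow> real^3 \<Rightarrow> real" where
  "tens P x = (\<Prod>i\<in>UNIV. P i (x $ i))"

lemma tens_has_derivative:
  assumes "\<And>i. smooth1 (P i)"
  shows "(tens P has_derivative (\<lambda>h. \<Sum>i\<in>UNIV. (deriv (P i) (x $ i) * h $ i) * (\<Prod>k\<in>UNIV - {i}. P k (x $ k)))) (at x)"
  unfolding tens_def[abs_def]
proof (rule has_derivative_prod)
  fix i :: 3
  have "((\<lambda>x. x $ i) has_derivative (\<lambda>h. h $ i)) (at x)"
    by (intro bounded_linear_imp_has_derivative bounded_linear_vec_nth)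
  moreover have "(P i has_derivative (\<lambda>h. deriv (P i) (x $ i) * h)) (at (x $ i))"
    using smooth1_has_deriv[OF assms] by (simp add: has_field_derivative_def)
  ultimately show "((\<lambda>x. P i (x $ i)) has_derivative (\<lambda>h. deriv (P i) (x $ i) * h $ i)) (at x)"
    using has_derivative_compose by fastforce
qed

lemma tens_split: "tens P x = P j (x $ j) * (\<Prod>k\<in>UNIV - {j}. P k (x $ k))"
  unfolding tens_def by (subst prod.remove[of UNIV j]) auto

lemma pderiv_dir_tens:
  assumes "\<And>i. smooth1 (P i)"
  shows "pderiv_dir j (tens P) = tens (P(j := deriv (P j)))"
proof
  fix x
  have "pderiv_dir j (tens P) x = (\<Sum>i\<in>UNIV. (deriv (P i) (x $ i) * (axis j 1 :: real^3) $ i) * (\<Prod>k\<in>UNIV - {i}. P k (x $ k)))"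
    unfolding pderiv_dir_def frechet_derivative_at[OF tens_has_derivative[OF assms], symmetric] ..
  also have "\<dots> = (\<Sum>i\<in>UNIV. if i = j then deriv (P i) (x $ i) * (\<Prod>k\<in>UNIV - {i}. P k (x $ k)) else 0)"
    by (intro sum.cong) (auto simp: axis_def)
  also have "\<dots> = deriv (P j) (x $ j) * (\<Prod>k\<in>UNIV - {j}. P k (x $ k))" by simp
  also have "\<dots> = tens (P(j := deriv (P j))) x" by (subst tens_split[of _ _ j]) simp
  finally show "pderiv_dir j (tens P) x = tens (P(j := deriv (P j))) x" .
qed

lemma pderiv_dir_funpow_tens:
  assumes "\<And>i. smooth1 (P i)"
  shows "(pderiv_dir j ^^ n) (tens P) = tens (P(j := (deriv ^^ n) (P j)))"
proof (induction n)
  case (Suc n)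
  have "pderiv_dir j (tens (P(j := (deriv ^^ n) (P j)))) = tens ((P(j := (deriv ^^ n) (P j)))(j := deriv ((P(j := (deriv ^^ n) (P j))) j)))"
    by (rule pderiv_dir_tens) (auto simp: assms smooth1_funpow_deriv)
  then show ?case by (simp add: Suc del: fun_upd_apply) (simp add: fun_upd_def)
qed simp

text \<open>Each factor is differentiated separately, so that the order of the partial derivatives cannot matter.\<close>
lemma mi_deriv_tens:
  assumes "\<And>i. smooth1 (P i)"
  shows "mi_deriv \<beta> (tens P) = tens (\<lambda>i. (deriv ^^ (\<beta> $ i)) (P i))"
proof -
  let ?P3 = "P(3 := (deriv ^^ (\<beta> $ 3)) (P 3))"
  let ?P2 = "?P3(2 := (deriv ^^ (\<beta> $ 2)) (?P3 2))"
  let ?P1 = "?P2(1 := (deriv ^^ (\<beta> $ 1)) (?P2 1))"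
  have s3: "smooth1 (?P3 i)" for i by (auto simp: assms smooth1_funpow_deriv)
  have s2: "smooth1 (?P2 i)" for i using s3 by (auto simp: assms smooth1_funpow_deriv)
  have "mi_deriv \<beta> (tens P) = tens ?P1"
    unfolding mi_deriv_def by (simp only: pderiv_dir_funpow_tens[OF assms] pderiv_dir_funpow_tens[OF s3] pderiv_dir_funpow_tens[OF s2])
  also have "?P1 = (\<lambda>i. (deriv ^^ (\<beta> $ i)) (P i))"
  proof
    fix i :: 3 show "?P1 i = (deriv ^^ (\<beta> $ i)) (P i)" using exhaust_3[of i] by auto
  qed
  finally show ?thesis .
qed

lemma smooth_fun_tens:
  assumes "\<And>i. smooth1 (P i)" shows "smooth_fun (tens P)"
  unfolding smooth_fun_def
proof (intro allI)
  fix js x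
  have "\<exists>Q. (\<forall>i. smooth1 (Q i)) \<and> foldr pderiv_dir js (tens P) = tens Q"
  proof (induction js)
    case (Cons j js)
    then obtain Q where Q: "\<forall>i. smooth1 (Q i)" "foldr pderiv_dir js (tens P) = tens Q" by blast
    then have "foldr pderiv_dir (j # js) (tens P) = tens (Q(j := deriv (Q j)))" using pderiv_dir_tens[of Q j] by simp
    moreover have "\<forall>i. smooth1 ((Q(j := deriv (Q j))) i)" using Q smooth1_deriv by simp
    ultimately show ?case by blast
  qed (use assms in auto)
  then obtain Q where Q: "\<forall>i. smooth1 (Q i)" "foldr pderiv_dir js (tens P) = tens Q" by blast
  then show "foldr pderiv_dir js (tens P) differentiable at x"
    using differentiableI[OF tens_has_derivative[of Q x]] by simp
qed

lemma tens_eq_0: "P i (x $ i) = 0 \<Longrightarrow> tens P x = 0"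
  by (auto simp: tens_split[of _ _ i])

lemma test_fun_tens:
  assumes "\<And>i. test1 R (P i)" shows "test_fun (cube R) (tens P)"
proof -
  have "\<forall>i. \<exists>c. 0 < c \<and> c < R \<and> (\<forall>t. \<bar>t\<bar> \<ge> c \<longrightarrow> P i t = 0)" using assms by (auto simp: test1_def)
  then obtain c where c: "\<And>i. 0 < c i \<and> c i < R \<and> (\<forall>t. \<bar>t\<bar> \<ge> c i \<longrightarrow> P i t = 0)" by metis
  define K where "K = cbox (- (\<chi> i. c i)) (\<chi> i. c i)"
  have sub: "{x. tens P x \<noteq> 0} \<subseteq> K"
  proof
    fix x assume "x \<in> {x. tens P x \<noteq> 0}"
    then have "P i (x $ i) \<noteq> 0" for i using tens_eq_0[of P i x] by auto
    then have "\<bar>x $ i\<bar> < c i" for i using c[of i] by (meson not_less)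
    then show "x \<in> K" unfolding K_def mem_box_cart using \<open>\<And>i. \<bar>x $ i\<bar> < c i\<close>
      by (auto simp: abs_less_iff) (metis less_imp_le minus_less_iff)+
  qed
  then have cl: "closure {x. tens P x \<noteq> 0} \<subseteq> K"
    by (intro closure_minimal) (auto simp: K_def)
  have "K \<subseteq> cube R"
  proof
    fix x assume "x \<in> K"
    then have "\<bar>x $ i\<bar> \<le> c i" for i unfolding K_def mem_box_cart by (auto simp: abs_le_iff minus_le_iff)
    then have "\<bar>x $ i\<bar> < R" for i using c[of i] by (meson le_less_trans)
    then show "x \<in> cube R" by (auto simp: cube_def)
  qed
  moreover have "compact (closure {x. tens P x \<noteq> 0})"
    unfolding compact_eq_bounded_closed using bounded_subset[OF _ cl] by (auto simp: K_def)
  ultimately show ?thesis using cl assms unfolding test_fun_def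
    by (auto intro: smooth_fun_tens simp: test1_def)
qed

lemma cube_iff: "x \<in> cube R \<longleftrightarrow> (\<forall>i. \<bar>x $ i\<bar> < R)"
  by (auto simp: cube_def forall_3)

lemma cube_eq_box: "cube R = box (- (\<chi> i. R)) (\<chi> i. R)"
  by (auto simp: cube_iff mem_box_cart abs_less_iff) (metis minus_less_iff)+

lemma cube_borel [measurable]: "cube R \<in> sets borel" by (simp add: cube_eq_box)
lemma tens_borel:
  assumes "\<And>i. P i \<in> borel_measurable borel" shows "tens P \<in> borel_measurable borel"
proof -
  have "(\<lambda>x::real^3. x $ i) \<in> borel_measurable borel" for i
    by (intro borel_measurable_continuous_onI continuous_intros)
  then show ?thesis unfolding tens_def[abs_def]
    using measurable_compose[OF _ assms] by (intro borel_measurable_prod) blast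
qed

text \<open>The positive and the negative part of \<open>G\<close> have the same integral over every box. Boxes are stable under
  intersection and generate the Borel sets, hence both parts are densities of the same measure.\<close>
lemma AE_zero_if_box_integrals_zero:
  fixes G :: "'a::euclidean_space \<Rightarrow> real"
  assumes G: "integrable lborel G"
    and z: "\<And>a b. (\<integral>x. indicator (box a b) x * G x \<partial>lborel) = 0"
  shows "AE x in lborel. G x = 0"
proof -
  have [measurable]: "G \<in> borel_measurable lborel" using G by simp
  let ?M = "density lborel (\<lambda>x. ennreal (G x))" and ?N = "density lborel (\<lambda>x. ennreal (- G x))"
  have fin: "(\<integral>\<^sup>+x. ennreal (G x) \<partial>lborel) < \<infinity>" "(\<integral>\<^sup>+x. ennreal (- G x) \<partial>lborel) < \<infinity>"
    using G by (auto simp: real_integrable_def top.not_eq_extremum)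
  have eq: "emeasure ?M (box a b) = emeasure ?N (box a b)" for a b
  proof -
    let ?H = "\<lambda>x. indicator (box a b) x * G x"
    have H: "integrable lborel ?H"
      using integrable_mult_indicator[of "box a b" lborel G] G by simp
    have "(\<integral>\<^sup>+x. ennreal (?H x) \<partial>lborel) = (\<integral>\<^sup>+x. ennreal (- ?H x) \<partial>lborel)"
    proof -
      have "enn2real (\<integral>\<^sup>+x. ennreal (?H x) \<partial>lborel) - enn2real (\<integral>\<^sup>+x. ennreal (- ?H x) \<partial>lborel) = 0"
        using z[of a b] unfolding real_lebesgue_integral_def[OF H] .
      moreover have "(\<integral>\<^sup>+x. ennreal (?H x) \<partial>lborel) < \<infinity>" "(\<integral>\<^sup>+x. ennreal (- ?H x) \<partial>lborel) < \<infinity>"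
        using H by (auto simp: real_integrable_def top.not_eq_extremum)
      ultimately show ?thesis by (metis ennreal_enn2real eq_iff_diff_eq_0 infinity_ennreal_def)
    qed
    moreover have "(\<integral>\<^sup>+x. ennreal (G x) * indicator (box a b) x \<partial>lborel) = (\<integral>\<^sup>+x. ennreal (?H x) \<partial>lborel)"
      by (intro nn_integral_cong) (auto simp: indicator_def)
    moreover have "(\<integral>\<^sup>+x. ennreal (- G x) * indicator (box a b) x \<partial>lborel) = (\<integral>\<^sup>+x. ennreal (- ?H x) \<partial>lborel)"
      by (intro nn_integral_cong) (auto simp: indicator_def)
    ultimately show ?thesis by (simp add: emeasure_density)
  qed
  have MN: "?M = ?N"
  proof (rule measure_eqI_generator_eq)
    let ?E = "range (\<lambda>(a, b). box a b::'a set)"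
    show "Int_stable ?E"
      by (auto simp: Int_stable_def box_Int_box)
    show "?E \<subseteq> Pow UNIV" "sets ?M = sigma_sets UNIV ?E" "sets ?N = sigma_sets UNIV ?E"
      by (simp_all add: borel_eq_box)
    let ?A = "\<lambda>n::nat. box (- (real n *\<^sub>R One)) (real n *\<^sub>R One) :: 'a set"
    show "range ?A \<subseteq> ?E" "(\<Union>i. ?A i) = UNIV"
      unfolding UN_box_eq_UNIV by auto
    show "emeasure ?M (?A i) \<noteq> \<infinity>" for i
    proof -
      have "emeasure ?M (?A i) \<le> (\<integral>\<^sup>+x. ennreal (G x) \<partial>lborel)"
        by (subst emeasure_density) (auto intro!: nn_integral_mono simp: indicator_def)
      then show ?thesis using fin by (auto simp: top_unique)
    qed
    show "emeasure ?M X = emeasure ?N X" if "X \<in> ?E" for X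
      using that eq by auto
  qed
  then have "AE x in lborel. ennreal (G x) = ennreal (- G x)"
    using fin by (subst finite_density_unique[symmetric]) auto
  then show ?thesis
  proof eventually_elim
    case (elim x)
    show ?case
    proof (cases "G x \<ge> 0")
      case True
      then have "ennreal (- G x) = 0" by (intro ennreal_neg) simp
      then show ?thesis using elim True by simp
    next
      case False
      then have "ennreal (G x) = 0" by (intro ennreal_neg) simp
      then show ?thesis using elim False by (simp add: ennreal_eq_0_iff)
    qed
  qed
qed

section \<open>Integration along coordinate lines\<close>

definition upd :: "real^3 \<Rightarrow> 3 \<Rightarrow> real \<Rightarrow> real^3" where
  "upd x j t = (\<chi> i. if i = j then t else x $ i)"

lemma upd_nth [simp]: "upd x j t $ i = (if i = j then t else x $ i)"
  by (simp add: upd_def)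

lemma upd_upd_same [simp]: "upd (upd x j t) j s = upd x j s"
  by (auto simp: Finite_Cartesian_Product.vec_eq_iff)

lemma upd_self [simp]: "upd x j (x $ j) = x"
  by (auto simp: Finite_Cartesian_Product.vec_eq_iff)

lemma continuous_on_upd: "continuous_on UNIV (\<lambda>p. upd (fst p) j (snd p))"
  unfolding upd_def
proof (rule continuous_on_vec_lambda)
  fix i :: 3 show "continuous_on UNIV (\<lambda>p::(real^3) \<times> real. if i = j then snd p else fst p $ i)"
    by (cases "i = j") (auto intro!: continuous_intros)
qed

lemma upd_measurable [measurable]: "(\<lambda>p. upd (fst p) j (snd p)) \<in> borel \<Otimes>\<^sub>M borel \<rightarrow>\<^sub>M borel"
  using borel_measurable_continuous_onI[OF continuous_on_upd] by (simp add: borel_prod)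

lemma upd_line_measurable [measurable]: "(\<lambda>t. upd x j t) \<in> borel \<rightarrow>\<^sub>M borel"
  by (rule measurable_compose[OF _ upd_measurable, of "\<lambda>t. (x, t)", simplified]) auto

lemma nth_measurable [measurable]: "(\<lambda>x::real^3. x $ i) \<in> borel \<rightarrow>\<^sub>M borel"
  by (intro borel_measurable_continuous_onI continuous_intros)

text \<open>Exchanging a coordinate of a point with an additional real variable expresses Fubini's theorem in
  direction \<open>j\<close> as invariance of a measure, in the same way for all three directions.\<close>
definition swap_coord :: "3 \<Rightarrow> (real^3) \<times> real \<Rightarrow> (real^3) \<times> real" where
  "swap_coord j p = (upd (fst p) j (snd p), fst p $ j)"

lemma swap_coord_measurable [measurable]:
  "swap_coord j \<in> lborel \<Otimes>\<^sub>M lborel \<rightarrow>\<^sub>M lborel \<Otimes>\<^sub>M lborel"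
  unfolding swap_coord_def[abs_def] by measurable

lemma prod_Basis_vec: "(\<Prod>b\<in>(Basis :: (real^3) set). g b) = (\<Prod>i\<in>UNIV. g (axis i 1))"
proof -
  have *: "(Basis :: (real^3) set) = range (\<lambda>i. axis i 1)" by (auto simp: Basis_vec_def)
  have inj: "inj (\<lambda>i::3. axis i (1::real))" by (auto simp: inj_on_def axis_eq_axis)
  show ?thesis unfolding * prod.reindex[OF inj] by (simp add: o_def)
qed

lemma emeasure_box_vec:
  assumes "\<And>i. l $ i \<le> u $ i"
  shows "emeasure lborel (box l u :: (real^3) set) = ennreal (\<Prod>i\<in>UNIV. u $ i - l $ i)"
proof -
  have "l \<bullet> b \<le> u \<bullet> b" if "b \<in> Basis" for b :: "real^3"
    using that assms by (auto simp: Basis_vec_def inner_axis)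
  then have "emeasure lborel (box l u) = ennreal (\<Prod>b\<in>Basis. (u - l) \<bullet> b)" by (rule emeasure_lborel_box)
  also have "(\<Prod>b\<in>Basis. (u - l) \<bullet> b) = (\<Prod>i\<in>UNIV. u $ i - l $ i)"
    unfolding prod_Basis_vec by (simp add: inner_axis)
  finally show ?thesis .
qed

text \<open>The preimage of a box is a box with the same side lengths in a different order.\<close>
lemma distr_swap_coord: "distr (lborel \<Otimes>\<^sub>M lborel) (lborel \<Otimes>\<^sub>M lborel) (swap_coord j) = lborel \<Otimes>\<^sub>M lborel"
proof -
  have pairbox: "box l u = box (fst l) (fst u) \<times> box (snd l) (snd u)" for l u :: "(real^3) \<times> real"
    by (auto simp: box_def Basis_prod_def inner_prod_def ball_Un)
  have prodeq: "emeasure lborel (box l u) = ennreal (\<Prod>i\<in>UNIV. fst u $ i - fst l $ i) * ennreal (snd u - snd l)"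
    if "\<And>i. fst l $ i \<le> fst u $ i" "snd l \<le> snd u" for l u :: "(real^3) \<times> real"
  proof -
    have "emeasure lborel (box l u) = emeasure (lborel \<Otimes>\<^sub>M lborel) (box (fst l) (fst u) \<times> box (snd l) (snd u))"
      by (simp add: lborel_prod pairbox)
    also have "\<dots> = emeasure lborel (box (fst l) (fst u)) * emeasure lborel (box (snd l) (snd u))"
      by (rule lborel.emeasure_pair_measure_Times) auto
    finally show ?thesis using that by (simp add: emeasure_box_vec)
  qed
  have "lborel = distr (lborel \<Otimes>\<^sub>M lborel) (lborel \<Otimes>\<^sub>M lborel) (swap_coord j)"
  proof (rule lborel_eqI)
    fix l u :: "(real^3) \<times> real"
    assume le: "\<And>b. b \<in> Basis \<Longrightarrow> l \<bullet> b \<le> u \<bullet> b"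
    have le1: "fst l $ i \<le> fst u $ i" for i
      using le[of "(axis i 1, 0)"] by (auto simp: Basis_prod_def Basis_vec_def inner_axis inner_prod_def)
    have le2: "snd l \<le> snd u" using le[of "(0, 1)"] by (auto simp: Basis_prod_def inner_prod_def)
    have vim: "swap_coord j -` box l u = box (swap_coord j l) (swap_coord j u)" (is "?A = ?B")
    proof -
      have "p \<in> ?A \<longleftrightarrow> p \<in> ?B" for p
        by (cases p) (simp add: pairbox swap_coord_def mem_box_cart, metis)
      then show ?thesis by blast
    qed
    have "emeasure (distr (lborel \<Otimes>\<^sub>M lborel) (lborel \<Otimes>\<^sub>M lborel) (swap_coord j)) (box l u)
        = emeasure (lborel \<Otimes>\<^sub>M lborel) (swap_coord j -` box l u)"
    proof (subst emeasure_distr[OF swap_coord_measurable])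
      show "box l u \<in> sets (lborel \<Otimes>\<^sub>M lborel)" unfolding lborel_prod by simp
    qed (simp add: lborel_prod)
    also have "\<dots> = emeasure lborel (box (swap_coord j l) (swap_coord j u))"
      by (simp add: vim lborel_prod)
    also have "\<dots> = ennreal (\<Prod>i\<in>UNIV. fst (swap_coord j u) $ i - fst (swap_coord j l) $ i) * ennreal (snd (swap_coord j u) - snd (swap_coord j l))"
      by (rule prodeq) (auto simp: swap_coord_def le1 le2)
    also have "\<dots> = ennreal ((\<Prod>i\<in>UNIV. fst (swap_coord j u) $ i - fst (swap_coord j l) $ i) * (snd (swap_coord j u) - snd (swap_coord j l)))"
      using le1 by (subst ennreal_mult''[symmetric]) (auto simp: swap_coord_def)
    also have "(\<Prod>i\<in>UNIV. fst (swap_coord j u) $ i - fst (swap_coord j l) $ i) * (snd (swap_coord j u) - snd (swap_coord j l))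
       = (snd u - snd l) * (\<Prod>i\<in>UNIV - {j}. fst u $ i - fst l $ i) * (fst u $ j - fst l $ j)"
      by (subst prod.remove[of UNIV j]) (auto simp: swap_coord_def intro!: prod.cong)
    also have "\<dots> = (\<Prod>i\<in>UNIV. fst u $ i - fst l $ i) * (snd u - snd l)"
      by (subst prod.remove[of UNIV j]) auto
    also have "ennreal \<dots> = ennreal (\<Prod>i\<in>UNIV. fst u $ i - fst l $ i) * ennreal (snd u - snd l)"
      using le2 by (subst ennreal_mult'') auto
    also have "\<dots> = emeasure lborel (box l u)" by (rule prodeq[symmetric]) (auto simp: le1 le2)
    also have "\<dots> = ennreal (\<Prod>b\<in>Basis. (u - l) \<bullet> b)" by (rule emeasure_lborel_box) (rule le)
    finally show "emeasure (distr (lborel \<Otimes>\<^sub>M lborel) (lborel \<Otimes>\<^sub>M lborel) (swap_coord j)) (box l u)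
       = ennreal (\<Prod>b\<in>Basis. (u - l) \<bullet> b)" .
  qed (simp add: lborel_prod)
  then show ?thesis by (simp add: lborel_prod)
qed

definition line_int :: "3 \<Rightarrow> (real^3 \<Rightarrow> ennreal) \<Rightarrow> real^3 \<Rightarrow> ennreal" where
  "line_int j F x = (\<integral>\<^sup>+t. F (upd x j t) \<partial>lborel)"

lemma line_int_measurable [measurable (raw)]:
  assumes [measurable]: "F \<in> borel_measurable borel" shows "line_int j F \<in> borel_measurable borel"
proof -
  have "(\<lambda>p. F (upd (fst p) j (snd p))) \<in> borel_measurable (borel \<Otimes>\<^sub>M lborel)"
    by measurable
  then show ?thesis unfolding line_int_def[abs_def]
    by (intro lborel.borel_measurable_nn_integral) (simp add: case_prod_beta')
qed

text \<open>Both sides integrate a function of a point and an additional variable, before and after the swap of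
  coordinates.\<close>
lemma line_int_self_adjoint:
  assumes [measurable]: "a \<in> borel_measurable borel" "Z \<in> borel_measurable borel"
  shows "(\<integral>\<^sup>+x. a x * line_int j Z x \<partial>lborel) = (\<integral>\<^sup>+x. Z x * line_int j a x \<partial>lborel)"
proof -
  have *: "(\<integral>\<^sup>+x. a x * line_int j Z x \<partial>lborel) = (\<integral>\<^sup>+p. a (fst p) * Z (upd (fst p) j (snd p)) \<partial>(lborel \<Otimes>\<^sub>M lborel))"
    if [measurable]: "a \<in> borel_measurable borel" "Z \<in> borel_measurable borel" for a Z
  proof -
    have "(\<integral>\<^sup>+p. a (fst p) * Z (upd (fst p) j (snd p)) \<partial>(lborel \<Otimes>\<^sub>M lborel))
      = (\<integral>\<^sup>+x. \<integral>\<^sup>+t. a x * Z (upd x j t) \<partial>lborel \<partial>lborel)"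
      by (subst lborel.nn_integral_fst[symmetric]) auto
    also have "\<dots> = (\<integral>\<^sup>+x. a x * line_int j Z x \<partial>lborel)"
      unfolding line_int_def by (intro nn_integral_cong nn_integral_cmult) measurable
    finally show ?thesis by simp
  qed
  have "(\<integral>\<^sup>+p. Z (fst p) * a (upd (fst p) j (snd p)) \<partial>(lborel \<Otimes>\<^sub>M lborel))
     = (\<integral>\<^sup>+p. Z (fst p) * a (upd (fst p) j (snd p)) \<partial>distr (lborel \<Otimes>\<^sub>M lborel) (lborel \<Otimes>\<^sub>M lborel) (swap_coord j))"
    by (simp add: distr_swap_coord)
  also have "\<dots> = (\<integral>\<^sup>+p. a (fst p) * Z (upd (fst p) j (snd p)) \<partial>(lborel \<Otimes>\<^sub>M lborel))"
    by (subst nn_integral_distr) (auto simp: swap_coord_def mult.commute)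
  finally show ?thesis using *[of a Z] *[of Z a] by simp
qed

text \<open>Line integrals of the indicator of a null set vanish almost everywhere, by self-adjointness against
  the constant function 1.\<close>
lemma AE_line:
  assumes "AE x in lborel. P x" shows "AE x in lborel. AE t in lborel. P (upd x j t)"
proof -
  obtain N where N: "N \<in> null_sets lborel" "{x. \<not> P x} \<subseteq> N"
    using assms by (auto simp: eventually_ae_filter)
  have [measurable]: "N \<in> sets borel" using N by auto
  have "(\<integral>\<^sup>+x. 1 * line_int j (indicator N) x \<partial>lborel) = (\<integral>\<^sup>+x. indicator N x * line_int j (\<lambda>x. 1) x \<partial>lborel)"
    by (rule line_int_self_adjoint) auto
  also have "\<dots> = 0"
    using AE_not_in[OF N(1)] by (subst nn_integral_0_iff_AE) (auto elim!: eventually_mono)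
  finally have "AE x in lborel. line_int j (indicator N) x = 0"
    by (subst (asm) nn_integral_0_iff_AE) auto
  then show ?thesis
  proof eventually_elim
    case (elim x)
    then have "AE t in lborel. indicator N (upd x j t) = (0::ennreal)"
      unfolding line_int_def by (subst (asm) nn_integral_0_iff_AE) auto
    then show ?case by eventually_elim (use N in \<open>auto split: split_indicator_asm\<close>)
  qed
qed

section \<open>Tensor products separate locally integrable functions\<close>

lemma tens_bump_tendsto: "(\<lambda>n. tens (\<lambda>i. bump (a $ i) (b $ i) n) x) \<longlonglongrightarrow> indicator (box a b) x"
proof -
  have "(\<lambda>n. \<Prod>i\<in>UNIV. bump (a $ i) (b $ i) n (x $ i)) \<longlonglongrightarrow> (\<Prod>i\<in>UNIV. indicator {a $ i<..<b $ i} (x $ i))"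
    by (intro tendsto_prod bump_tendsto)
  also have "(\<Prod>i\<in>UNIV. indicator {a $ i<..<b $ i} (x $ i)) = (indicator (box a b) x :: real)"
  proof (cases "x \<in> box a b")
    case False
    then obtain i where "\<not> (a $ i < x $ i \<and> x $ i < b $ i)" by (auto simp: mem_box_cart)
    then have "(\<Prod>i\<in>UNIV. indicator {a $ i<..<b $ i} (x $ i)) = (0::real)" 
      by (intro prod_zero bexI[of _ i]) auto
    then show ?thesis using False by simp
  qed (auto simp: mem_box_cart)
  finally show ?thesis unfolding tens_def .
qed

lemma tens_bump_bounds: "0 \<le> tens (\<lambda>i. bump (a $ i) (b $ i) n) x" "tens (\<lambda>i. bump (a $ i) (b $ i) n) x \<le> 1"
  unfolding tens_def by (auto intro!: prod_nonneg prod_le_1 bump_bounds)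

lemma locally_integrable_cbox:
  assumes "locally_integrable (cube R) F" "\<And>i. - R < a $ i" "\<And>i. b $ i < R"
  shows "integrable lebesgue (\<lambda>x. indicator (cbox a b) x * F x)"
proof -
  have "cbox a b \<subseteq> cube R"
  proof
    fix x assume x: "x \<in> cbox a b"
    have "- R < x $ i \<and> x $ i < R" for i
      using x assms(2,3)[of i] unfolding mem_box_cart by (meson le_less_trans less_le_trans)
    then show "x \<in> cube R" by (auto simp: cube_iff abs_less_iff) (metis minus_less_iff)
  qed
  then have "F absolutely_integrable_on cbox a b"
    using assms(1) by (auto simp: locally_integrable_def)
  then show ?thesis by (simp add: set_integrable_def)
qed

text \<open>Tensor products of bumps converge boundedly to indicators of boxes, so the integral of \<open>F\<close> over every
  box with closure in the cube vanishes. Since \<open>F\<close> is only locally integrable, the criterion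
  for boxes is applied on an exhausting sequence of smaller cubes.\<close>
lemma AE_zero_if_tensor_integrals_zero:
  assumes R: "R > 0" and F: "locally_integrable (cube R) F"
    and z: "\<And>P. (\<And>i. test1 R (P i)) \<Longrightarrow> (\<integral>x. F x * tens P x \<partial>leb_cube R) = 0"
  shows "AE x in leb_cube R. F x = 0"
proof -
  have box0: "(\<integral>x. indicator (box a b) x * F x \<partial>lebesgue) = 0"
    if ab: "\<And>i. - R < a $ i" "\<And>i. b $ i < R" for a b
  proof -
    have int: "integrable lebesgue (\<lambda>x. indicator (cbox a b) x * F x)"
      by (rule locally_integrable_cbox[OF F ab])
    have mF: "(\<lambda>x. indicator (cbox a b) x * F x) \<in> borel_measurable lebesgue"
      using int by simp
    let ?T = "\<lambda>n. tens (\<lambda>i. bump (a $ i) (b $ i) n)"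
    have mT: "?T n \<in> borel_measurable lebesgue" for n
    proof -
      have "?T n \<in> borel_measurable borel"
        by (intro tens_borel borel_measurable_continuous_onI smooth1_continuous smooth1_bump)
      then show ?thesis by (simp add: measurable_completion)
    qed
    have supp: "?T n x = indicator (cbox a b) x * ?T n x" for n x
    proof (cases "x \<in> cbox a b")
      case False
      then obtain i where "\<not> (a $ i \<le> x $ i \<and> x $ i \<le> b $ i)" by (auto simp: mem_box_cart)
      then have "?T n x = 0" by (intro tens_eq_0[of _ i] bump_eq_0) auto
      then show ?thesis by simp
    qed simp
    have ind_eq: "(indicator (box a b) x::real) = indicator (box a b) x * indicator (cbox a b) x" for x
      using box_subset_cbox[of a b] by (auto simp: indicator_def)
    have "(\<lambda>n. \<integral>x. ?T n x * (indicator (cbox a b) x * F x) \<partial>lebesgue) \<longlonglongrightarrow> (\<integral>x. indicator (box a b) x * (indicator (cbox a b) x * F x) \<partial>lebesgue)"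
    proof (rule integral_dominated_convergence)
      show "(\<lambda>x. indicator (box a b) x * (indicator (cbox a b) x * F x)) \<in> borel_measurable lebesgue"
        by (rule borel_measurable_times[OF borel_measurable_indicator mF]) simp
      show "(\<lambda>x. ?T n x * (indicator (cbox a b) x * F x)) \<in> borel_measurable lebesgue" for n
        by (rule borel_measurable_times[OF mT mF])
      show "integrable lebesgue (\<lambda>x. \<bar>indicator (cbox a b) x * F x\<bar>)"
        by (rule integrable_abs[OF int])
      show "AE x in lebesgue. (\<lambda>n. ?T n x * (indicator (cbox a b) x * F x)) \<longlonglongrightarrow> indicator (box a b) x * (indicator (cbox a b) x * F x)"
        by (intro AE_I2 tendsto_mult tens_bump_tendsto tendsto_const)
      show "AE x in lebesgue. norm (?T n x * (indicator (cbox a b) x * F x)) \<le> \<bar>indicator (cbox a b) x * F x\<bar>" for n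
        using tens_bump_bounds[of a b n] by (intro AE_I2) (auto simp: abs_mult mult_left_le_one_le)
    qed
    moreover have "(\<integral>x. ?T n x * (indicator (cbox a b) x * F x) \<partial>lebesgue) = 0" for n
    proof -
      have t: "test1 R (bump (a $ i) (b $ i) n)" for i using ab R by (intro test1_bump)
      have "0 = (\<integral>x. F x * ?T n x \<partial>leb_cube R)" using z[OF t] by simp
      also have "\<dots> = (\<integral>x. indicator (cube R) x *\<^sub>R (F x * ?T n x) \<partial>lebesgue)"
        by (rule integral_restrict_space) simp
      also have "\<dots> = (\<integral>x. ?T n x * (indicator (cbox a b) x * F x) \<partial>lebesgue)"
      proof (rule Bochner_Integration.integral_cong[OF refl])
        fix x
        show "indicator (cube R) x *\<^sub>R (F x * ?T n x) = ?T n x * (indicator (cbox a b) x * F x)"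
        proof (cases "x \<in> cube R")
          case True
          then have "indicator (cube R) x *\<^sub>R (F x * ?T n x) = F x * ?T n x" by simp
          also have "\<dots> = F x * (indicator (cbox a b) x * ?T n x)" by (rule arg_cong[OF supp])
          also have "\<dots> = ?T n x * (indicator (cbox a b) x * F x)" by (simp only: mult_ac)
          finally show ?thesis .
        next
          case False
          then obtain i where "\<not> \<bar>x $ i\<bar> < R" by (auto simp: cube_iff)
          then have "?T n x = 0" using ab[of i] by (intro tens_eq_0[of _ i] bump_eq_0) linarith
          then show ?thesis by simp
        qed
      qed
      finally show ?thesis by simp
    qed
    ultimately have "(\<lambda>n::nat. 0) \<longlonglongrightarrow> (\<integral>x. indicator (box a b) x * (indicator (cbox a b) x * F x) \<partial>lebesgue)"
      by (simp only:)
    then have "(\<integral>x. indicator (box a b) x * (indicator (cbox a b) x * F x) \<partial>lebesgue) = 0"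
      by (simp only: LIMSEQ_const_iff)
    moreover have "indicator (box a b) x * (indicator (cbox a b) x * F x) = indicator (box a b) x * F x" for x
      by (simp only: mult.assoc[symmetric] ind_eq[symmetric])
    ultimately show ?thesis by simp
  qed
  \<comment> \<open>The shift by 2 keeps the radius \<open>R - R / (n + 2)\<close> positive for \<open>n = 0\<close>.\<close>
  define U where "U n = (box (- (\<chi> i. R - R / (real n + 2))) (\<chi> i. R - R / (real n + 2)) :: (real^3) set)" for n
  have 0: "AE x in lebesgue. x \<in> U n \<longrightarrow> F x = 0" for n
  proof -
    let ?c = "(\<chi> i. R - R / (real n + 2)) :: real^3"
    have c: "- R < (- ?c) $ i" "?c $ i < R" for i using R by auto
    have int: "integrable lebesgue (\<lambda>x. indicator (U n) x * F x)"
    proof -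
      have "integrable lebesgue (\<lambda>x. indicator (U n) x *\<^sub>R (indicator (cbox (-?c) ?c) x * F x))"
        by (rule integrable_mult_indicator) (auto simp: U_def intro!: locally_integrable_cbox[OF F] c)
      moreover have "indicator (U n) x *\<^sub>R (indicator (cbox (-?c) ?c) x * F x) = indicator (U n) x * F x" for x
        using box_subset_cbox[of "- ?c" ?c] by (auto simp: indicator_def U_def)
      ultimately show ?thesis by (simp only:)
    qed
    then obtain G where G: "G \<in> borel_measurable lborel" "AE x in lborel. indicator (U n) x * F x = G x"
      using completion_ex_borel_measurable_real[of "\<lambda>x. indicator (U n) x * F x" lborel] by auto
    have G': "AE x in lebesgue. indicator (U n) x * F x = G x" using AE_completion[OF G(2)] .
    have iG: "integrable lborel G"
    proof -
      have "integrable lebesgue G"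
        using int G' G(1) by (subst integrable_cong_AE[where g="\<lambda>x. indicator (U n) x * F x"]) (auto intro: measurable_completion)
      then show ?thesis using G(1) integrable_completion by blast
    qed
    have "AE x in lborel. G x = 0"
    proof (rule AE_zero_if_box_integrals_zero[OF iG])
      fix a b :: "real^3"
      let ?a = "(\<chi> i. max (a $ i) ((-?c) $ i)) :: real^3" and ?b = "(\<chi> i. min (b $ i) (?c $ i)) :: real^3"
      have "(\<integral>x. indicator (box a b) x * G x \<partial>lborel) = (\<integral>x. indicator (box a b) x * G x \<partial>lebesgue)"
        using G(1) by (subst integral_completion) auto
      also have "\<dots> = (\<integral>x. indicator (box a b) x * (indicator (U n) x * F x) \<partial>lebesgue)"
      proof (rule integral_cong_AE)
        have m1: "G \<in> borel_measurable lebesgue" using G(1) by (rule measurable_completion)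
        have m2: "(\<lambda>x. indicator (U n) x * F x) \<in> borel_measurable lebesgue" using int by simp
        show "(\<lambda>x. indicator (box a b) x * G x) \<in> borel_measurable lebesgue" 
          by (rule borel_measurable_times[OF borel_measurable_indicator m1]) simp
        show "(\<lambda>x. indicator (box a b) x * (indicator (U n) x * F x)) \<in> borel_measurable lebesgue" 
          by (rule borel_measurable_times[OF borel_measurable_indicator m2]) simp
        show "AE x in lebesgue. indicator (box a b) x * G x = indicator (box a b) x * (indicator (U n) x * F x)"
          using G' by eventually_elim simp
      qed
      also have "\<dots> = (\<integral>x. indicator (box ?a ?b) x * F x \<partial>lebesgue)"
        by (intro Bochner_Integration.integral_cong refl) (auto simp: indicator_def U_def mem_box_cart)
      also have "\<dots> = 0"
      proof (rule box0)
        fix i show "- R < ?a $ i" "?b $ i < R" using c[of i] by auto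
      qed
      finally show "(\<integral>x. indicator (box a b) x * G x \<partial>lborel) = 0" .
    qed
    then have "AE x in lebesgue. G x = 0" by (rule AE_completion)
    with G' show ?thesis by eventually_elim (auto simp: indicator_def)
  qed
  have "AE x in lebesgue. \<forall>n. x \<in> U n \<longrightarrow> F x = 0" using 0 unfolding AE_all_countable by blast
  then have "AE x in lebesgue. x \<in> cube R \<longrightarrow> F x = 0"
  proof eventually_elim
    case (elim x)
    show ?case
    proof
      assume x: "x \<in> cube R"
      have "eventually (\<lambda>n. \<bar>x $ i\<bar> < R - R / (real n + 2)) sequentially" for i
      proof -
        have "(\<lambda>n. R - R / (real n + 2)) \<longlonglongrightarrow> R - 0"
          by (intro tendsto_diff tendsto_const) real_asymp
        moreover have "\<bar>x $ i\<bar> < R - 0" using x by (simp add: cube_iff)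
        ultimately show ?thesis by (rule order_tendstoD)
      qed
      then have "eventually (\<lambda>n. \<forall>i. \<bar>x $ i\<bar> < R - R / (real n + 2)) sequentially"
        by (rule eventually_all_finite)
      then obtain n where "\<forall>i. \<bar>x $ i\<bar> < R - R / (real n + 2)"
        by (auto simp: eventually_sequentially)
      then have "- (R - R / (real n + 2)) < x $ i \<and> x $ i < R - R / (real n + 2)" for i
        unfolding abs_less_iff by (metis minus_less_iff)
      then have "x \<in> U n" by (simp add: U_def mem_box_cart)
      then show "F x = 0" using elim by blast
    qed
  qed
  then show ?thesis by (subst AE_restrict_space_iff) auto
qed

section \<open>A pointwise bound along lines\<close>

lemma integral_cube_lborel:
  assumes "G \<in> borel_measurable borel" "\<And>x. x \<notin> cube R \<Longrightarrow> G x = (0::real)"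
  shows "(\<integral>x. G x \<partial>leb_cube R) = (\<integral>x. G x \<partial>lborel)"
proof -
  have "(\<integral>x. G x \<partial>leb_cube R) = (\<integral>x. indicator (cube R) x *\<^sub>R G x \<partial>lebesgue)"
    by (rule integral_restrict_space) simp
  also have "\<dots> = (\<integral>x. G x \<partial>lebesgue)"
    using assms(2) by (intro Bochner_Integration.integral_cong) (auto simp: indicator_def)
  also have "\<dots> = (\<integral>x. G x \<partial>lborel)" using assms(1) by (intro integral_completion) simp
  finally show ?thesis .
qed

lemma pair_integrable_dominated:
  fixes G :: "'a::euclidean_space \<times> 'b::euclidean_space \<Rightarrow> real"
  assumes G: "G \<in> borel_measurable (lborel \<Otimes>\<^sub>M lborel)"
    and a: "integrable lborel a" and b: "integrable lborel b"
    and le: "\<And>x s. \<bar>G (x, s)\<bar> \<le> a x * b s"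
  shows "integrable (lborel \<Otimes>\<^sub>M lborel) G"
proof -
  have [measurable]: "a \<in> borel_measurable lborel" "b \<in> borel_measurable lborel" using a b by auto
  have "integrable (lborel \<Otimes>\<^sub>M lborel) (\<lambda>(x, s). a x * b s)"
  proof (rule lborel_pair.Fubini_integrable)
    show "(\<lambda>(x, s). a x * b s) \<in> borel_measurable (lborel \<Otimes>\<^sub>M lborel)" by measurable
    have "integrable lborel (\<lambda>x. \<bar>a x\<bar> * (\<integral>y. \<bar>b y\<bar> \<partial>lborel))"
      using a by auto
    then show "integrable lborel (\<lambda>x. \<integral>y. norm (case (x, y) of (x, s) \<Rightarrow> a x * b s) \<partial>lborel)"
      by (simp add: abs_mult)
    show "AE x in lborel. integrable lborel (\<lambda>y. case (x, y) of (x, s) \<Rightarrow> a x * b s)"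
      using b by auto
  qed
  then show ?thesis using G
  proof (rule Bochner_Integration.integrable_bound)
    show "AE x in lborel \<Otimes>\<^sub>M lborel. norm (G x) \<le> norm (case x of (x, s) \<Rightarrow> a x * b s)"
      using le by (intro AE_I2) (auto intro: order_trans[OF _ abs_ge_self])
  qed
qed

lemma integrable_bounded_mult:
  fixes u g :: "'a \<Rightarrow> real"
  assumes u: "integrable M u" and g: "g \<in> borel_measurable M" "\<And>x. \<bar>g x\<bar> \<le> B"
  shows "integrable M (\<lambda>x. u x * g x)"
proof (rule Bochner_Integration.integrable_bound)
  show "integrable M (\<lambda>x. B * u x)" using u by simp
  show "(\<lambda>x. u x * g x) \<in> borel_measurable M" using u g(1) by simp
  show "AE x in M. norm (u x * g x) \<le> norm (B * u x)"
  proof (rule AE_I2)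
    fix x
    have "\<bar>g x\<bar> * \<bar>u x\<bar> \<le> \<bar>B\<bar> * \<bar>u x\<bar>" using g(2)[of x] by (intro mult_right_mono) auto
    then show "norm (u x * g x) \<le> norm (B * u x)" by (simp add: abs_mult mult.commute)
  qed
qed

lemma tens_test_borel: "(\<And>i. test1 R (P i)) \<Longrightarrow> tens P \<in> borel_measurable borel"
  by (intro tens_borel test1_borel)

lemma test1_eq_0: "test1 R p \<Longrightarrow> \<not> \<bar>t\<bar> < R \<Longrightarrow> p t = 0"
  by (force simp: test1_def)

lemma tens_outside_cube: "(\<And>i. test1 R (P i)) \<Longrightarrow> x \<notin> cube R \<Longrightarrow> tens P x = 0"
  by (metis cube_iff tens_eq_0 test1_eq_0)

definition below_int :: "(real \<Rightarrow> real) \<Rightarrow> real \<Rightarrow> real" where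
  "below_int p t = (\<integral>z. p z * indicator {z. z < t} z \<partial>lborel)"

lemma below_int_continuous: "test1 R p \<Longrightarrow> continuous_on UNIV (below_int p)"
  unfolding below_int_def[abs_def] using test1_primitive by (meson DERIV_isCont continuous_at_imp_continuous_on)

text \<open>Subtracting from \<open>p\<close> the multiple of \<open>\<rho>\<close> with the same integral leaves a function of mean zero, and only
  functions of mean zero have a primitive with compact support.\<close>
lemma test1_balanced_primitive:
  assumes p: "test1 R p" and \<rho>: "test1 R \<rho>" and \<rho>1: "(\<integral>t. \<rho> t \<partial>lborel) = 1"
  defines "m \<equiv> \<integral>t. p t \<partial>lborel"
  shows "test1 R (\<lambda>t. below_int p t - m * below_int \<rho> t)"
    and "deriv (\<lambda>t. below_int p t - m * below_int \<rho> t) = (\<lambda>t. p t - m * \<rho> t)"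
proof -
  let ?\<psi> = "\<lambda>t. below_int p t - m * below_int \<rho> t"
  have d: "(?\<psi> has_real_derivative (\<lambda>t. p t - m * \<rho> t) t) (at t)" for t
    using test1_primitive[OF p, of t] test1_primitive[OF \<rho>, of t]
    unfolding below_int_def by (auto intro!: derivative_eq_intros)
  then show "deriv ?\<psi> = (\<lambda>t. p t - m * \<rho> t)" using DERIV_imp_deriv by blast
  have s: "smooth1 ?\<psi>" by (rule smooth1_antideriv[OF d]) (use test1_lin[OF p \<rho>] in \<open>simp add: test1_def\<close>)
  obtain c where c: "0 < c" "c < R" "\<And>t. \<bar>t\<bar> \<ge> c \<Longrightarrow> p t = 0" using p by (auto simp: test1_def)
  obtain c' where c': "0 < c'" "c' < R" "\<And>t. \<bar>t\<bar> \<ge> c' \<Longrightarrow> \<rho> t = 0" using \<rho> by (auto simp: test1_def)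
  have low: "below_int q t = 0" if "\<And>t. \<bar>t\<bar> \<ge> d \<Longrightarrow> q t = 0" "t \<le> - d" "0 < d" for q d t
    unfolding below_int_def using that by (intro integral_eq_zero_AE AE_I2) (auto simp: indicator_def)
  have high: "below_int q t = (\<integral>t. q t \<partial>lborel)" if "\<And>t. \<bar>t\<bar> \<ge> d \<Longrightarrow> q t = 0" "t \<ge> d" "0 < d" for q d t
    unfolding below_int_def using that by (intro Bochner_Integration.integral_cong refl) (auto simp: indicator_def)
  have "?\<psi> t = 0" if t: "\<bar>t\<bar> \<ge> max c c'" for t
  proof (cases "t < 0")
    case True
    then show ?thesis using low[of c p t] low[of c' \<rho> t] c c' t by simp
  next
    case False
    then show ?thesis using high[of c p t] high[of c' \<rho> t] c c' t \<rho>1 by (simp add: m_def)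
  qed
  with s c c' show "test1 R ?\<psi>" unfolding test1_def by (auto intro!: exI[of _ "max c c'"])
qed

text \<open>The kernel of the representation \<open>u(z) = \<integral> u \<rho> - \<integral> u' \<kappa>(z, \<cdot>)\<close> of a function by its derivative on an
  interval, where \<open>\<rho>\<close> has compact support and integral 1.\<close>
definition slice_kernel :: "(real \<Rightarrow> real) \<Rightarrow> real \<Rightarrow> real \<Rightarrow> real" where
  "slice_kernel \<rho> z t = indicator {z. z < t} z - below_int \<rho> t"

lemma slice_kernel_measurable [measurable]:
  assumes "test1 R \<rho>"
  shows "(\<lambda>p. slice_kernel \<rho> (fst p) (snd p)) \<in> borel_measurable (borel \<Otimes>\<^sub>M borel)"
proof -
  have [measurable]: "below_int \<rho> \<in> borel_measurable borel"
    by (rule borel_measurable_continuous_onI[OF below_int_continuous[OF assms]])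
  show ?thesis unfolding slice_kernel_def indicator_def by measurable
qed

text \<open>The right-hand side is the test function of \<open>test1_balanced_primitive\<close>.\<close>
lemma slice_kernel_integral:
  assumes p: "test1 R p"
  shows "(\<integral>z. p z * slice_kernel \<rho> z t \<partial>lborel) = below_int p t - (\<integral>t. p t \<partial>lborel) * below_int \<rho> t"
proof -
  have i1: "integrable lborel (\<lambda>z. p z * indicator {z. z < t} z)"
    by (rule integrable_bounded_mult[OF test1_integrable[OF p], of _ 1]) (auto simp: indicator_def)
  have "(\<integral>z. p z * slice_kernel \<rho> z t \<partial>lborel) = (\<integral>z. p z * indicator {z. z < t} z - p z * below_int \<rho> t \<partial>lborel)"
    by (simp add: slice_kernel_def algebra_simps)
  also have "\<dots> = below_int p t - (\<integral>z. p z * below_int \<rho> t \<partial>lborel)"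
    unfolding below_int_def by (intro Bochner_Integration.integral_diff i1 integrable_mult_left test1_integrable[OF p])
  finally show ?thesis by simp
qed

lemma below_int_bounds:
  assumes \<rho>: "test1 R \<rho>" and \<rho>1: "(\<integral>t. \<rho> t \<partial>lborel) = 1" and pos: "\<And>t. 0 \<le> \<rho> t"
  shows "0 \<le> below_int \<rho> t" "below_int \<rho> t \<le> 1"
proof -
  show "0 \<le> below_int \<rho> t" unfolding below_int_def by (intro Bochner_Integration.integral_nonneg) (auto simp: pos)
  have "below_int \<rho> t \<le> (\<integral>t. \<rho> t \<partial>lborel)" unfolding below_int_def
    by (intro integral_mono' test1_integrable[OF \<rho>]) (auto simp: pos indicator_def)
  then show "below_int \<rho> t \<le> 1" using \<rho>1 by simp
qed

lemma slice_kernel_bound: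
  assumes \<rho>: "test1 R \<rho>" and \<rho>1: "(\<integral>t. \<rho> t \<partial>lborel) = 1" and pos: "\<And>t. 0 \<le> \<rho> t"
  shows "\<bar>slice_kernel \<rho> z t\<bar> \<le> 1"
  using below_int_bounds[OF assms, of t] by (auto simp: slice_kernel_def indicator_def)

text \<open>The weak derivative is tested with the compactly supported primitive of \<open>p - m \<rho>\<close> in
  direction \<open>j\<close>, where \<open>m\<close> is the integral of \<open>p\<close>. Writing this primitive as an integral of \<open>p\<close> against
  the kernel and swapping coordinates moves the test function \<open>p\<close> outside. Hence \<open>u\<close> agrees with its
  representation \<open>T\<close> by the kernel almost everywhere, and both \<open>\<rho>\<close> and the kernel are bounded.\<close>
lemma slice_bound:
  assumes R: "R > 0"
    and \<rho>: "test1 R \<rho>" and \<rho>1: "(\<integral>t. \<rho> t \<partial>lborel) = 1" and pos: "\<And>t. 0 \<le> \<rho> t" and \<rho>B: "\<And>t. \<rho> t \<le> B" and B1: "1 \<le> B"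
    and u: "integrable lborel u" "\<And>x. x \<notin> cube R \<Longrightarrow> u x = 0"
    and w: "integrable lborel w" "\<And>x. x \<notin> cube R \<Longrightarrow> w x = 0"
    and weak: "\<And>P. (\<And>i. test1 R (P i)) \<Longrightarrow>
        (\<integral>x. u x * tens (P(j := deriv (P j))) x \<partial>lborel) = - (\<integral>x. w x * tens P x \<partial>lborel)"
  shows "AE x in lborel. ennreal \<bar>u x\<bar> \<le> ennreal B * line_int j (\<lambda>x. ennreal (\<bar>u x\<bar> + \<bar>w x\<bar>)) x"
proof -
  have [measurable]: "u \<in> borel_measurable borel" "w \<in> borel_measurable borel" using u w by auto
  have [measurable]: "\<rho> \<in> borel_measurable borel" by (rule test1_borel[OF \<rho>])
  note slice_kernel_measurable[OF \<rho>, measurable]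
  have km1 [measurable]: "(\<lambda>p. slice_kernel \<rho> (snd p) (fst p $ j)) \<in> borel_measurable (borel \<Otimes>\<^sub>M borel)"
    using measurable_compose[of "\<lambda>p::(real^3)\<times>real. (snd p, fst p $ j)" "borel \<Otimes>\<^sub>M borel" "borel \<Otimes>\<^sub>M borel", OF _ slice_kernel_measurable[OF \<rho>]]
    by simp
  have km2 [measurable]: "(\<lambda>p. slice_kernel \<rho> (fst p $ j) (snd p)) \<in> borel_measurable (borel \<Otimes>\<^sub>M borel)"
    using measurable_compose[of "\<lambda>p::(real^3)\<times>real. (fst p $ j, snd p)" "borel \<Otimes>\<^sub>M borel" "borel \<Otimes>\<^sub>M borel", OF _ slice_kernel_measurable[OF \<rho>]]
    by simp
  note kB = slice_kernel_bound[OF \<rho> \<rho>1 pos]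
  have intB: "integrable lborel (\<lambda>x. B * \<bar>u x\<bar> + \<bar>w x\<bar>)" using u w by simp
  have dom: "\<bar>u y * \<rho> s - w y * slice_kernel \<rho> z t\<bar> \<le> B * \<bar>u y\<bar> + \<bar>w y\<bar>" for y s z t
  proof -
    have "\<bar>u y * \<rho> s - w y * slice_kernel \<rho> z t\<bar> \<le> \<bar>u y\<bar> * \<bar>\<rho> s\<bar> + \<bar>w y\<bar> * \<bar>slice_kernel \<rho> z t\<bar>"
      by (metis abs_mult abs_triangle_ineq4)
    also have "\<dots> \<le> \<bar>u y\<bar> * B + \<bar>w y\<bar> * 1"
      using pos[of s] \<rho>B[of s] kB[of z t] by (intro add_mono mult_left_mono) auto
    finally show ?thesis by (simp add: mult.commute)
  qed
  define T where "T x = (\<integral>t. u (upd x j t) * \<rho> t - w (upd x j t) * slice_kernel \<rho> (x $ j) t \<partial>lborel)" for x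
  have swap_eq: "integrable (lborel \<Otimes>\<^sub>M lborel) (\<lambda>p. H (swap_coord j p))" 
      "(\<integral>p. H (swap_coord j p) \<partial>(lborel \<Otimes>\<^sub>M lborel)) = (\<integral>p. H p \<partial>(lborel \<Otimes>\<^sub>M lborel))"
    if H: "integrable (lborel \<Otimes>\<^sub>M lborel) H" for H :: "_ \<Rightarrow> real"
  proof -
    show "integrable (lborel \<Otimes>\<^sub>M lborel) (\<lambda>p. H (swap_coord j p))"
      by (rule integrable_distr[OF swap_coord_measurable]) (simp only: distr_swap_coord H)
    have "(\<integral>p. H p \<partial>(lborel \<Otimes>\<^sub>M lborel)) = (\<integral>p. H p \<partial>distr (lborel \<Otimes>\<^sub>M lborel) (lborel \<Otimes>\<^sub>M lborel) (swap_coord j))"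
      by (simp only: distr_swap_coord)
    also have "\<dots> = (\<integral>p. H (swap_coord j p) \<partial>(lborel \<Otimes>\<^sub>M lborel))"
      using H by (intro integral_distr swap_coord_measurable) simp
    finally show "(\<integral>p. H (swap_coord j p) \<partial>(lborel \<Otimes>\<^sub>M lborel)) = (\<integral>p. H p \<partial>(lborel \<Otimes>\<^sub>M lborel))" by simp
  qed
  \<comment> \<open>\<open>T\<close> need not decay in direction \<open>j\<close>; it is integrable only after restriction to the cube.\<close>
  have T_int: "integrable lborel (\<lambda>x. indicator (cube R) x * T x)"
  proof -
    let ?H = "\<lambda>p::(real^3)\<times>real. indicator (cube R) (upd (fst p) j (snd p)) * (u (fst p) * \<rho> (fst p $ j) - w (fst p) * slice_kernel \<rho> (snd p) (fst p $ j))"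
    have "integrable (lborel \<Otimes>\<^sub>M lborel) ?H"
    proof (rule pair_integrable_dominated[OF _ intB])
      show "?H \<in> borel_measurable (lborel \<Otimes>\<^sub>M lborel)" by measurable
      have "integrable lborel (\<lambda>s. indicator {-R..R} s *\<^sub>R (1::real))"
        by (intro borel_integrable_compact) auto
      then show "integrable lborel (\<lambda>s. indicator {-R..R} s :: real)" by simp
      fix x :: "real^3" and s :: real
      have "\<bar>indicator (cube R) (upd x j s)\<bar> \<le> (indicator {-R..R} s :: real)"
      proof (cases "upd x j s \<in> cube R")
        case True
        then have "\<bar>upd x j s $ j\<bar> < R" by (simp only: cube_iff)
        then show ?thesis by (auto simp: indicator_def)
      qed simp
      then have "\<bar>indicator (cube R) (upd x j s)\<bar> * \<bar>u x * \<rho> (x $ j) - w x * slice_kernel \<rho> s (x $ j)\<bar> \<le> indicator {-R..R} s * (B * \<bar>u x\<bar> + \<bar>w x\<bar>)"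
        by (intro mult_mono dom) auto
      then show "\<bar>?H (x, s)\<bar> \<le> (B * \<bar>u x\<bar> + \<bar>w x\<bar>) * indicator {-R..R} s"
        by (simp add: abs_mult mult.commute)
    qed
    from lborel_pair.integrable_fst'[OF swap_eq(1)[OF this]]
    have "integrable lborel (\<lambda>x. \<integral>t. indicator (cube R) x * (u (upd x j t) * \<rho> t - w (upd x j t) * slice_kernel \<rho> (x $ j) t) \<partial>lborel)"
      by (simp add: swap_coord_def)
    then show ?thesis by (simp add: T_def)
  qed
  have "AE x in leb_cube R. u x - T x = 0"
  proof (rule AE_zero_if_tensor_integrals_zero[OF R])
    show "locally_integrable (cube R) (\<lambda>x. u x - T x)"
      unfolding locally_integrable_def
    proof (intro allI impI)
      fix K assume K: "compact K \<and> K \<subseteq> cube R"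
      have "integrable lborel (\<lambda>x. indicator (cube R) x * (u x - T x))"
        using Bochner_Integration.integrable_diff[OF integrable_mult_indicator[OF _ u(1), of "cube R"] T_int]
        by (simp add: right_diff_distrib)
      then have "set_integrable lborel (cube R) (\<lambda>x. u x - T x)" by (simp add: set_integrable_def)
      then have "(\<lambda>x. u x - T x) absolutely_integrable_on cube R"
        by (simp add: set_integrable_def integrable_completion)
      then show "(\<lambda>x. u x - T x) absolutely_integrable_on K"
        using K by (rule_tac set_integrable_subset) (auto intro: lmeasurable_compact fmeasurableD)
    qed
  next
    fix P :: "3 \<Rightarrow> real \<Rightarrow> real" assume P: "\<And>i. test1 R (P i)"
    define p where "p = P j"
    define oth where "oth x = (\<Prod>k\<in>UNIV - {j}. P k (x $ k))" for x :: "real^3"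
    define m where "m = (\<integral>t. p t \<partial>lborel)"
    define \<psi> where "\<psi> t = below_int p t - m * below_int \<rho> t" for t
    have p: "test1 R p" by (simp add: p_def P)
    have \<psi>: "test1 R \<psi>" "deriv \<psi> = (\<lambda>t. p t - m * \<rho> t)"
      using test1_balanced_primitive[OF p \<rho> \<rho>1] unfolding \<psi>_def[abs_def] m_def by auto
    have tens_upd: "tens (P(j := q)) x = q (x $ j) * oth x" for q x
      unfolding oth_def by (subst tens_split[of _ _ j]) (auto intro!: prod.cong)
    have tensP: "tens P x = p (x $ j) * oth x" for x
      using tens_upd[of p x] by (simp add: p_def)
    have oth_upd [simp]: "oth (upd x j t) = oth x" for x t
      unfolding oth_def by (intro prod.cong) auto
    have tm: "tens (P(j := q)) \<in> borel_measurable borel" if "test1 R q" for q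
      by (rule tens_test_borel[of R]) (use that P in auto)
    have [measurable]: "p \<in> borel_measurable borel" by (rule test1_borel[OF p])
    have [measurable]: "oth \<in> borel_measurable borel"
    proof -
      have [measurable]: "P k \<in> borel_measurable borel" for k by (rule test1_borel[OF P])
      show ?thesis unfolding oth_def[abs_def] by measurable
    qed
    have "\<exists>C\<ge>0. \<forall>x. \<bar>oth x\<bar> \<le> C"
    proof -
      have "\<forall>i. \<exists>B. \<forall>t. \<bar>P i t\<bar> \<le> B" using P test1_bounded by metis
      then obtain B where B: "\<And>i t. \<bar>P i t\<bar> \<le> B i" by metis
      have B0: "0 \<le> B i" for i using B[of i 0] by linarith
      have "\<bar>oth x\<bar> \<le> (\<Prod>i\<in>UNIV - {j}. B i)" for x
        unfolding oth_def abs_prod by (intro prod_mono) (auto simp: B)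
      then show ?thesis using B0 by (auto intro!: exI[of _ "\<Prod>i\<in>UNIV - {j}. B i"] prod_nonneg)
    qed
    then obtain C where C: "C \<ge> 0" "\<And>x. \<bar>oth x\<bar> \<le> C" by blast
    have bint: "integrable lborel (\<lambda>x. v x * (q (x $ j) * oth x))"
      if v: "integrable lborel v" and q: "test1 R q" for v q
    proof -
      obtain D where D: "D \<ge> 0" "\<And>t. \<bar>q t\<bar> \<le> D" using test1_bounded[OF q] by metis
      have [measurable]: "q \<in> borel_measurable borel" by (rule test1_borel[OF q])
      show ?thesis
        by (rule integrable_bounded_mult[OF v, of _ "D * C"])
           (auto simp: abs_mult intro!: mult_mono C D)
    qed
    have weak1: "(\<integral>x. u x * (p (x $ j) * oth x) \<partial>lborel) - m * (\<integral>x. u x * (\<rho> (x $ j) * oth x) \<partial>lborel) = - (\<integral>x. w x * (\<psi> (x $ j) * oth x) \<partial>lborel)"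
    proof -
      have "(\<integral>x. u x * (p (x $ j) * oth x) \<partial>lborel) - m * (\<integral>x. u x * (\<rho> (x $ j) * oth x) \<partial>lborel)
         = (\<integral>x. u x * (p (x $ j) * oth x) - m * (u x * (\<rho> (x $ j) * oth x)) \<partial>lborel)"
        by (subst Bochner_Integration.integral_diff) (auto intro!: bint u p \<rho>)
      also have "\<dots> = (\<integral>x. u x * tens ((P(j := \<psi>))(j := deriv ((P(j := \<psi>)) j))) x \<partial>lborel)"
        by (simp only: fun_upd_upd fun_upd_same tens_upd \<psi>(2)) (simp add: algebra_simps)
      also have "\<dots> = - (\<integral>x. w x * tens (P(j := \<psi>)) x \<partial>lborel)"
        by (rule weak) (use P \<psi> in auto)
      finally show ?thesis by (simp only: tens_upd)
    qed
    \<comment> \<open>Integrating \<open>?H\<close> over the additional variable first gives \<open>u\<close> tested with \<open>P\<close>; doing so after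
      the swap gives \<open>T\<close> tested with \<open>P\<close>.\<close>
    let ?H = "\<lambda>q::(real^3)\<times>real. oth (fst q) * p (snd q) * (u (fst q) * \<rho> (fst q $ j) - w (fst q) * slice_kernel \<rho> (snd q) (fst q $ j))"
    have intH: "integrable (lborel \<Otimes>\<^sub>M lborel) ?H"
    proof (rule pair_integrable_dominated)
      show "?H \<in> borel_measurable (lborel \<Otimes>\<^sub>M lborel)" by measurable
      show "integrable lborel (\<lambda>x. C * (B * \<bar>u x\<bar> + \<bar>w x\<bar>))" using intB by simp
      show "integrable lborel (\<lambda>s. \<bar>p s\<bar>)" using test1_integrable[OF p] by simp
      fix x :: "real^3" and s :: real
      have "\<bar>oth x\<bar> * \<bar>p s\<bar> * \<bar>u x * \<rho> (x $ j) - w x * slice_kernel \<rho> s (x $ j)\<bar> \<le> C * \<bar>p s\<bar> * (B * \<bar>u x\<bar> + \<bar>w x\<bar>)"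
        by (intro mult_mono dom C) (auto simp: C)
      then show "\<bar>?H (x, s)\<bar> \<le> C * (B * \<bar>u x\<bar> + \<bar>w x\<bar>) * \<bar>p s\<bar>" by (simp add: abs_mult mult_ac)
    qed
    have "(\<integral>q. ?H q \<partial>(lborel \<Otimes>\<^sub>M lborel)) = (\<integral>x. \<integral>z. ?H (x, z) \<partial>lborel \<partial>lborel)"
      using lborel_pair.integral_fst'[OF intH] by simp
    also have "\<dots> = (\<integral>x. m * (u x * (\<rho> (x $ j) * oth x)) - w x * (\<psi> (x $ j) * oth x) \<partial>lborel)"
    proof (rule Bochner_Integration.integral_cong[OF refl])
      fix x
      have ik: "integrable lborel (\<lambda>z. p z * slice_kernel \<rho> z (x $ j))"
      proof (rule integrable_bounded_mult[OF test1_integrable[OF p], of _ 1])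
        show "(\<lambda>z. slice_kernel \<rho> z (x $ j)) \<in> borel_measurable lborel"
          unfolding slice_kernel_def by measurable
      qed (rule kB)
      have "(\<integral>z. ?H (x, z) \<partial>lborel) = (\<integral>z. (oth x * u x * \<rho> (x $ j)) * p z - (oth x * w x) * (p z * slice_kernel \<rho> z (x $ j)) \<partial>lborel)"
        by (simp add: algebra_simps)
      also have "\<dots> = (oth x * u x * \<rho> (x $ j)) * m - (oth x * w x) * \<psi> (x $ j)"
        using ik test1_integrable[OF p] slice_kernel_integral[OF p, of \<rho> "x $ j"]
        by (subst Bochner_Integration.integral_diff) (auto simp: m_def \<psi>_def)
      finally show "(\<integral>z. ?H (x, z) \<partial>lborel) = m * (u x * (\<rho> (x $ j) * oth x)) - w x * (\<psi> (x $ j) * oth x)"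
        by (simp add: algebra_simps)
    qed
    also have "\<dots> = m * (\<integral>x. u x * (\<rho> (x $ j) * oth x) \<partial>lborel) - (\<integral>x. w x * (\<psi> (x $ j) * oth x) \<partial>lborel)"
      by (subst Bochner_Integration.integral_diff) (auto intro!: bint u w \<rho> \<psi>)
    also have "\<dots> = (\<integral>x. u x * (p (x $ j) * oth x) \<partial>lborel)" using weak1 by simp
    finally have 1: "(\<integral>q. ?H q \<partial>(lborel \<Otimes>\<^sub>M lborel)) = (\<integral>x. u x * tens P x \<partial>lborel)" by (simp add: tensP)
    have intH': "integrable (lborel \<Otimes>\<^sub>M lborel) (\<lambda>q. ?H (swap_coord j q))" by (rule swap_eq(1)[OF intH])
    have inner: "(\<integral>t. ?H (swap_coord j (x, t)) \<partial>lborel) = T x * tens P x" for x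
      by (simp add: swap_coord_def T_def tensP mult.commute mult.left_commute flip: Bochner_Integration.integral_mult_right_zero Bochner_Integration.integral_mult_left_zero)
    have Tint: "integrable lborel (\<lambda>x. T x * tens P x)"
      using lborel_pair.integrable_fst'[OF intH'] by (simp only: inner)
    have 2: "(\<integral>q. ?H (swap_coord j q) \<partial>(lborel \<Otimes>\<^sub>M lborel)) = (\<integral>x. T x * tens P x \<partial>lborel)"
      using lborel_pair.integral_fst'[OF intH'] by (simp only: inner)
    have 3: "(\<integral>x. u x * tens P x \<partial>lborel) = (\<integral>x. T x * tens P x \<partial>lborel)"
      using 1 2 swap_eq(2)[OF intH] by simp
    have iu: "integrable lborel (\<lambda>x. u x * tens P x)" using bint[OF u(1) p] by (simp add: tensP)
    have "(\<integral>x. (u x - T x) * tens P x \<partial>leb_cube R) = (\<integral>x. u x * tens P x - T x * tens P x \<partial>leb_cube R)"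
      by (simp add: algebra_simps)
    also have "\<dots> = (\<integral>x. u x * tens P x - T x * tens P x \<partial>lborel)"
    proof (rule integral_cube_lborel)
      show "(\<lambda>x. u x * tens P x - T x * tens P x) \<in> borel_measurable borel"
        using iu Tint by auto
      show "u x * tens P x - T x * tens P x = 0" if "x \<notin> cube R" for x
        using tens_outside_cube[OF P that] by simp
    qed
    also have "\<dots> = 0" using 3 iu Tint by (subst Bochner_Integration.integral_diff) auto
    finally show "(\<integral>x. (u x - T x) * tens P x \<partial>leb_cube R) = 0" .
  qed
  then have "AE x in lebesgue. x \<in> cube R \<longrightarrow> u x - T x = 0"
    by (subst (asm) AE_restrict_space_iff) auto
  then have "AE x in lborel. x \<in> cube R \<longrightarrow> u x - T x = 0" by (simp only: AE_completion_iff)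
  then show ?thesis
  proof eventually_elim
    case (elim x)
    show ?case
    proof (cases "x \<in> cube R")
      case True
      let ?f = "\<lambda>t. u (upd x j t) * \<rho> t - w (upd x j t) * slice_kernel \<rho> (x $ j) t"
      have "ennreal \<bar>T x\<bar> \<le> (\<integral>\<^sup>+t. ennreal \<bar>?f t\<bar> \<partial>lborel)"
      proof (cases "integrable lborel ?f")
        case True
        then show ?thesis using integral_norm_bound_ennreal[OF True] by (simp add: T_def)
      next
        case False
        then show ?thesis by (simp add: T_def not_integrable_integral_eq)
      qed
      also have "\<dots> \<le> (\<integral>\<^sup>+t. ennreal B * ennreal (\<bar>u (upd x j t)\<bar> + \<bar>w (upd x j t)\<bar>) \<partial>lborel)"
      proof (rule nn_integral_mono)
        fix t
        have "\<bar>?f t\<bar> \<le> B * \<bar>u (upd x j t)\<bar> + 1 * \<bar>w (upd x j t)\<bar>" using dom by simp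
        also have "\<dots> \<le> B * \<bar>u (upd x j t)\<bar> + B * \<bar>w (upd x j t)\<bar>"
          using B1 by (intro add_left_mono mult_right_mono) auto
        finally have "\<bar>?f t\<bar> \<le> B * (\<bar>u (upd x j t)\<bar> + \<bar>w (upd x j t)\<bar>)" by (simp add: algebra_simps)
        then show "ennreal \<bar>?f t\<bar> \<le> ennreal B * ennreal (\<bar>u (upd x j t)\<bar> + \<bar>w (upd x j t)\<bar>)"
          using B1 by (subst ennreal_mult[symmetric]) (auto intro: ennreal_leI)
      qed
      also have "\<dots> = ennreal B * line_int j (\<lambda>x. ennreal (\<bar>u x\<bar> + \<bar>w x\<bar>)) x"
        unfolding line_int_def by (rule nn_integral_cmult) measurable
      finally show ?thesis using elim True by simp
    qed (simp add: u)
  qed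
qed

section \<open>Products of functions with mixed derivatives\<close>

lemma line_int_mono: "(\<And>x. F x \<le> G x) \<Longrightarrow> line_int j F x \<le> line_int j G x"
  unfolding line_int_def by (intro nn_integral_mono) auto

lemma line_int_mono_AE:
  assumes "AE x in lborel. F x \<le> G x"
  shows "AE x in lborel. line_int j F x \<le> line_int j G x"
  using AE_line[OF assms, of j] by eventually_elim (auto simp: line_int_def intro: nn_integral_mono_AE)

lemma line_int_cmult:
  assumes [measurable]: "F \<in> borel_measurable borel"
  shows "line_int j (\<lambda>x. c * F x) x = c * line_int j F x"
  unfolding line_int_def by (rule nn_integral_cmult) measurable

lemma line_int_add:
  assumes [measurable]: "F \<in> borel_measurable borel" "G \<in> borel_measurable borel"
  shows "line_int j (\<lambda>x. F x + G x) x = line_int j F x + line_int j G x"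
  unfolding line_int_def by (rule nn_integral_add) measurable

lemma line_int_zero: "(\<And>t. F (upd x j t) = 0) \<Longrightarrow> line_int j F x = 0"
  unfolding line_int_def by simp

definition slab :: "real \<Rightarrow> 3 set \<Rightarrow> (real^3) set" where
  "slab R A = {x. \<forall>i\<in>A. \<bar>x $ i\<bar> < R}"

lemma slab_borel [measurable]: "slab R A \<in> sets borel"
proof -
  have "slab R A = (\<Inter>i\<in>A. {x. \<bar>x $ i\<bar> < R})" by (auto simp: slab_def)
  moreover have "open (\<Inter>i\<in>A. {x::real^3. \<bar>x $ i\<bar> < R})"
    by (intro open_INT) (auto intro!: open_Collect_less continuous_intros)
  ultimately show ?thesis by simp
qed

lemma cube_eq_slab: "cube R = slab R UNIV" by (auto simp: slab_def cube_iff)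

lemma line_int_slab:
  assumes "R > 0" "j \<in> A"
  shows "line_int j (indicator (slab R A)) x \<le> ennreal (2 * R) * indicator (slab R (A - {j})) x"
proof -
  have "line_int j (indicator (slab R A)) x = (\<integral>\<^sup>+t. indicator (slab R (A - {j})) x * indicator {-R<..<R} t \<partial>lborel)"
    unfolding line_int_def using assms(2)
    by (intro nn_integral_cong) (auto simp: indicator_def slab_def abs_less_iff)
  also have "\<dots> = indicator (slab R (A - {j})) x * (\<integral>\<^sup>+t. indicator {-R<..<R} t \<partial>lborel)"
    by (rule nn_integral_cmult) measurable
  also have "\<dots> = indicator (slab R (A - {j})) x * ennreal (2 * R)"
    using assms(1) by simp
  finally show ?thesis by (simp add: mult.commute)
qed

text \<open>The Cauchy-Schwarz inequality on a segment of length \<open>2 R\<close>.\<close>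
lemma line_int_square_le:
  assumes [measurable]: "F \<in> borel_measurable borel"
    and R: "R > 0" and supp: "\<And>x. \<not> \<bar>x $ j\<bar> < R \<Longrightarrow> F x = 0"
  shows "(line_int j F x)\<^sup>2 \<le> ennreal (2 * R) * line_int j (\<lambda>x. (F x)\<^sup>2) x"
proof -
  have "line_int j F x = (\<integral>\<^sup>+t. F (upd x j t) * indicator {-R<..<R} t \<partial>lborel)"
    unfolding line_int_def using supp[of "upd x j _"]
    by (intro nn_integral_cong) (auto simp: indicator_def abs_less_iff)
  also have "\<dots>\<^sup>2 \<le> (\<integral>\<^sup>+t. (F (upd x j t))\<^sup>2 \<partial>lborel) * (\<integral>\<^sup>+t. (indicator {-R<..<R} t)\<^sup>2 \<partial>lborel)"
    by (rule Cauchy_Schwarz_nn_integral) measurable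
  also have "(\<integral>\<^sup>+t. (indicator {-R<..<R} t)\<^sup>2 \<partial>lborel) = (\<integral>\<^sup>+t. indicator {-R<..<R} t \<partial>lborel)"
    by (intro nn_integral_cong) (auto simp: indicator_def)
  finally show ?thesis using R by (simp add: line_int_def mult.commute)
qed

lemma emeasure_cube: "R > 0 \<Longrightarrow> emeasure lborel (cube R) = ennreal ((2 * R) ^ 3)"
  unfolding cube_eq_box by (subst emeasure_box_vec) auto

text \<open>The left-hand side does not depend on \<open>x\<close>. Its integral over the cube is computed by moving the line
  integrals to the indicator of the cube one by one; each of them contributes a factor \<open>2 R\<close>, and
  together these are the volume of the cube.\<close>
lemma triple_line_int_le:
  assumes R: "R > (0::real)" and [measurable]: "H \<in> borel_measurable borel"
  shows "line_int 3 (line_int 1 (line_int 2 H)) x \<le> (\<integral>\<^sup>+y. H y \<partial>lborel)"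
proof -
  define \<kappa> where "\<kappa> = line_int 3 (line_int 1 (line_int 2 H)) x"
  have const: "line_int 3 (line_int 1 (line_int 2 H)) y = \<kappa>" for y
  proof -
    have "upd (upd (upd y 3 t) 1 s) 2 r = upd (upd (upd x 3 t) 1 s) 2 r" for t s r
      by (auto simp: Finite_Cartesian_Product.vec_eq_iff forall_3)
    then show ?thesis by (simp add: \<kappa>_def line_int_def)
  qed
  let ?c = "ennreal (2 * R)"
  have "\<kappa> * ennreal ((2 * R) ^ 3) = (\<integral>\<^sup>+y. indicator (cube R) y * line_int 3 (line_int 1 (line_int 2 H)) y \<partial>lborel)"
    unfolding const using R by (subst nn_integral_multc) (simp_all add: emeasure_cube mult.commute)
  also have "\<dots> = (\<integral>\<^sup>+y. line_int 1 (line_int 2 H) y * line_int 3 (indicator (slab R UNIV)) y \<partial>lborel)"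
    unfolding cube_eq_slab by (rule line_int_self_adjoint) measurable
  also have "\<dots> \<le> (\<integral>\<^sup>+y. line_int 1 (line_int 2 H) y * (?c * indicator (slab R {1, 2}) y) \<partial>lborel)"
  proof (intro nn_integral_mono mult_left_mono)
    have "UNIV - {3} = {1, 2 :: 3}" using exhaust_3 by auto
    then show "line_int 3 (indicator (slab R UNIV)) y \<le> ?c * indicator (slab R {1, 2}) y" for y
      using line_int_slab[OF R, of 3 UNIV y] by simp
  qed simp
  also have "\<dots> = ?c * (\<integral>\<^sup>+y. indicator (slab R {1, 2}) y * line_int 1 (line_int 2 H) y \<partial>lborel)"
    by (subst nn_integral_cmult[symmetric]) (auto simp: mult_ac)
  also have "(\<integral>\<^sup>+y. indicator (slab R {1, 2}) y * line_int 1 (line_int 2 H) y \<partial>lborel)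
     = (\<integral>\<^sup>+y. line_int 2 H y * line_int 1 (indicator (slab R {1, 2})) y \<partial>lborel)"
    by (rule line_int_self_adjoint) measurable
  also have "\<dots> \<le> (\<integral>\<^sup>+y. line_int 2 H y * (?c * indicator (slab R {2}) y) \<partial>lborel)"
  proof (intro nn_integral_mono mult_left_mono)
    have "{1,2} - {1} = {2 :: 3}" by auto
    then show "line_int 1 (indicator (slab R {1, 2})) y \<le> ?c * indicator (slab R {2}) y" for y
      using line_int_slab[OF R, of 1 "{1,2}" y] by simp
  qed simp
  also have "\<dots> = ?c * (\<integral>\<^sup>+y. indicator (slab R {2}) y * line_int 2 H y \<partial>lborel)"
    by (subst nn_integral_cmult[symmetric]) (auto simp: mult_ac)
  also have "(\<integral>\<^sup>+y. indicator (slab R {2}) y * line_int 2 H y \<partial>lborel)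
     = (\<integral>\<^sup>+y. H y * line_int 2 (indicator (slab R {2})) y \<partial>lborel)"
    by (rule line_int_self_adjoint) measurable
  also have "\<dots> \<le> (\<integral>\<^sup>+y. H y * ?c \<partial>lborel)"
  proof (intro nn_integral_mono mult_left_mono)
    show "line_int 2 (indicator (slab R {2})) y \<le> ?c" for y
      using line_int_slab[OF R, of 2 "{2}" y] by (simp add: slab_def)
  qed simp
  also have "\<dots> = (\<integral>\<^sup>+y. H y \<partial>lborel) * ?c" by (rule nn_integral_multc) measurable
  finally have "\<kappa> * ennreal ((2 * R) ^ 3) \<le> ?c * (?c * ((\<integral>\<^sup>+y. H y \<partial>lborel) * ?c))"
    by (simp add: mult_left_mono)
  also have "\<dots> = (\<integral>\<^sup>+y. H y \<partial>lborel) * ennreal ((2 * R) ^ 3)"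
    using R by (subst ennreal_power[symmetric]) (simp_all add: power3_eq_cube mult_ac)
  finally have "\<kappa> * ennreal ((2 * R) ^ 3) \<le> (\<integral>\<^sup>+y. H y \<partial>lborel) * ennreal ((2 * R) ^ 3)" .
  then show ?thesis using R
    unfolding \<kappa>_def[symmetric] by (simp add: mult.commute[of _ "ennreal _"] ennreal_mult_le_mult_iff)
qed

text \<open>Here \<open>u\<close> and \<open>w\<close> are thought of as extended by zero to the whole space, so that the line integrals are
  taken over entire lines.\<close>
definition weak_partial :: "real \<Rightarrow> 3 \<Rightarrow> (real^3 \<Rightarrow> real) \<Rightarrow> (real^3 \<Rightarrow> real) \<Rightarrow> bool" where
  "weak_partial R j u w \<longleftrightarrow> (\<forall>P. (\<forall>i. test1 R (P i)) \<longrightarrow>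
     (\<integral>x. u x * tens (P(j := deriv (P j))) x \<partial>lborel) = - (\<integral>x. w x * tens P x \<partial>lborel))"

lemma exists_unit_bump:
  assumes R: "R > 0"
  obtains \<rho> B where "test1 R \<rho>" "(\<integral>t. \<rho> t \<partial>lborel) = 1" "\<And>t. 0 \<le> \<rho> t" "\<And>t. \<rho> t \<le> B" "(1::real) \<le> B"
proof -
  let ?b = "bump (-R/2) (R/2) 1"
  have b: "test1 R ?b" using R by (intro test1_bump) auto
  define m where "m = (\<integral>t. ?b t \<partial>lborel)"
  have m: "m > 0"
  proof (rule ccontr)
    assume "\<not> 0 < m"
    moreover have "0 \<le> m" unfolding m_def by (intro Bochner_Integration.integral_nonneg) (simp add: bump_bounds)
    ultimately have "m = 0" by simp
    then have "AE t in lborel. ?b t = 0"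
      using integral_nonneg_eq_0_iff_AE[OF test1_integrable[OF b]] bump_bounds by (simp add: m_def)
    then have "AE t in lborel. t \<notin> {-R/2<..<R/2}"
    proof eventually_elim
      case (elim t)
      then show ?case using bump_pos[of "-R/2" t "R/2" 1] by auto
    qed
    then have "emeasure lborel {-R/2<..<R/2} = 0"
      by (subst (asm) AE_iff_measurable[where N="{-R/2<..<R/2}"]) auto
    then show False using R by simp
  qed
  show thesis
  proof (rule that)
    have "test1 R (\<lambda>t. 0 * ?b t - (- 1 / m) * ?b t)"
      by (rule test1_lin) (use b in \<open>auto simp: test1_def\<close>)
    then show "test1 R (\<lambda>t. ?b t / m)" by simp
    show "(\<integral>t. ?b t / m \<partial>lborel) = 1" using m by (simp add: m_def)
    show "0 \<le> ?b t / m" for t using m by (simp add: bump_bounds)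
    show "?b t / m \<le> max 1 (1 / m)" for t
      using m bump_bounds[of "-R/2" "R/2" 1 t] by (auto simp: field_simps le_max_iff_disj)
  qed simp
qed

lemma ennreal_collect4:
  fixes X :: ennreal
  assumes "0 \<le> a" "0 \<le> c" "0 \<le> d"
  shows "ennreal a * (ennreal c * (ennreal c * (ennreal d * X))) = ennreal (a * c\<^sup>2 * d) * X"
  using assms by (simp add: ennreal_mult power2_eq_square mult_ac)

lemma ennreal_collect3:
  fixes X :: ennreal
  assumes "0 \<le> a" "0 \<le> c" "0 \<le> d"
  shows "ennreal a * (ennreal c * (ennreal d * X)) = ennreal (a * c * d) * X"
  using assms by (simp add: ennreal_mult mult_ac)

lemma square_sum4_le:
  fixes a b c d :: real
  shows "(a + b + c + d)\<^sup>2 \<le> 4 * (a\<^sup>2 + b\<^sup>2 + c\<^sup>2 + d\<^sup>2)"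
proof -
  have "0 \<le> (a-b)\<^sup>2 + (a-c)\<^sup>2 + (a-d)\<^sup>2 + (b-c)\<^sup>2 + (b-d)\<^sup>2 + (c-d)\<^sup>2" by simp
  then show ?thesis by (simp add: power2_eq_square algebra_simps)
qed

text \<open>Slicing in the directions 1 and 2 dominates \<open>f\<close> by a function of the third coordinate, at the price of
  the mixed derivative \<open>f12\<close>; slicing in direction 3 dominates \<open>g\<close> by a function of the first two. After
  moving the line integral in direction 3 from one factor to the other, \<open>triple_line_int_le\<close> applies.\<close>
lemma mixed_product_bound:
  assumes R: "R > 0"
  obtains C where "C > 0" "\<And>f f1 f2 f12 g g3.
      (\<And>h. h \<in> {f, f1, f2, f12, g, g3} \<Longrightarrow> integrable lborel h \<and> (\<forall>x. x \<notin> cube R \<longrightarrow> h x = 0)) \<Longrightarrow>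
      weak_partial R 1 f f1 \<Longrightarrow> weak_partial R 2 f f2 \<Longrightarrow> weak_partial R 2 f1 f12 \<Longrightarrow> weak_partial R 3 g g3 \<Longrightarrow>
      (\<integral>\<^sup>+x. ennreal ((f x)\<^sup>2 * (g x)\<^sup>2) \<partial>lborel) \<le> ennreal C *
        (\<integral>\<^sup>+x. ennreal ((f x)\<^sup>2 + (f1 x)\<^sup>2 + (f2 x)\<^sup>2 + (f12 x)\<^sup>2) \<partial>lborel) * (\<integral>\<^sup>+x. ennreal ((g x)\<^sup>2 + (g3 x)\<^sup>2) \<partial>lborel)"
proof -
  obtain \<rho> B where \<rho>: "test1 R \<rho>" "(\<integral>t. \<rho> t \<partial>lborel) = 1" "\<And>t. 0 \<le> \<rho> t" "\<And>t. \<rho> t \<le> B" and B: "(1::real) \<le> B"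
    using exists_unit_bump[OF R] by metis
  let ?c = "ennreal (2 * R)"
  define C1 where "C1 = B^4 * (2*R)^2 * 4"
  define C2 where "C2 = B^2 * (2*R) * 2"
  have C12: "C1 > 0" "C2 > 0" using B R by (auto simp: C1_def C2_def)
  show thesis
  proof (rule that[of "C1 * C2"])
    show "C1 * C2 > 0" using C12 by simp
    fix f f1 f2 f12 g g3 :: "real^3 \<Rightarrow> real"
    assume *: "\<And>h. h \<in> {f, f1, f2, f12, g, g3} \<Longrightarrow> integrable lborel h \<and> (\<forall>x. x \<notin> cube R \<longrightarrow> h x = 0)"
      and weak: "weak_partial R 1 f f1" "weak_partial R 2 f f2" "weak_partial R 2 f1 f12" "weak_partial R 3 g g3"
    have int: "integrable lborel f" "integrable lborel f1" "integrable lborel f2" "integrable lborel f12" "integrable lborel g" "integrable lborel g3"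
      using * by auto
    then have [measurable]: "f \<in> borel_measurable borel" "f1 \<in> borel_measurable borel" "f2 \<in> borel_measurable borel" "f12 \<in> borel_measurable borel" 
      "g \<in> borel_measurable borel" "g3 \<in> borel_measurable borel" by auto
    have supp: "f x = 0" "f1 x = 0" "f2 x = 0" "f12 x = 0" "g x = 0" "g3 x = 0" if "x \<notin> cube R" for x
      using * that by auto
    have sb: "AE x in lborel. ennreal \<bar>u x\<bar> \<le> ennreal B * line_int j (\<lambda>x. ennreal (\<bar>u x\<bar> + \<bar>w x\<bar>)) x"
      if "weak_partial R j u w" "u \<in> {f, f1, g}" "w \<in> {f1, f2, f12, g3}" for u w j
      by (rule slice_bound[OF R \<rho> B]) (use that * in \<open>auto simp: weak_partial_def\<close>)
    define h where "h x = \<bar>f x\<bar> + \<bar>f1 x\<bar> + \<bar>f2 x\<bar> + \<bar>f12 x\<bar>" for x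
    define k where "k x = \<bar>g x\<bar> + \<bar>g3 x\<bar>" for x
    define H where "H x = (f x)\<^sup>2 + (f1 x)\<^sup>2 + (f2 x)\<^sup>2 + (f12 x)\<^sup>2" for x
    define K where "K x = (g x)\<^sup>2 + (g3 x)\<^sup>2" for x
    have [measurable]: "h \<in> borel_measurable borel" "k \<in> borel_measurable borel" "H \<in> borel_measurable borel" "K \<in> borel_measurable borel"
      unfolding h_def k_def H_def K_def by measurable
    have hsupp: "h x = 0" "k x = 0" if "x \<notin> cube R" for x using supp[OF that] by (auto simp: h_def k_def)
    have hH: "(h x)\<^sup>2 \<le> 4 * H x" for x
      unfolding h_def H_def using square_sum4_le[of "\<bar>f x\<bar>" "\<bar>f1 x\<bar>" "\<bar>f2 x\<bar>" "\<bar>f12 x\<bar>"] by simp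
    have kK: "(k x)\<^sup>2 \<le> 2 * K x" for x
      unfolding k_def K_def using sum_squares_bound[of "\<bar>g x\<bar>" "\<bar>g3 x\<bar>"] by (simp add: power2_sum)
    have [simp]: "0 \<le> h x" "0 \<le> k x" "0 \<le> H x" "0 \<le> K x" for x by (auto simp: h_def k_def H_def K_def)
    \<comment> \<open>The bound in direction 2 is applied to \<open>f\<close> and \<open>f1\<close> at once, and its result is inserted into the
      bound in direction 1.\<close>
    have "AE x in lborel. ennreal (\<bar>f x\<bar> + \<bar>f1 x\<bar>) \<le> ennreal B * line_int 2 (\<lambda>x. ennreal (h x)) x"
      using sb[OF weak(2), simplified] sb[OF weak(3), simplified]
    proof eventually_elim
      case (elim x)
      have "ennreal (\<bar>f x\<bar> + \<bar>f1 x\<bar>) = ennreal \<bar>f x\<bar> + ennreal \<bar>f1 x\<bar>" by simp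
      also have "\<dots> \<le> ennreal B * line_int 2 (\<lambda>x. ennreal (\<bar>f x\<bar> + \<bar>f2 x\<bar>)) x + ennreal B * line_int 2 (\<lambda>x. ennreal (\<bar>f1 x\<bar> + \<bar>f12 x\<bar>)) x"
        using elim by (intro add_mono) simp_all
      also have "\<dots> = ennreal B * line_int 2 (\<lambda>x. ennreal (\<bar>f x\<bar> + \<bar>f2 x\<bar>) + ennreal (\<bar>f1 x\<bar> + \<bar>f12 x\<bar>)) x"
        by (subst line_int_add) (auto simp: distrib_left)
      also have "\<dots> = ennreal B * line_int 2 (\<lambda>x. ennreal (h x)) x"
        by (simp add: h_def algebra_simps flip: ennreal_plus)
      finally show ?case by simp
    qed
    note lm = line_int_mono_AE[OF this, of 1]
    have "AE x in lborel. ennreal \<bar>f x\<bar> \<le> ennreal B * line_int 1 (\<lambda>x. ennreal (\<bar>f x\<bar> + \<bar>f1 x\<bar>)) x"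
      by (rule sb[OF weak(1)]) auto
    with lm
    have fb: "AE x in lborel. ennreal \<bar>f x\<bar> \<le> ennreal B * (ennreal B * line_int 1 (line_int 2 (\<lambda>x. ennreal (h x))) x)"
    proof eventually_elim
      case (elim x)
      have "ennreal B * line_int 1 (\<lambda>x. ennreal (\<bar>f x\<bar> + \<bar>f1 x\<bar>)) x \<le> ennreal B * line_int 1 (\<lambda>x. ennreal B * line_int 2 (\<lambda>x. ennreal (h x)) x) x"
        using elim(1) by (rule mult_left_mono) simp
      also have "\<dots> = ennreal B * (ennreal B * line_int 1 (line_int 2 (\<lambda>x. ennreal (h x))) x)"
        by (subst line_int_cmult) auto
      finally show ?case using elim(2) by (rule order_trans[rotated])
    qed
    have f2b: "AE x in lborel. ennreal ((f x)\<^sup>2) \<le> ennreal C1 * line_int 1 (line_int 2 (\<lambda>x. ennreal (H x))) x"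
      using fb
    proof eventually_elim
      case (elim x)
      have "ennreal ((f x)\<^sup>2) = (ennreal \<bar>f x\<bar>)\<^sup>2" by (simp add: ennreal_power)
      also have "\<dots> \<le> (ennreal B * (ennreal B * line_int 1 (line_int 2 (\<lambda>x. ennreal (h x))) x))\<^sup>2"
        using elim by (rule power_mono) simp
      also have "\<dots> = ennreal (B^4) * (line_int 1 (line_int 2 (\<lambda>x. ennreal (h x))) x)\<^sup>2"
        using B by (simp add: power_mult_distrib ennreal_power[symmetric] mult.assoc[symmetric] flip: power_add)
      also have "(line_int 1 (line_int 2 (\<lambda>x. ennreal (h x))) x)\<^sup>2 \<le> ?c * line_int 1 (\<lambda>x. (line_int 2 (\<lambda>x. ennreal (h x)) x)\<^sup>2) x"
        by (rule line_int_square_le[OF _ R]) (auto intro!: line_int_zero hsupp simp: cube_iff dest!: spec[of _ "1::3"])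
      also have "\<dots> \<le> ?c * line_int 1 (\<lambda>x. ?c * line_int 2 (\<lambda>x. (ennreal (h x))\<^sup>2) x) x"
        by (intro mult_left_mono line_int_mono line_int_square_le[OF _ R]) (auto intro!: hsupp simp: cube_iff)
      also have "\<dots> \<le> ?c * line_int 1 (\<lambda>x. ?c * line_int 2 (\<lambda>x. ennreal 4 * ennreal (H x)) x) x"
        by (intro mult_left_mono line_int_mono) (auto simp: ennreal_power hH intro!: ennreal_leI simp flip: ennreal_mult'' ennreal_numeral)
      also have "\<dots> = ?c * (?c * (ennreal 4 * line_int 1 (line_int 2 (\<lambda>x. ennreal (H x))) x))"
        by (simp add: line_int_cmult)
      also have "ennreal (B^4) * (?c * (?c * (ennreal 4 * line_int 1 (line_int 2 (\<lambda>x. ennreal (H x))) x)))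
         = ennreal C1 * line_int 1 (line_int 2 (\<lambda>x. ennreal (H x))) x"
        unfolding C1_def using R B by (intro ennreal_collect4) auto
      finally show ?case by (simp add: mult_left_mono)
    qed
    have g2b: "AE x in lborel. ennreal ((g x)\<^sup>2) \<le> ennreal C2 * line_int 3 (\<lambda>x. ennreal (K x)) x"
      using sb[OF weak(4), simplified]
    proof eventually_elim
      case (elim x)
      have "ennreal ((g x)\<^sup>2) = (ennreal \<bar>g x\<bar>)\<^sup>2" by (simp add: ennreal_power)
      also have "\<dots> \<le> (ennreal B * line_int 3 (\<lambda>x. ennreal (k x)) x)\<^sup>2"
        using elim unfolding k_def by (intro power_mono) simp_all
      also have "\<dots> = ennreal (B^2) * (line_int 3 (\<lambda>x. ennreal (k x)) x)\<^sup>2"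
        using B by (simp add: power_mult_distrib ennreal_power)
      also have "(line_int 3 (\<lambda>x. ennreal (k x)) x)\<^sup>2 \<le> ?c * line_int 3 (\<lambda>x. (ennreal (k x))\<^sup>2) x"
        by (rule line_int_square_le[OF _ R]) (auto intro!: hsupp simp: cube_iff)
      also have "\<dots> \<le> ?c * line_int 3 (\<lambda>x. ennreal 2 * ennreal (K x)) x"
        by (intro mult_left_mono line_int_mono) (auto simp: ennreal_power kK intro!: ennreal_leI simp flip: ennreal_mult'' ennreal_numeral)
      also have "\<dots> = ?c * (ennreal 2 * line_int 3 (\<lambda>x. ennreal (K x)) x)"
        by (simp add: line_int_cmult)
      also have "ennreal (B^2) * (?c * (ennreal 2 * line_int 3 (\<lambda>x. ennreal (K x)) x))
         = ennreal C2 * line_int 3 (\<lambda>x. ennreal (K x)) x"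
        unfolding C2_def using R B by (intro ennreal_collect3) auto
      finally show ?case by (simp add: mult_left_mono)
    qed
    have "(\<integral>\<^sup>+x. ennreal ((f x)\<^sup>2 * (g x)\<^sup>2) \<partial>lborel) \<le>
       (\<integral>\<^sup>+x. ennreal (C1 * C2) * (line_int 1 (line_int 2 (\<lambda>x. ennreal (H x))) x * line_int 3 (\<lambda>x. ennreal (K x)) x) \<partial>lborel)"
    proof (rule nn_integral_mono_AE)
      show "AE x in lborel. ennreal ((f x)\<^sup>2 * (g x)\<^sup>2) \<le> ennreal (C1 * C2) * (line_int 1 (line_int 2 (\<lambda>x. ennreal (H x))) x * line_int 3 (\<lambda>x. ennreal (K x)) x)"
        using f2b g2b
      proof eventually_elim
        case (elim x)
        have "ennreal ((f x)\<^sup>2 * (g x)\<^sup>2) = ennreal ((f x)\<^sup>2) * ennreal ((g x)\<^sup>2)" by (simp add: ennreal_mult)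
        also have "\<dots> \<le> (ennreal C1 * line_int 1 (line_int 2 (\<lambda>x. ennreal (H x))) x) * (ennreal C2 * line_int 3 (\<lambda>x. ennreal (K x)) x)"
          using elim by (intro mult_mono) auto
        also have "\<dots> = ennreal (C1 * C2) * (line_int 1 (line_int 2 (\<lambda>x. ennreal (H x))) x * line_int 3 (\<lambda>x. ennreal (K x)) x)"
          using C12 by (simp add: ennreal_mult mult_ac)
        finally show ?case .
      qed
    qed
    also have "\<dots> = ennreal (C1 * C2) * (\<integral>\<^sup>+x. line_int 1 (line_int 2 (\<lambda>x. ennreal (H x))) x * line_int 3 (\<lambda>x. ennreal (K x)) x \<partial>lborel)"
      by (rule nn_integral_cmult) measurable
    also have "(\<integral>\<^sup>+x. line_int 1 (line_int 2 (\<lambda>x. ennreal (H x))) x * line_int 3 (\<lambda>x. ennreal (K x)) x \<partial>lborel)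
       = (\<integral>\<^sup>+x. ennreal (K x) * line_int 3 (line_int 1 (line_int 2 (\<lambda>x. ennreal (H x)))) x \<partial>lborel)"
      by (rule line_int_self_adjoint) measurable
    also have "\<dots> \<le> (\<integral>\<^sup>+x. ennreal (K x) * (\<integral>\<^sup>+y. ennreal (H y) \<partial>lborel) \<partial>lborel)"
      by (intro nn_integral_mono mult_left_mono triple_line_int_le[OF R]) auto
    also have "\<dots> = (\<integral>\<^sup>+x. ennreal (K x) \<partial>lborel) * (\<integral>\<^sup>+y. ennreal (H y) \<partial>lborel)"
      by (rule nn_integral_multc) measurable
    finally have "(\<integral>\<^sup>+x. ennreal ((f x)\<^sup>2 * (g x)\<^sup>2) \<partial>lborel) \<le> ennreal (C1 * C2) *
        ((\<integral>\<^sup>+x. ennreal (K x) \<partial>lborel) * (\<integral>\<^sup>+y. ennreal (H y) \<partial>lborel))"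
      by (simp add: mult_left_mono)
    then show "(\<integral>\<^sup>+x. ennreal ((f x)\<^sup>2 * (g x)\<^sup>2) \<partial>lborel) \<le> ennreal (C1 * C2) *
        (\<integral>\<^sup>+x. ennreal ((f x)\<^sup>2 + (f1 x)\<^sup>2 + (f2 x)\<^sup>2 + (f12 x)\<^sup>2) \<partial>lborel) * (\<integral>\<^sup>+x. ennreal ((g x)\<^sup>2 + (g3 x)\<^sup>2) \<partial>lborel)"
      by (simp only: H_def K_def mult_ac)
  qed
qed

section \<open>Weak derivatives and Sobolev norms on the cube\<close>

lemma test_fun_pderiv:
  assumes "test_fun \<Omega> \<phi>" shows "test_fun \<Omega> (pderiv_dir j \<phi>)"
proof -
  have "foldr pderiv_dir js (pderiv_dir j \<phi>) differentiable (at x)" for js x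
  proof -
    have "foldr pderiv_dir (js @ [j]) \<phi> differentiable (at x)"
      using assms unfolding test_fun_def smooth_fun_def by blast
    then show ?thesis by simp
  qed
  then have s: "smooth_fun (pderiv_dir j \<phi>)" by (simp add: smooth_fun_def)
  let ?K = "closure {x. \<phi> x \<noteq> 0}"
  have "pderiv_dir j \<phi> x = 0" if "x \<notin> ?K" for x
  proof -
    have "(\<phi> has_derivative (\<lambda>h. 0)) (at x)"
    proof (rule has_derivative_transform_within_open[of "\<lambda>x. 0" _ _ _ "- ?K"])
      show "0 = \<phi> y" if "y \<in> - ?K" for y using that closure_subset[of "{x. \<phi> x \<noteq> 0}"] by auto
    qed (use that in auto)
    then show ?thesis unfolding pderiv_dir_def using frechet_derivative_at[of \<phi> "\<lambda>h. 0" x] by metis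
  qed
  then have "closure {x. pderiv_dir j \<phi> x \<noteq> 0} \<subseteq> ?K" by (intro closure_minimal) auto
  moreover have "compact ?K" "?K \<subseteq> \<Omega>" using assms by (auto simp: test_fun_def)
  ultimately show ?thesis unfolding test_fun_def using s
    unfolding compact_eq_bounded_closed by (meson bounded_subset closed_closure subset_trans)
qed

lemma test_fun_funpow: "test_fun \<Omega> \<phi> \<Longrightarrow> test_fun \<Omega> ((pderiv_dir j ^^ n) \<phi>)"
  by (induction n) (auto intro: test_fun_pderiv)

lemma test_fun_mi_deriv: "test_fun \<Omega> \<phi> \<Longrightarrow> test_fun \<Omega> (mi_deriv \<beta> \<phi>)"
  unfolding mi_deriv_def by (intro test_fun_funpow)

lemma test_fun_continuous: "test_fun \<Omega> \<phi> \<Longrightarrow> continuous_on S \<phi>"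
proof -
  assume "test_fun \<Omega> \<phi>"
  then have "foldr pderiv_dir [] \<phi> differentiable (at x)" for x unfolding test_fun_def smooth_fun_def by blast
  then show ?thesis by (auto intro!: continuous_at_imp_continuous_on differentiable_imp_continuous_within)
qed

lemma integrable_restrict_cube:
  "integrable (leb_cube R) f \<longleftrightarrow> integrable lebesgue (\<lambda>x. indicator (cube R) x * (f x :: real))"
  by (subst integrable_restrict_space) auto

lemma integrable_test_fun:
  assumes u: "locally_integrable (cube R) u" and \<phi>: "test_fun (cube R) \<phi>"
  shows "integrable (leb_cube R) (\<lambda>x. u x * \<phi> x)"
proof -
  let ?K = "closure {x. \<phi> x \<noteq> 0}"
  have K: "compact ?K" "?K \<subseteq> cube R" using \<phi> by (auto simp: test_fun_def)
  have \<phi>0: "\<phi> x = 0" if "x \<notin> ?K" for x using that closure_subset[of "{x. \<phi> x \<noteq> 0}"] by auto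
  have "bounded (\<phi> ` ?K)" by (intro compact_imp_bounded compact_continuous_image test_fun_continuous[OF \<phi>] K)
  then obtain B where B: "\<And>x. x \<in> ?K \<Longrightarrow> \<bar>\<phi> x\<bar> \<le> B" unfolding bounded_iff by force
  have B': "\<bar>\<phi> x\<bar> \<le> max B 0" for x using B[of x] \<phi>0[of x] by (cases "x \<in> ?K") auto
  have "integrable lebesgue (\<lambda>x. indicator ?K x * u x)"
    using u K unfolding locally_integrable_def set_integrable_def by auto
  then have "integrable lebesgue (\<lambda>x. indicator ?K x * u x * \<phi> x)"
  proof (rule integrable_bounded_mult[OF _ _ B'])
    have "\<phi> \<in> borel_measurable borel" by (intro borel_measurable_continuous_onI test_fun_continuous[OF \<phi>])
    then show "\<phi> \<in> borel_measurable lebesgue" by (simp add: measurable_completion)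
  qed
  moreover have "indicator ?K x * u x * \<phi> x = indicator (cube R) x * (u x * \<phi> x)" for x
    using K(2) \<phi>0[of x] by (cases "x \<in> ?K") auto
  ultimately show ?thesis unfolding integrable_restrict_cube by (simp only:)
qed

lemma locally_integrable_lin:
  assumes "locally_integrable \<Omega> u" "locally_integrable \<Omega> v"
  shows "locally_integrable \<Omega> (\<lambda>x. a * u x + b * v x)"
  using assms unfolding locally_integrable_def
  by (auto intro!: set_integral_add set_integrable_mult_right)

lemma has_weak_deriv_lin:
  assumes u: "has_weak_deriv (cube R) \<beta> u w" and v: "has_weak_deriv (cube R) \<beta> v z"
  shows "has_weak_deriv (cube R) \<beta> (\<lambda>x. a * u x + b * v x) (\<lambda>x. a * w x + b * z x)"
  unfolding has_weak_deriv_def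
proof (intro conjI allI impI)
  have li: "locally_integrable (cube R) u" "locally_integrable (cube R) v" "locally_integrable (cube R) w" "locally_integrable (cube R) z"
    using u v by (auto simp: has_weak_deriv_def)
  then show "locally_integrable (cube R) (\<lambda>x. a * u x + b * v x)" "locally_integrable (cube R) (\<lambda>x. a * w x + b * z x)"
    by (auto intro: locally_integrable_lin)
  fix \<phi> assume \<phi>: "test_fun (cube R) \<phi>"
  let ?D = "mi_deriv \<beta> \<phi>" and ?s = "(- 1) ^ mi_order \<beta> :: real"
  have D: "test_fun (cube R) ?D" by (rule test_fun_mi_deriv[OF \<phi>])
  have split: "(\<integral>x. (a * p x + b * q x) * \<psi> x \<partial>leb_cube R) =
     a * (\<integral>x. p x * \<psi> x \<partial>leb_cube R) + b * (\<integral>x. q x * \<psi> x \<partial>leb_cube R)"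
    if "locally_integrable (cube R) p" "locally_integrable (cube R) q" "test_fun (cube R) \<psi>" for p q \<psi>
  proof -
    have "(\<integral>x. (a * p x + b * q x) * \<psi> x \<partial>leb_cube R) = (\<integral>x. a * (p x * \<psi> x) + b * (q x * \<psi> x) \<partial>leb_cube R)"
      by (simp add: algebra_simps)
    also have "\<dots> = a * (\<integral>x. p x * \<psi> x \<partial>leb_cube R) + b * (\<integral>x. q x * \<psi> x \<partial>leb_cube R)"
      using integrable_test_fun[OF that(1,3)] integrable_test_fun[OF that(2,3)]
      by (subst Bochner_Integration.integral_add) auto
    finally show ?thesis .
  qed
  have "(\<integral>x. u x * ?D x \<partial>leb_cube R) = ?s * (\<integral>x. w x * \<phi> x \<partial>leb_cube R)"
    "(\<integral>x. v x * ?D x \<partial>leb_cube R) = ?s * (\<integral>x. z x * \<phi> x \<partial>leb_cube R)"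
    using u v \<phi> by (auto simp: has_weak_deriv_def)
  then show "(\<integral>x. (a * u x + b * v x) * ?D x \<partial>leb_cube R) = ?s * (\<integral>x. (a * w x + b * z x) * \<phi> x \<partial>leb_cube R)"
    unfolding split[OF li(1,2) D] split[OF li(3,4) \<phi>] by (simp add: algebra_simps)
qed

text \<open>The difference of two weak derivatives of the same function integrates to zero against tensor products.\<close>
lemma has_weak_deriv_unique:
  assumes R: "R > 0" and u: "has_weak_deriv (cube R) \<beta> u w" and v: "has_weak_deriv (cube R) \<beta> u z"
  shows "AE x in leb_cube R. w x = z x"
proof -
  have *: "has_weak_deriv (cube R) \<beta> (\<lambda>x. 1 * u x + (-1) * u x) (\<lambda>x. 1 * w x + (-1) * z x)"
    by (rule has_weak_deriv_lin[OF u v])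
  have "AE x in leb_cube R. 1 * w x + (-1) * z x = 0"
  proof (rule AE_zero_if_tensor_integrals_zero[OF R])
    show "locally_integrable (cube R) (\<lambda>x. 1 * w x + (-1) * z x)" using * by (simp add: has_weak_deriv_def)
    fix P :: "3 \<Rightarrow> real \<Rightarrow> real" assume "\<And>i. test1 R (P i)"
    then have t: "test_fun (cube R) (tens P)" by (rule test_fun_tens)
    then have "(\<integral>x. (1 * u x + (-1) * u x) * mi_deriv \<beta> (tens P) x \<partial>leb_cube R) =
      (- 1) ^ mi_order \<beta> * (\<integral>x. (1 * w x + (-1) * z x) * tens P x \<partial>leb_cube R)"
      using * unfolding has_weak_deriv_def by blast
    then show "(\<integral>x. (1 * w x + (-1) * z x) * tens P x \<partial>leb_cube R) = 0" by simp
  qed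
  then show ?thesis by eventually_elim simp
qed

lemma square_integrable_lin:
  assumes u: "square_integrable \<Omega> u" and v: "square_integrable \<Omega> v"
  shows "square_integrable \<Omega> (\<lambda>x. a * u x + b * v x)"
proof -
  have [measurable]: "u \<in> borel_measurable (lebesgue_on \<Omega>)" "v \<in> borel_measurable (lebesgue_on \<Omega>)"
    using u v by (auto simp: square_integrable_def)
  have "integrable (lebesgue_on \<Omega>) (\<lambda>x. (a * u x + b * v x)\<^sup>2)"
  proof (rule Bochner_Integration.integrable_bound)
    show "integrable (lebesgue_on \<Omega>) (\<lambda>x. 2 * a\<^sup>2 * (u x)\<^sup>2 + 2 * b\<^sup>2 * (v x)\<^sup>2)"
      using u v by (auto simp: square_integrable_def)
    have "(a * u x + b * v x)\<^sup>2 \<le> 2 * a\<^sup>2 * (u x)\<^sup>2 + 2 * b\<^sup>2 * (v x)\<^sup>2" for x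
      using sum_squares_bound[of "a * u x" "b * v x"] by (simp add: power2_eq_square algebra_simps)
    then show "AE x in lebesgue_on \<Omega>. norm ((a * u x + b * v x)\<^sup>2) \<le> norm (2 * a\<^sup>2 * (u x)\<^sup>2 + 2 * b\<^sup>2 * (v x)\<^sup>2)"
      by (intro AE_I2) (auto intro: order_trans[OF _ abs_ge_self])
  qed measurable
  then show ?thesis by (simp add: square_integrable_def)
qed

lemma in_sobolev_lin:
  assumes "in_sobolev (cube R) s u" "in_sobolev (cube R) s v"
  shows "in_sobolev (cube R) s (\<lambda>x. a * u x + b * v x)"
  unfolding in_sobolev_def
proof (intro conjI allI impI)
  show "square_integrable (cube R) (\<lambda>x. a * u x + b * v x)"
    using assms by (intro square_integrable_lin) (auto simp: in_sobolev_def)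
  fix \<beta> assume "mi_order \<beta> \<le> s"
  then obtain w z where "has_weak_deriv (cube R) \<beta> u w" "square_integrable (cube R) w"
    "has_weak_deriv (cube R) \<beta> v z" "square_integrable (cube R) z"
    using assms unfolding in_sobolev_def by blast
  then show "\<exists>w. has_weak_deriv (cube R) \<beta> (\<lambda>x. a * u x + b * v x) w \<and> square_integrable (cube R) w"
    by (blast intro: has_weak_deriv_lin square_integrable_lin)
qed

lemma has_weak_deriv_weak_deriv:
  "in_sobolev \<Omega> s u \<Longrightarrow> mi_order \<beta> \<le> s \<Longrightarrow> has_weak_deriv \<Omega> \<beta> u (weak_deriv \<Omega> \<beta> u)"
proof -
  assume "in_sobolev \<Omega> s u" "mi_order \<beta> \<le> s"
  then have "\<exists>w. has_weak_deriv \<Omega> \<beta> u w" unfolding in_sobolev_def by blast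
  then show ?thesis unfolding weak_deriv_def by (rule someI_ex)
qed

lemma AE_measurable_lebesgue_on:
  assumes f: "f \<in> borel_measurable (lebesgue_on S)" and eq: "AE x in lebesgue_on S. f x = (g x :: real)" and S: "S \<in> sets lebesgue"
  shows "g \<in> borel_measurable (lebesgue_on S)"
proof -
  have "(\<lambda>x. indicator S x * f x) \<in> borel_measurable lebesgue"
    using f S by (subst (asm) borel_measurable_restrict_space_iff) auto
  moreover have "AE x in lebesgue. indicator S x * f x = indicator S x * g x"
    using eq S by (subst (asm) AE_restrict_space_iff) (auto elim!: eventually_mono simp: indicator_def)
  ultimately have "(\<lambda>x. indicator S x * g x) \<in> borel_measurable lebesgue"
    by (rule borel_measurable_AE)
  then show ?thesis using S by (subst borel_measurable_restrict_space_iff) auto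
qed

lemma square_integrable_AE:
  assumes f: "square_integrable (cube R) f" and eq: "AE x in leb_cube R. f x = g x"
  shows "square_integrable (cube R) g"
proof -
  have g: "g \<in> borel_measurable (leb_cube R)"
    using AE_measurable_lebesgue_on[OF _ eq] f by (auto simp: square_integrable_def)
  moreover have "integrable (leb_cube R) (\<lambda>x. (g x)\<^sup>2)"
    using f g eq unfolding square_integrable_def
    by (subst integrable_cong_AE[where g="\<lambda>x. (f x)\<^sup>2"]) (auto elim!: eventually_mono)
  ultimately show ?thesis by (simp add: square_integrable_def)
qed

text \<open>The chosen weak derivative need not be the square integrable one, but agrees with it almost everywhere.\<close>
lemma square_integrable_weak_deriv:
  assumes R: "R > 0" and u: "in_sobolev (cube R) s u" "mi_order \<beta> \<le> s"
  shows "square_integrable (cube R) (wderiv R \<beta> u)"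
proof -
  obtain w where w: "has_weak_deriv (cube R) \<beta> u w" "square_integrable (cube R) w"
    using u by (auto simp: in_sobolev_def)
  show ?thesis
    by (rule square_integrable_AE[OF w(2) has_weak_deriv_unique[OF R w(1) has_weak_deriv_weak_deriv[OF u]]])
qed

lemma weak_deriv_lin:
  assumes R: "R > 0" and "in_sobolev (cube R) s u" "in_sobolev (cube R) s v" "mi_order \<beta> \<le> s"
  shows "AE x in leb_cube R. wderiv R \<beta> (\<lambda>x. a * u x + b * v x) x =
     a * wderiv R \<beta> u x + b * wderiv R \<beta> v x"
  using assms by (intro has_weak_deriv_unique[OF R has_weak_deriv_weak_deriv[OF in_sobolev_lin] has_weak_deriv_lin])
    (auto intro: has_weak_deriv_weak_deriv)

lemma in_sobolev_mono: "in_sobolev \<Omega> s u \<Longrightarrow> t \<le> s \<Longrightarrow> in_sobolev \<Omega> t u"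
  by (auto simp: in_sobolev_def)

lemma finite_mi_order: "finite {\<beta>. mi_order \<beta> \<le> s}"
proof -
  let ?f = "\<lambda>\<beta>::nat^3. (\<beta> $ 1, \<beta> $ 2, \<beta> $ 3)"
  have "inj_on ?f {\<beta>. mi_order \<beta> \<le> s}" by (auto simp: inj_on_def Finite_Cartesian_Product.vec_eq_iff forall_3)
  moreover have "?f ` {\<beta>. mi_order \<beta> \<le> s} \<subseteq> {..s} \<times> {..s} \<times> {..s}"
    by (auto simp: mi_order_def sum_3)
  ultimately show ?thesis by (meson finite_SigmaI finite_atMost inj_on_finite)
qed

definition deriv_sq :: "real \<Rightarrow> nat^3 \<Rightarrow> (real^3 \<Rightarrow> real) \<Rightarrow> real" where
  "deriv_sq R \<beta> u = (\<integral>x. (wderiv R \<beta> u x)\<^sup>2 \<partial>leb_cube R)"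

lemma deriv_sq_nonneg: "0 \<le> deriv_sq R \<beta> u"
  unfolding deriv_sq_def by simp

lemma sobolev_norm_sq: "(sobolev_norm (cube R) s u)\<^sup>2 = (\<Sum>\<beta> | mi_order \<beta> \<le> s. deriv_sq R \<beta> u)"
  unfolding sobolev_norm_def deriv_sq_def[symmetric] by (simp add: sum_nonneg deriv_sq_nonneg)

lemma deriv_sq_le: "mi_order \<beta> \<le> s \<Longrightarrow> deriv_sq R \<beta> u \<le> (sobolev_norm (cube R) s u)\<^sup>2"
  unfolding sobolev_norm_sq by (rule member_le_sum) (auto simp: deriv_sq_nonneg finite_mi_order)

text \<open>For fixed \<open>\<epsilon>\<close> this form of the triangle inequality is additive in the squares, so it can be integrated
  and summed over components and multi-indices.\<close>
lemma young_square:
  fixes p q \<epsilon> :: real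
  assumes "\<epsilon> > 0" shows "(p + q)\<^sup>2 \<le> (1 + \<epsilon>) * p\<^sup>2 + (1 + 1/\<epsilon>) * q\<^sup>2"
proof -
  have "0 \<le> (\<epsilon> * p - q)\<^sup>2 / \<epsilon>" using assms by simp
  also have "(\<epsilon> * p - q)\<^sup>2 / \<epsilon> = \<epsilon> * p\<^sup>2 - 2 * p * q + q\<^sup>2 / \<epsilon>"
    using assms by (simp add: power2_eq_square field_simps)
  finally show ?thesis by (simp add: power2_eq_square algebra_simps)
qed

lemma deriv_sq_lin:
  assumes R: "R > 0" and u: "in_sobolev (cube R) s u" "mi_order \<beta> \<le> s" and v: "in_sobolev (cube R) s v" and \<epsilon>: "\<epsilon> > 0"
  shows "deriv_sq R \<beta> (\<lambda>x. a * u x + b * v x) \<le> (1 + \<epsilon>) * a\<^sup>2 * deriv_sq R \<beta> u + (1 + 1/\<epsilon>) * b\<^sup>2 * deriv_sq R \<beta> v"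
proof -
  let ?W = "wderiv R \<beta>"
  have i: "integrable (leb_cube R) (\<lambda>x. (?W u x)\<^sup>2)" "integrable (leb_cube R) (\<lambda>x. (?W v x)\<^sup>2)"
    using square_integrable_weak_deriv[OF R u] square_integrable_weak_deriv[OF R v u(2)] by (auto simp: square_integrable_def)
  have "deriv_sq R \<beta> (\<lambda>x. a * u x + b * v x) \<le> (\<integral>x. (1 + \<epsilon>) * a\<^sup>2 * (?W u x)\<^sup>2 + (1 + 1/\<epsilon>) * b\<^sup>2 * (?W v x)\<^sup>2 \<partial>leb_cube R)"
    unfolding deriv_sq_def
  proof (rule integral_mono_AE)
    show "integrable (leb_cube R) (\<lambda>x. (?W (\<lambda>x. a * u x + b * v x) x)\<^sup>2)"
      using square_integrable_weak_deriv[OF R in_sobolev_lin[OF u(1) v] u(2)] by (auto simp: square_integrable_def)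
    show "integrable (leb_cube R) (\<lambda>x. (1 + \<epsilon>) * a\<^sup>2 * (?W u x)\<^sup>2 + (1 + 1/\<epsilon>) * b\<^sup>2 * (?W v x)\<^sup>2)"
      using i by auto
    show "AE x in leb_cube R. (?W (\<lambda>x. a * u x + b * v x) x)\<^sup>2 \<le> (1 + \<epsilon>) * a\<^sup>2 * (?W u x)\<^sup>2 + (1 + 1/\<epsilon>) * b\<^sup>2 * (?W v x)\<^sup>2"
      using weak_deriv_lin[OF R u(1) v u(2), of a b]
      by eventually_elim (use young_square[OF \<epsilon>, of "a * _" "b * _"] in \<open>auto simp: power_mult_distrib mult.assoc\<close>)
  qed
  also have "\<dots> = (1 + \<epsilon>) * a\<^sup>2 * deriv_sq R \<beta> u + (1 + 1/\<epsilon>) * b\<^sup>2 * deriv_sq R \<beta> v"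
    unfolding deriv_sq_def using i by (subst Bochner_Integration.integral_add) auto
  finally show ?thesis .
qed

text \<open>Choosing \<open>\<epsilon>\<close> as the quotient of the two norms recovers the triangle inequality from its quadratic form.
  Both norms are enlarged slightly to keep the quotient meaningful when one of them vanishes.\<close>
lemma sqrt_triangle_of_young:
  fixes p q r a b :: real
  assumes "0 \<le> p" "0 \<le> q" and y: "\<And>\<epsilon>. \<epsilon> > 0 \<Longrightarrow> r \<le> (1 + \<epsilon>) * a\<^sup>2 * p + (1 + 1/\<epsilon>) * b\<^sup>2 * q"
  shows "sqrt r \<le> \<bar>a\<bar> * sqrt p + \<bar>b\<bar> * sqrt q"
proof -
  define P Q where "P = \<bar>a\<bar> * sqrt p" and "Q = \<bar>b\<bar> * sqrt q"
  have PQ: "0 \<le> P" "0 \<le> Q" "a\<^sup>2 * p = P\<^sup>2" "b\<^sup>2 * q = Q\<^sup>2" using assms(1,2) by (auto simp: P_def Q_def power_mult_distrib)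
  have "r \<le> (P + Q + e)\<^sup>2" if e: "e > 0" for e
  proof -
    \<comment> \<open>Halving \<open>e\<close> keeps both summands positive, so that their quotient is an admissible \<open>\<epsilon>\<close>.\<close>
    let ?P = "P + e/2" and ?Q = "Q + e/2"
    have pos: "?P > 0" "?Q > 0" using PQ e by auto
    have "r \<le> (1 + ?Q/?P) * P\<^sup>2 + (1 + 1/(?Q/?P)) * Q\<^sup>2"
      using y[of "?Q/?P"] pos PQ(3,4) by (simp add: mult.assoc)
    also have "\<dots> \<le> (1 + ?Q/?P) * ?P\<^sup>2 + (1 + 1/(?Q/?P)) * ?Q\<^sup>2"
      using pos PQ e by (intro add_mono mult_left_mono power_mono) auto
    also have "\<dots> = (?P + ?Q)\<^sup>2"
    proof -
      have "(1 + Y/X) * X\<^sup>2 + (1 + 1/(Y/X)) * Y\<^sup>2 = (X + Y)\<^sup>2" if "X > 0" "Y > 0" for X Y :: real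
        using that by (simp add: power2_eq_square field_simps)
      from this[OF pos] show ?thesis .
    qed
    finally show ?thesis by (simp add: algebra_simps)
  qed
  then have "sqrt r \<le> P + Q + e" if "e > 0" for e
    using that PQ real_sqrt_le_mono[of r "(P + Q + e)\<^sup>2"] by auto
  then show ?thesis unfolding P_def[symmetric] Q_def[symmetric] by (rule field_le_epsilon)
qed

text \<open>Sums, differences and multiples are all instances, so that each fact about linearity is needed once.
  The coefficients are real because complex vector functions are treated as real ones.\<close>
definition lin_vec :: "real \<Rightarrow> vecfun \<Rightarrow> real \<Rightarrow> vecfun \<Rightarrow> vecfun" where
  "lin_vec a V b W = (\<lambda>n x. of_real a * V n x + of_real b * W n x)"

lemma lin_vec_sobolev:
  assumes "V \<in> sobolev_vec (cube R) s N" "W \<in> sobolev_vec (cube R) s N"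
  shows "lin_vec a V b W \<in> sobolev_vec (cube R) s N"
  using assms by (auto simp: sobolev_vec_def lin_vec_def intro: in_sobolev_lin)

lemma sobolev_vec_norm_sq:
  "(sobolev_vec_norm (cube R) s N V)\<^sup>2 = (\<Sum>n<N. (sobolev_norm (cube R) s (\<lambda>x. Re (V n x)))\<^sup>2 + (sobolev_norm (cube R) s (\<lambda>x. Im (V n x)))\<^sup>2)"
  unfolding sobolev_vec_norm_def by (simp add: sum_nonneg)

lemma sobolev_vec_norm_nonneg: "0 \<le> sobolev_vec_norm \<Omega> s N V"
  unfolding sobolev_vec_norm_def by (simp add: sum_nonneg)

lemma sobolev_norm_sq_lin:
  assumes R: "R > 0" and u: "in_sobolev (cube R) s u" and v: "in_sobolev (cube R) s v" and \<epsilon>: "\<epsilon> > 0"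
  shows "(sobolev_norm (cube R) s (\<lambda>x. a * u x + b * v x))\<^sup>2 \<le> (1 + \<epsilon>) * a\<^sup>2 * (sobolev_norm (cube R) s u)\<^sup>2 + (1 + 1/\<epsilon>) * b\<^sup>2 * (sobolev_norm (cube R) s v)\<^sup>2"
  unfolding sobolev_norm_sq sum_distrib_left sum.distrib[symmetric]
  by (intro sum_mono deriv_sq_lin[OF R u _ v \<epsilon>]) auto

lemma sobolev_vec_norm_lin:
  assumes R: "R > 0" and V: "V \<in> sobolev_vec (cube R) s N" and W: "W \<in> sobolev_vec (cube R) s N"
  shows "sobolev_vec_norm (cube R) s N (lin_vec a V b W) \<le> \<bar>a\<bar> * sobolev_vec_norm (cube R) s N V + \<bar>b\<bar> * sobolev_vec_norm (cube R) s N W"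
proof -
  have "sqrt ((sobolev_vec_norm (cube R) s N (lin_vec a V b W))\<^sup>2) \<le> \<bar>a\<bar> * sqrt ((sobolev_vec_norm (cube R) s N V)\<^sup>2) + \<bar>b\<bar> * sqrt ((sobolev_vec_norm (cube R) s N W)\<^sup>2)"
  proof (rule sqrt_triangle_of_young)
    fix \<epsilon> :: real assume \<epsilon>: "\<epsilon> > 0"
    have R1: "(sobolev_norm (cube R) s (\<lambda>x. Re (lin_vec a V b W n x)))\<^sup>2 \<le> (1 + \<epsilon>) * a\<^sup>2 * (sobolev_norm (cube R) s (\<lambda>x. Re (V n x)))\<^sup>2 + (1 + 1/\<epsilon>) * b\<^sup>2 * (sobolev_norm (cube R) s (\<lambda>x. Re (W n x)))\<^sup>2" if "n < N" for n
      using sobolev_norm_sq_lin[OF R _ _ \<epsilon>, of s "\<lambda>x. Re (V n x)" "\<lambda>x. Re (W n x)" a b] V W that by (simp add: lin_vec_def sobolev_vec_def)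
    have R2: "(sobolev_norm (cube R) s (\<lambda>x. Im (lin_vec a V b W n x)))\<^sup>2 \<le> (1 + \<epsilon>) * a\<^sup>2 * (sobolev_norm (cube R) s (\<lambda>x. Im (V n x)))\<^sup>2 + (1 + 1/\<epsilon>) * b\<^sup>2 * (sobolev_norm (cube R) s (\<lambda>x. Im (W n x)))\<^sup>2" if "n < N" for n
      using sobolev_norm_sq_lin[OF R _ _ \<epsilon>, of s "\<lambda>x. Im (V n x)" "\<lambda>x. Im (W n x)" a b] V W that by (simp add: lin_vec_def sobolev_vec_def)
    show "(sobolev_vec_norm (cube R) s N (lin_vec a V b W))\<^sup>2 \<le> (1 + \<epsilon>) * a\<^sup>2 * (sobolev_vec_norm (cube R) s N V)\<^sup>2 + (1 + 1/\<epsilon>) * b\<^sup>2 * (sobolev_vec_norm (cube R) s N W)\<^sup>2"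
      unfolding sobolev_vec_norm_sq sum_distrib_left sum.distrib[symmetric]
      by (rule sum_mono) (use R1 R2 in \<open>fastforce simp: distrib_left\<close>)
  qed auto
  then show ?thesis by (simp add: sobolev_vec_norm_nonneg)
qed

lemma sobolev_vec_norm_mono:
  assumes "s \<le> t" shows "sobolev_vec_norm (cube R) s N V \<le> sobolev_vec_norm (cube R) t N V"
proof -
  have "(sobolev_norm (cube R) s u)\<^sup>2 \<le> (sobolev_norm (cube R) t u)\<^sup>2" for u
    unfolding sobolev_norm_sq using assms by (intro sum_mono2 finite_mi_order) (auto simp: deriv_sq_nonneg)
  then show ?thesis unfolding sobolev_vec_norm_def by (intro real_sqrt_le_mono sum_mono add_mono)
qed

lemma weak_cderiv_lin:
  assumes R: "R > 0" and V: "V \<in> sobolev_vec (cube R) s N" and W: "W \<in> sobolev_vec (cube R) s N" and "mi_order \<beta> \<le> s" "n < N"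
  shows "AE x in leb_cube R. wcderiv R \<beta> (lin_vec a V b W n) x =
     of_real a * wcderiv R \<beta> (V n) x + of_real b * wcderiv R \<beta> (W n) x"
proof -
  have s: "in_sobolev (cube R) s (\<lambda>x. Re (V n x))" "in_sobolev (cube R) s (\<lambda>x. Re (W n x))"
     "in_sobolev (cube R) s (\<lambda>x. Im (V n x))" "in_sobolev (cube R) s (\<lambda>x. Im (W n x))"
    using V W \<open>n < N\<close> by (auto simp: sobolev_vec_def)
  show ?thesis
    using weak_deriv_lin[OF R s(1,2) \<open>mi_order \<beta> \<le> s\<close>, of a b] weak_deriv_lin[OF R s(3,4) \<open>mi_order \<beta> \<le> s\<close>, of a b]
    by eventually_elim (simp add: weak_cderiv_def lin_vec_def complex_eq_iff)
qed

section \<open>Products of first derivatives\<close>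

text \<open>Fubini's theorem on the product space asks for Borel functions, while Sobolev functions are only
  Lebesgue measurable.\<close>
lemma square_integrable_borel_rep:
  assumes R: "R > 0" and h: "square_integrable (cube R) h"
  obtains h0 where "integrable lborel h0" "\<And>x. x \<notin> cube R \<Longrightarrow> h0 x = 0" "AE x in leb_cube R. h x = h0 x"
    "(\<integral>\<^sup>+x. ennreal ((h0 x)\<^sup>2) \<partial>lborel) = ennreal (\<integral>x. (h x)\<^sup>2 \<partial>leb_cube R)"
proof -
  have hm: "h \<in> borel_measurable (leb_cube R)" and hi: "integrable (leb_cube R) (\<lambda>x. (h x)\<^sup>2)"
    using h by (auto simp: square_integrable_def)
  have "(\<lambda>x. indicator (cube R) x * h x) \<in> borel_measurable lebesgue"
    using hm by (subst (asm) borel_measurable_restrict_space_iff) auto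
  then obtain g where g: "g \<in> borel_measurable lborel" "AE x in lborel. indicator (cube R) x * h x = g x"
    using completion_ex_borel_measurable_real by blast
  have [measurable]: "g \<in> borel_measurable borel" using g(1) by simp
  define h0 where "h0 x = indicator (cube R) x * g x" for x
  have [measurable]: "h0 \<in> borel_measurable borel" unfolding h0_def by measurable
  have m0: "h0 \<in> borel_measurable lebesgue" by (intro measurable_completion) simp
  have out: "h0 x = 0" if "x \<notin> cube R" for x using that by (simp add: h0_def)
  have "AE x in lebesgue. x \<in> cube R \<longrightarrow> h x = h0 x"
    using AE_completion[OF g(2)] by eventually_elim (auto simp: h0_def indicator_def)
  then have ae: "AE x in leb_cube R. h x = h0 x" by (subst AE_restrict_space_iff) auto
  have m0': "h0 \<in> borel_measurable (leb_cube R)" by (rule measurable_restrict_space1[OF m0])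
  have "integrable (leb_cube R) (\<lambda>x. (h0 x)\<^sup>2)"
    using hi hm m0' ae by (subst integrable_cong_AE[where g="\<lambda>x. (h x)\<^sup>2"]) (auto elim!: eventually_mono)
  then have "integrable lebesgue (\<lambda>x. indicator (cube R) x * (h0 x)\<^sup>2)" by (simp add: integrable_restrict_cube)
  moreover have "indicator (cube R) x * (h0 x)\<^sup>2 = (h0 x)\<^sup>2" for x by (auto simp: h0_def indicator_def)
  ultimately have "integrable lebesgue (\<lambda>x. (h0 x)\<^sup>2)" by (simp only:)
  then have i2: "integrable lborel (\<lambda>x. (h0 x)\<^sup>2)" by (subst (asm) integrable_completion) auto
  have "(\<integral>\<^sup>+x. ennreal ((h0 x)\<^sup>2) \<partial>lborel) = ennreal (\<integral>x. (h0 x)\<^sup>2 \<partial>lborel)"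
    by (rule nn_integral_eq_integral[OF i2]) simp
  also have "(\<integral>x. (h0 x)\<^sup>2 \<partial>lborel) = (\<integral>x. (h0 x)\<^sup>2 \<partial>leb_cube R)"
    by (rule integral_cube_lborel[symmetric]) (auto simp: out)
  also have "\<dots> = (\<integral>x. (h x)\<^sup>2 \<partial>leb_cube R)"
    using hm m0' ae by (intro integral_cong_AE) (auto elim!: eventually_mono)
  finally have e: "(\<integral>\<^sup>+x. ennreal ((h0 x)\<^sup>2) \<partial>lborel) = ennreal (\<integral>x. (h x)\<^sup>2 \<partial>leb_cube R)" .
  have "integrable lborel h0"
  proof (rule Bochner_Integration.integrable_bound)
    have "integrable lborel (indicator (cube R) :: _ \<Rightarrow> real)"
      using R by (intro integrable_real_indicator) (auto simp: emeasure_cube)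
    then show "integrable lborel (\<lambda>x. indicator (cube R) x + (h0 x)\<^sup>2)" using i2 by (rule Bochner_Integration.integrable_add)
    have "\<bar>h0 x\<bar> \<le> indicator (cube R) x + (h0 x)\<^sup>2" for x
    proof (cases "x \<in> cube R")
      case True
      have "0 \<le> (\<bar>h0 x\<bar> - 1/2)\<^sup>2" by simp
      then show ?thesis using True by (simp add: power2_eq_square algebra_simps)
    qed (simp add: out)
    then show "AE x in lborel. norm (h0 x) \<le> norm (indicator (cube R) x + (h0 x)\<^sup>2)"
      by (intro AE_I2) (auto intro: order_trans[OF _ abs_ge_self])
  qed simp
  then show thesis using that out ae e by blast
qed

lemma mi_order_add: "mi_order (\<alpha> + \<beta>) = mi_order \<alpha> + mi_order \<beta>"
  by (simp add: mi_order_def sum.distrib)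

lemma mi_order_axis [simp]: "mi_order (axis j n) = n"
  by (simp add: mi_order_def axis_def if_distrib[of "\<lambda>f. f _"])

lemma integral_rep_tens:
  assumes ae: "AE x in leb_cube R. w x = w0 x" and w0: "integrable lborel w0" and w: "w \<in> borel_measurable (leb_cube R)"
    and P: "\<And>i. test1 R (P i)"
  shows "(\<integral>x. w x * tens P x \<partial>leb_cube R) = (\<integral>x. w0 x * tens P x \<partial>lborel)"
proof -
  have [measurable]: "tens P \<in> borel_measurable borel" by (rule tens_test_borel[OF P])
  have [measurable]: "w0 \<in> borel_measurable borel" using w0 by auto
  have b: "f \<in> borel_measurable (leb_cube R)" if "f \<in> borel_measurable borel" for f :: "real^3 \<Rightarrow> real"
    using that by (intro measurable_restrict_space1 measurable_completion) simp
  have "(\<integral>x. w x * tens P x \<partial>leb_cube R) = (\<integral>x. w0 x * tens P x \<partial>leb_cube R)"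
    using ae w b[of w0] b[of "tens P"] by (intro integral_cong_AE borel_measurable_times) (auto elim!: eventually_mono)
  also have "\<dots> = (\<integral>x. w0 x * tens P x \<partial>lborel)"
    by (rule integral_cube_lborel) (auto simp: tens_outside_cube[OF P])
  finally show ?thesis .
qed

text \<open>The derivative of a tensor product in direction \<open>j\<close> is again a tensor product and can be used to test the
  weak derivative of order \<open>\<beta>\<close>.\<close>
lemma weak_partial_of_weak_deriv:
  assumes "has_weak_deriv (cube R) \<beta> u w" "has_weak_deriv (cube R) (\<beta> + axis j 1) u z"
    and "AE x in leb_cube R. w x = w0 x" "integrable lborel w0" "w \<in> borel_measurable (leb_cube R)"
    and "AE x in leb_cube R. z x = z0 x" "integrable lborel z0" "z \<in> borel_measurable (leb_cube R)"
  shows "weak_partial R j w0 z0"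
  unfolding weak_partial_def
proof (intro allI impI)
  fix P :: "3 \<Rightarrow> real \<Rightarrow> real" assume "\<forall>i. test1 R (P i)"
  then have P: "test1 R (P i)" for i by blast
  let ?Q = "P(j := deriv (P j))"
  have Q: "test1 R (?Q i)" for i using P test1_deriv by simp
  have sm: "smooth1 (P i)" "smooth1 (?Q i)" for i using P[of i] Q[of i] by (auto simp: test1_def simp del: fun_upd_apply)
  have w1: "(\<integral>x. p x * mi_deriv \<gamma> \<phi> x \<partial>leb_cube R) = (-1) ^ mi_order \<gamma> * (\<integral>x. q x * \<phi> x \<partial>leb_cube R)"
    if "has_weak_deriv (cube R) \<gamma> p q" "test_fun (cube R) \<phi>" for \<gamma> p q \<phi>
    using that by (simp add: has_weak_deriv_def)
  have "mi_deriv \<beta> (tens ?Q) = mi_deriv (\<beta> + axis j 1) (tens P)"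
    unfolding mi_deriv_tens[OF sm(1)] mi_deriv_tens[OF sm(2)]
    by (intro arg_cong[of _ _ tens]) (auto simp: axis_def funpow_Suc_right simp del: funpow.simps)
  moreover have "(\<integral>x. u x * mi_deriv \<beta> (tens ?Q) x \<partial>leb_cube R) = (-1) ^ mi_order \<beta> * (\<integral>x. w x * tens ?Q x \<partial>leb_cube R)"
    by (rule w1[OF assms(1) test_fun_tens[OF Q]])
  moreover have "(\<integral>x. u x * mi_deriv (\<beta> + axis j 1) (tens P) x \<partial>leb_cube R) = (-1) ^ mi_order (\<beta> + axis j 1) * (\<integral>x. z x * tens P x \<partial>leb_cube R)"
    by (rule w1[OF assms(2) test_fun_tens[OF P]])
  ultimately have "(-1) ^ mi_order \<beta> * (\<integral>x. w x * tens ?Q x \<partial>leb_cube R) = (-1) ^ mi_order \<beta> * (- (\<integral>x. z x * tens P x \<partial>leb_cube R))"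
    by (simp add: mi_order_add)
  then have "(\<integral>x. w x * tens ?Q x \<partial>leb_cube R) = - (\<integral>x. z x * tens P x \<partial>leb_cube R)"
    by (subst (asm) mult_left_cancel) auto
  then show "(\<integral>x. w0 x * tens ?Q x \<partial>lborel) = - (\<integral>x. z0 x * tens P x \<partial>lborel)"
    unfolding integral_rep_tens[OF assms(3-5) Q] integral_rep_tens[OF assms(6-8) P] .
qed

text \<open>The mixed derivative of \<open>f = \<partial>\<^sub>i u\<close> that \<open>mixed_product_bound\<close> needs has order three in \<open>u\<close>, which is why
  the \<open>H\<^sup>3\<close> norm appears.\<close>
lemma gradient_product_bound:
  assumes R: "R > 0"
  obtains C where "C > 0" "\<And>u v i j. in_sobolev (cube R) 3 u \<Longrightarrow> in_sobolev (cube R) 3 v \<Longrightarrow>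
      integrable (leb_cube R) (\<lambda>x. (wderiv R (axis i 1) u x)\<^sup>2 * (wderiv R (axis j 1) v x)\<^sup>2) \<and>
      (\<integral>x. (wderiv R (axis i 1) u x)\<^sup>2 * (wderiv R (axis j 1) v x)\<^sup>2 \<partial>leb_cube R)
        \<le> C * (sobolev_norm (cube R) 3 u)\<^sup>2 * (sobolev_norm (cube R) 3 v)\<^sup>2"
proof (rule mixed_product_bound[OF R])
  fix C0 :: real assume C0: "C0 > 0" and bound: "\<And>f f1 f2 f12 g g3.
      (\<And>h. h \<in> {f, f1, f2, f12, g, g3} \<Longrightarrow> integrable lborel h \<and> (\<forall>x. x \<notin> cube R \<longrightarrow> h x = 0)) \<Longrightarrow>
      weak_partial R 1 f f1 \<Longrightarrow> weak_partial R 2 f f2 \<Longrightarrow> weak_partial R 2 f1 f12 \<Longrightarrow> weak_partial R 3 g g3 \<Longrightarrow>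
      (\<integral>\<^sup>+x. ennreal ((f x)\<^sup>2 * (g x)\<^sup>2) \<partial>lborel) \<le> ennreal C0 *
        (\<integral>\<^sup>+x. ennreal ((f x)\<^sup>2 + (f1 x)\<^sup>2 + (f2 x)\<^sup>2 + (f12 x)\<^sup>2) \<partial>lborel) * (\<integral>\<^sup>+x. ennreal ((g x)\<^sup>2 + (g3 x)\<^sup>2) \<partial>lborel)"
  show thesis
  proof (rule that[of "8 * C0"])
    show "8 * C0 > 0" using C0 by simp
    fix u v i j assume u: "in_sobolev (cube R) 3 u" and v: "in_sobolev (cube R) 3 v"
    let ?M = "leb_cube R"
    define is_rep where "is_rep q \<beta> h0 \<longleftrightarrow> integrable lborel h0 \<and> (\<forall>x. x \<notin> cube R \<longrightarrow> h0 x = 0) \<and>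
        (AE x in ?M. wderiv R \<beta> q x = h0 x) \<and> (\<integral>\<^sup>+x. ennreal ((h0 x)\<^sup>2) \<partial>lborel) = ennreal (deriv_sq R \<beta> q)" for q \<beta> h0
    have is_rep: "\<exists>h0. is_rep q \<beta> h0" if "in_sobolev (cube R) 3 q" "mi_order \<beta> \<le> 3" for q \<beta>
    proof (rule square_integrable_borel_rep[OF R square_integrable_weak_deriv[OF R that]])
      fix h0 assume "integrable lborel h0" "\<And>x. x \<notin> cube R \<Longrightarrow> h0 x = 0" "AE x in ?M. wderiv R \<beta> q x = h0 x"
        "(\<integral>\<^sup>+x. ennreal ((h0 x)\<^sup>2) \<partial>lborel) = ennreal (\<integral>x. (wderiv R \<beta> q x)\<^sup>2 \<partial>?M)"
      then show ?thesis unfolding is_rep_def deriv_sq_def by (intro exI[of _ h0]) simp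
    qed
    define rep where "rep q \<beta> = (SOME h0. is_rep q \<beta> h0)" for q \<beta>
    have rep: "integrable lborel (rep q \<beta>)" "\<forall>x. x \<notin> cube R \<longrightarrow> rep q \<beta> x = 0" "AE x in ?M. wderiv R \<beta> q x = rep q \<beta> x"
        "(\<integral>\<^sup>+x. ennreal ((rep q \<beta> x)\<^sup>2) \<partial>lborel) = ennreal (deriv_sq R \<beta> q)"
      if "in_sobolev (cube R) 3 q" "mi_order \<beta> \<le> 3" for q \<beta>
    proof -
      have "is_rep q \<beta> (rep q \<beta>)" unfolding rep_def by (rule someI_ex[OF is_rep[OF that]])
      then show "integrable lborel (rep q \<beta>)" "\<forall>x. x \<notin> cube R \<longrightarrow> rep q \<beta> x = 0" "AE x in ?M. wderiv R \<beta> q x = rep q \<beta> x"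
        "(\<integral>\<^sup>+x. ennreal ((rep q \<beta> x)\<^sup>2) \<partial>lborel) = ennreal (deriv_sq R \<beta> q)"
        unfolding is_rep_def by blast+
    qed
    have meas: "wderiv R \<beta> q \<in> borel_measurable ?M" if "in_sobolev (cube R) 3 q" "mi_order \<beta> \<le> 3" for q \<beta>
      using square_integrable_weak_deriv[OF R that] by (simp add: square_integrable_def)
    let ?b = "axis i 1 :: nat^3" and ?c = "axis j 1 :: nat^3"
    have o: "mi_order ?b \<le> 3" "mi_order (?b + axis 1 1) \<le> 3" "mi_order (?b + axis 2 1) \<le> 3" "mi_order (?b + axis 1 1 + axis 2 1) \<le> 3"
       "mi_order ?c \<le> 3" "mi_order (?c + axis 3 1) \<le> 3" by (auto simp: mi_order_add)
    define f f1 f2 f12 g g3 where defs: "f = rep u ?b" "f1 = rep u (?b + axis 1 1)" "f2 = rep u (?b + axis 2 1)"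
      "f12 = rep u (?b + axis 1 1 + axis 2 1)" "g = rep v ?c" "g3 = rep v (?c + axis 3 1)"
    note f = rep[OF u o(1), folded defs] and f1 = rep[OF u o(2), folded defs] and f2 = rep[OF u o(3), folded defs]
      and f12 = rep[OF u o(4), folded defs] and g = rep[OF v o(5), folded defs] and g3 = rep[OF v o(6), folded defs]
    have [measurable]: "f \<in> borel_measurable borel" "f1 \<in> borel_measurable borel" "f2 \<in> borel_measurable borel" "f12 \<in> borel_measurable borel" 
      "g \<in> borel_measurable borel" "g3 \<in> borel_measurable borel" using f f1 f2 f12 g g3 by auto
    note wd = has_weak_deriv_weak_deriv
    have w: "weak_partial R 1 f f1" "weak_partial R 2 f f2" "weak_partial R 2 f1 f12" "weak_partial R 3 g g3"
      using weak_partial_of_weak_deriv[OF wd[OF u o(1)] wd[OF u o(2)] f(3,1) meas[OF u o(1)] f1(3,1) meas[OF u o(2)]]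
        weak_partial_of_weak_deriv[OF wd[OF u o(1)] wd[OF u o(3)] f(3,1) meas[OF u o(1)] f2(3,1) meas[OF u o(3)]]
        weak_partial_of_weak_deriv[OF wd[OF u o(2)] wd[OF u o(4)] f1(3,1) meas[OF u o(2)] f12(3,1) meas[OF u o(4)]]
        weak_partial_of_weak_deriv[OF wd[OF v o(5)] wd[OF v o(6)] g(3,1) meas[OF v o(5)] g3(3,1) meas[OF v o(6)]] .
    define U V where "U = (sobolev_norm (cube R) 3 u)\<^sup>2" and "V = (sobolev_norm (cube R) 3 v)\<^sup>2"
    have [simp]: "0 \<le> U" "0 \<le> V" by (auto simp: U_def V_def)
    have "(\<integral>\<^sup>+x. ennreal ((f x)\<^sup>2 * (g x)\<^sup>2) \<partial>lborel) \<le> ennreal C0 *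
        (\<integral>\<^sup>+x. ennreal ((f x)\<^sup>2 + (f1 x)\<^sup>2 + (f2 x)\<^sup>2 + (f12 x)\<^sup>2) \<partial>lborel) * (\<integral>\<^sup>+x. ennreal ((g x)\<^sup>2 + (g3 x)\<^sup>2) \<partial>lborel)"
      by (rule bound[OF _ w]) (use f f1 f2 f12 g g3 in auto)
    also have "(\<integral>\<^sup>+x. ennreal ((f x)\<^sup>2 + (f1 x)\<^sup>2 + (f2 x)\<^sup>2 + (f12 x)\<^sup>2) \<partial>lborel)
       = ennreal (deriv_sq R ?b u + deriv_sq R (?b + axis 1 1) u + deriv_sq R (?b + axis 2 1) u + deriv_sq R (?b + axis 1 1 + axis 2 1) u)"
      using f(4) f1(4) f2(4) f12(4) by (simp add: nn_integral_add deriv_sq_nonneg)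
    also have "\<dots> \<le> ennreal (4 * U)"
      using deriv_sq_le[OF o(1), of R u] deriv_sq_le[OF o(2), of R u] deriv_sq_le[OF o(3), of R u] deriv_sq_le[OF o(4), of R u]
      unfolding U_def by (intro ennreal_leI) linarith
    also have "(\<integral>\<^sup>+x. ennreal ((g x)\<^sup>2 + (g3 x)\<^sup>2) \<partial>lborel) = ennreal (deriv_sq R ?c v + deriv_sq R (?c + axis 3 1) v)"
      using g(4) g3(4) by (simp add: nn_integral_add deriv_sq_nonneg)
    also have "\<dots> \<le> ennreal (2 * V)"
      using deriv_sq_le[OF o(5), of R v] deriv_sq_le[OF o(6), of R v] unfolding V_def by (intro ennreal_leI) linarith
    finally have "(\<integral>\<^sup>+x. ennreal ((f x)\<^sup>2 * (g x)\<^sup>2) \<partial>lborel) \<le> ennreal C0 * ennreal (4 * U) * ennreal (2 * V)"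
      by (simp add: mult_left_mono mult_right_mono)
    also have "\<dots> = ennreal (8 * C0 * U * V)"
    proof -
      have "ennreal C0 * ennreal (4 * U) * ennreal (2 * V) = ennreal (C0 * (4 * U) * (2 * V))"
        using C0 by (simp only: ennreal_mult[symmetric] less_imp_le mult_nonneg_nonneg \<open>0 \<le> U\<close> \<open>0 \<le> V\<close> zero_le_numeral)
      then show ?thesis by (simp add: mult_ac)
    qed
    finally have le: "(\<integral>\<^sup>+x. ennreal ((f x)\<^sup>2 * (g x)\<^sup>2) \<partial>lborel) \<le> ennreal (8 * C0 * U * V)" .
    have ifg: "integrable lborel (\<lambda>x. (f x)\<^sup>2 * (g x)\<^sup>2)"
      using le by (intro integrableI_bounded) (auto simp: top.not_eq_extremum order_le_less_trans)
    have "ennreal (\<integral>x. (f x)\<^sup>2 * (g x)\<^sup>2 \<partial>lborel) = (\<integral>\<^sup>+x. ennreal ((f x)\<^sup>2 * (g x)\<^sup>2) \<partial>lborel)"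
      by (rule nn_integral_eq_integral[symmetric, OF ifg]) simp
    with le have "ennreal (\<integral>x. (f x)\<^sup>2 * (g x)\<^sup>2 \<partial>lborel) \<le> ennreal (8 * C0 * U * V)" by (simp only:)
    moreover have "0 \<le> 8 * C0 * U * V" using C0 by simp
    ultimately have le': "(\<integral>x. (f x)\<^sup>2 * (g x)\<^sup>2 \<partial>lborel) \<le> 8 * C0 * U * V"
      by (simp only: ennreal_le_iff)
    have out: "(f x)\<^sup>2 * (g x)\<^sup>2 = 0" if "x \<notin> cube R" for x using f(2) that by simp
    have b: "h \<in> borel_measurable ?M" if "h \<in> borel_measurable borel" for h :: "real^3 \<Rightarrow> real"
      using that by (intro measurable_restrict_space1 measurable_completion) simp
    have m1: "(\<lambda>x. (wderiv R ?b u x)\<^sup>2 * (wderiv R ?c v x)\<^sup>2) \<in> borel_measurable ?M"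
      using meas[OF u o(1)] meas[OF v o(5)] by measurable
    have m2: "(\<lambda>x. (f x)\<^sup>2 * (g x)\<^sup>2) \<in> borel_measurable ?M" by (rule b) measurable
    have ae: "AE x in ?M. (wderiv R ?b u x)\<^sup>2 * (wderiv R ?c v x)\<^sup>2 = (f x)\<^sup>2 * (g x)\<^sup>2"
      using f(3) g(3) by eventually_elim simp
    have "integrable lebesgue (\<lambda>x. (f x)\<^sup>2 * (g x)\<^sup>2)" using ifg by (subst integrable_completion) auto
    moreover have "indicator (cube R) x * ((f x)\<^sup>2 * (g x)\<^sup>2) = (f x)\<^sup>2 * (g x)\<^sup>2" for x
      using out[of x] by (cases "x \<in> cube R") auto
    ultimately have ifgM: "integrable ?M (\<lambda>x. (f x)\<^sup>2 * (g x)\<^sup>2)" unfolding integrable_restrict_cube by (simp only:)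
    have "(\<integral>x. (wderiv R ?b u x)\<^sup>2 * (wderiv R ?c v x)\<^sup>2 \<partial>?M) = (\<integral>x. (f x)\<^sup>2 * (g x)\<^sup>2 \<partial>?M)"
      by (rule integral_cong_AE[OF m1 m2 ae])
    also have "\<dots> = (\<integral>x. (f x)\<^sup>2 * (g x)\<^sup>2 \<partial>lborel)" by (rule integral_cube_lborel) (auto simp: f(2))
    finally show "integrable ?M (\<lambda>x. (wderiv R ?b u x)\<^sup>2 * (wderiv R ?c v x)\<^sup>2) \<and>
      (\<integral>x. (wderiv R ?b u x)\<^sup>2 * (wderiv R ?c v x)\<^sup>2 \<partial>?M)
        \<le> 8 * C0 * (sobolev_norm (cube R) 3 u)\<^sup>2 * (sobolev_norm (cube R) 3 v)\<^sup>2"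
      using ifgM le' integrable_cong_AE[OF m1 m2 ae] by (simp add: U_def V_def)
  qed
qed

section \<open>The operator as a quadratic polynomial in the gradient\<close>

lemma smooth1_Psi: "smooth1 (Psi a n)"
proof (induction n rule: less_induct)
  case (less n)
  define u where "u t = t ^ n * exp t - (\<Sum>j<n. ip a (\<lambda>t. t ^ n * exp t) (Psi a j) * Psi a j t)" for t
  have "smooth1 (\<lambda>t. t ^ n * exp t + (-1) * (\<Sum>j<n. ip a (\<lambda>t. t ^ n * exp t) (Psi a j) * Psi a j t))"
    by (intro smooth1_add smooth1_mult smooth1_power smooth1_exp smooth1_const smooth1_sum less) auto
  then have "smooth1 u" unfolding u_def[abs_def] by simp
  then have "smooth1 (\<lambda>t. inverse (sqrt (ip a u u)) * u t)" by (intro smooth1_mult smooth1_const)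
  moreover have "Psi a n = (\<lambda>t. inverse (sqrt (ip a u u)) * u t)"
    unfolding Psi.simps[of a n] u_def[abs_def] Let_def by (simp add: field_simps)
  ultimately show ?case by simp
qed

definition closed_cube :: "real \<Rightarrow> (real^3) set" where
  "closed_cube R = cbox (- (\<chi> i. R)) (\<chi> i. R)"

lemma closed_cube_iff: "x \<in> closed_cube R \<longleftrightarrow> (\<forall>i. \<bar>x $ i\<bar> \<le> R)"
  unfolding closed_cube_def mem_box_cart by (auto simp: abs_le_iff minus_le_iff)

lemma cube_subset_closed_cube: "cube R \<subseteq> closed_cube R"
  by (meson cube_iff closed_cube_iff less_imp_le subsetI)

lemma compact_closed_cube: "compact (closed_cube R)"
  by (simp add: closed_cube_def)

definition rel_pos :: "real \<Rightarrow> real^3 \<Rightarrow> real \<Rightarrow> real^3" where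
  "rel_pos d x \<alpha> = x - source_pos d \<alpha>"

lemma rel_pos_eq: "rel_pos d x \<alpha> = rel_pos d x 0 - \<alpha> *\<^sub>R axis 1 1"
  by (simp add: rel_pos_def source_pos_def Finite_Cartesian_Product.vec_eq_iff forall_3 vector_3 axis_def)

text \<open>The sources lie strictly below the closed cube.\<close>
lemma rel_pos_nonzero:
  assumes "d > R" "x \<in> closed_cube R" shows "rel_pos d x \<alpha> \<noteq> 0"
proof -
  have "\<bar>x $ 3\<bar> \<le> R" using assms(2) by (simp add: closed_cube_iff)
  then have "rel_pos d x \<alpha> $ 3 > 0" using assms(1) by (simp add: rel_pos_def source_pos_def vector_3)
  then show ?thesis by auto
qed

lemma continuous_rel_pos: "continuous_on S (\<lambda>p. rel_pos d (fst p) (snd p))"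
proof -
  have "rel_pos d (fst p) (snd p) = fst p - source_pos d 0 - snd p *\<^sub>R axis 1 1" for p
    using rel_pos_eq[of d "fst p" "snd p"] by (simp add: rel_pos_def)
  then show ?thesis by (auto intro!: continuous_intros)
qed

text \<open>The vector fields below are scalar functions times real-linear images of the relative position, which
  is affine in the source parameter.\<close>
definition cvec :: "complex \<Rightarrow> real^3 \<Rightarrow> complex^3" where
  "cvec c y = (\<chi> j. c * of_real (y $ j))"

lemma bounded_linear_cvec: "bounded_linear (cvec c)"
  unfolding linear_conv_bounded_linear[symmetric]
  by (rule linearI) (simp_all add: cvec_def Finite_Cartesian_Product.vec_eq_iff algebra_simps scaleR_conv_of_real[where 'a=complex])

lemma x_tilde_eq: "x_tilde k d x \<alpha> = (1 / norm (rel_pos d x \<alpha>)) *\<^sub>R cvec (\<i> * of_real k) (rel_pos d x \<alpha>)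
     - (1 / (norm (rel_pos d x \<alpha>))\<^sup>2) *\<^sub>R cvec 1 (rel_pos d x \<alpha>)"
  by (simp add: x_tilde_def rel_pos_def cvec_def Finite_Cartesian_Product.vec_eq_iff scaleR_conv_of_real[where 'a=complex])

text \<open>The explicit form shows that the derivative is jointly continuous in the point and the parameter.\<close>
lemma x_hat_eq:
  assumes nz: "\<And>\<alpha>. rel_pos d x \<alpha> \<noteq> 0"
  defines "y \<equiv> rel_pos d x"
  shows "x_hat k d x \<alpha> =
     (1 / norm (y \<alpha>)) *\<^sub>R cvec (\<i> * of_real k) (- axis 1 1) + (y \<alpha> $ 1 / (norm (y \<alpha>)) ^ 3) *\<^sub>R cvec (\<i> * of_real k) (y \<alpha>)
     - ((1 / (norm (y \<alpha>))\<^sup>2) *\<^sub>R cvec 1 (- axis 1 1) + (2 * (y \<alpha> $ 1) / (norm (y \<alpha>)) ^ 4) *\<^sub>R cvec 1 (y \<alpha>))"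
proof -
  have nz': "y \<alpha> \<noteq> 0" for \<alpha> using nz by (simp add: y_def)
  have yd: "(y has_vector_derivative (- axis 1 1)) (at \<alpha>)"
  proof -
    have "y = (\<lambda>\<alpha>. rel_pos d x 0 - \<alpha> *\<^sub>R axis 1 1)" unfolding y_def using rel_pos_eq by blast
    then show ?thesis by (auto intro!: derivative_eq_intros)
  qed
  have cd: "((\<lambda>\<alpha>. cvec c (y \<alpha>)) has_vector_derivative cvec c (- axis 1 1)) (at \<alpha>)" for c
    by (rule bounded_linear.has_vector_derivative[OF bounded_linear_cvec yd])
  have nd: "((\<lambda>\<alpha>. norm (y \<alpha>)) has_real_derivative (- (y \<alpha> $ 1) / norm (y \<alpha>))) (at \<alpha>)"
  proof -
    have "(norm has_derivative (\<lambda>h. h \<bullet> sgn (y \<alpha>))) (at (y \<alpha>))" using nz' by (rule has_derivative_norm)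
    then have "((\<lambda>\<alpha>. norm (y \<alpha>)) has_derivative (\<lambda>h. (h *\<^sub>R (- axis 1 1)) \<bullet> sgn (y \<alpha>))) (at \<alpha>)"
      using has_derivative_compose[OF yd[unfolded has_vector_derivative_def], of norm] by blast
    moreover have "(\<lambda>h. (h *\<^sub>R (- axis 1 1)) \<bullet> sgn (y \<alpha>)) = (*) (- (y \<alpha> $ 1) / norm (y \<alpha>))"
      by (auto simp: sgn_div_norm inner_axis' field_simps)
    ultimately show ?thesis by (simp add: has_field_derivative_def)
  qed
  have n0: "norm (y \<alpha>) \<noteq> 0" using nz' by simp
  have i1: "((\<lambda>\<alpha>. 1 / norm (y \<alpha>)) has_real_derivative (y \<alpha> $ 1 / (norm (y \<alpha>)) ^ 3)) (at \<alpha>)"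
    using nd n0 by (auto intro!: derivative_eq_intros simp: power2_eq_square power3_eq_cube field_simps)
  have i2: "((\<lambda>\<alpha>. 1 / (norm (y \<alpha>))\<^sup>2) has_real_derivative (2 * (y \<alpha> $ 1) / (norm (y \<alpha>)) ^ 4)) (at \<alpha>)"
    using nd n0 by (auto intro!: derivative_eq_intros simp: power2_eq_square power4_eq_xxxx field_simps)
  have "(x_tilde k d x has_vector_derivative
     ((1 / norm (y \<alpha>)) *\<^sub>R cvec (\<i> * of_real k) (- axis 1 1) + (y \<alpha> $ 1 / (norm (y \<alpha>)) ^ 3) *\<^sub>R cvec (\<i> * of_real k) (y \<alpha>)
     - ((1 / (norm (y \<alpha>))\<^sup>2) *\<^sub>R cvec 1 (- axis 1 1) + (2 * (y \<alpha> $ 1) / (norm (y \<alpha>)) ^ 4) *\<^sub>R cvec 1 (y \<alpha>)))) (at \<alpha>)"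
    unfolding x_tilde_eq[abs_def] y_def[symmetric]
    by (intro has_vector_derivative_diff has_vector_derivative_scaleR i1 i2 cd)
  then show ?thesis unfolding x_hat_def by (rule vector_derivative_at)
qed

lemma continuous_x_tilde:
  assumes "d > R"
  shows "continuous_on (closed_cube R \<times> A) (\<lambda>p. x_tilde k d (fst p) (snd p))"
  unfolding x_tilde_eq
  by (intro continuous_intros continuous_rel_pos bounded_linear.continuous_on[OF bounded_linear_cvec])
     (auto simp: rel_pos_nonzero[OF assms])

lemma continuous_x_hat:
  assumes "d > R"
  shows "continuous_on (closed_cube R \<times> A) (\<lambda>p. x_hat k d (fst p) (snd p))"
proof -
  have "continuous_on (closed_cube R \<times> A) (\<lambda>p. 
     (1 / norm (rel_pos d (fst p) (snd p))) *\<^sub>R cvec (\<i> * of_real k) (- axis 1 1) + (rel_pos d (fst p) (snd p) $ 1 / (norm (rel_pos d (fst p) (snd p))) ^ 3) *\<^sub>R cvec (\<i> * of_real k) (rel_pos d (fst p) (snd p))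
     - ((1 / (norm (rel_pos d (fst p) (snd p)))\<^sup>2) *\<^sub>R cvec 1 (- axis 1 1) + (2 * (rel_pos d (fst p) (snd p) $ 1) / (norm (rel_pos d (fst p) (snd p))) ^ 4) *\<^sub>R cvec 1 (rel_pos d (fst p) (snd p))))"
    by (intro continuous_intros continuous_rel_pos bounded_linear.continuous_on[OF bounded_linear_cvec])
       (auto simp: rel_pos_nonzero[OF assms])
  then show ?thesis
    by (rule continuous_on_cong[THEN iffD1, rotated 2]) (auto simp: x_hat_eq rel_pos_nonzero[OF assms])
qed

text \<open>Pulling the vector \<open>A\<close> out of the integral over the source parameter leaves coefficients that are
  continuous up to the boundary of the cube.\<close>
lemma weighted_cdot_integral:
  fixes F :: "real^3 \<Rightarrow> real \<Rightarrow> complex^3" and w :: "real \<Rightarrow> real"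
  assumes w: "continuous_on UNIV w" and F: "continuous_on (closed_cube R \<times> {-a..a}) (\<lambda>p. F (fst p) (snd p))"
  shows "continuous_on (closed_cube R) (\<lambda>x. integral {-a..a} (\<lambda>\<alpha>. of_real (w \<alpha>) * F x \<alpha> $ j))"
    and "x \<in> closed_cube R \<Longrightarrow> integral {-a..a} (\<lambda>\<alpha>. of_real (w \<alpha>) * cdot A (F x \<alpha>)) = (\<Sum>j\<in>UNIV. integral {-a..a} (\<lambda>\<alpha>. of_real (w \<alpha>) * F x \<alpha> $ j) * A $ j)"
proof -
  have c: "continuous_on (closed_cube R \<times> {-a..a}) (\<lambda>p. of_real (w (snd p)) * F (fst p) (snd p) $ j)" for j
    by (intro continuous_intros F continuous_on_compose2[OF w]) auto
  have "continuous_on (closed_cube R) (\<lambda>x. integral (cbox (-a) a) (\<lambda>\<alpha>. of_real (w \<alpha>) * F x \<alpha> $ j))"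
    by (rule integral_continuous_on_param) (use c[of j] in \<open>simp add: case_prod_beta'\<close>)
  then show "continuous_on (closed_cube R) (\<lambda>x. integral {-a..a} (\<lambda>\<alpha>. of_real (w \<alpha>) * F x \<alpha> $ j))" by simp
  assume x: "x \<in> closed_cube R"
  have int: "(\<lambda>\<alpha>. of_real (w \<alpha>) * F x \<alpha> $ j) integrable_on {-a..a}" for j
  proof -
    have "continuous_on {-a..a} (\<lambda>\<alpha>. of_real (w \<alpha>) * F x \<alpha> $ j)"
    proof -
      have "continuous_on {-a..a} (\<lambda>\<alpha>. (\<lambda>p. of_real (w (snd p)) * F (fst p) (snd p) $ j) (x, \<alpha>))"
        by (rule continuous_on_compose2[OF c]) (use x in \<open>auto intro!: continuous_intros\<close>)
      then show ?thesis by simp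
    qed
    then show ?thesis by (rule integrable_continuous_real)
  qed
  have "integral {-a..a} (\<lambda>\<alpha>. of_real (w \<alpha>) * cdot A (F x \<alpha>)) = integral {-a..a} (\<lambda>\<alpha>. \<Sum>j\<in>UNIV. (of_real (w \<alpha>) * F x \<alpha> $ j) * A $ j)"
    by (simp add: cdot_def sum_distrib_left mult_ac)
  also have "\<dots> = (\<Sum>j\<in>UNIV. integral {-a..a} (\<lambda>\<alpha>. (of_real (w \<alpha>) * F x \<alpha> $ j) * A $ j))"
    by (intro integral_sum integrable_on_mult_left int) auto
  also have "\<dots> = (\<Sum>j\<in>UNIV. integral {-a..a} (\<lambda>\<alpha>. of_real (w \<alpha>) * F x \<alpha> $ j) * A $ j)"
    by (simp only: integral_mult_left)
  finally show "integral {-a..a} (\<lambda>\<alpha>. of_real (w \<alpha>) * cdot A (F x \<alpha>)) = (\<Sum>j\<in>UNIV. integral {-a..a} (\<lambda>\<alpha>. of_real (w \<alpha>) * F x \<alpha> $ j) * A $ j)" .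
qed

lemma cdot_commute: "cdot A B = cdot B A" by (simp add: cdot_def mult.commute)

definition quad_op :: "nat \<Rightarrow> (nat \<Rightarrow> nat \<Rightarrow> complex) \<Rightarrow> (nat \<Rightarrow> 3 \<Rightarrow> complex) \<Rightarrow> (nat \<Rightarrow> 3 \<Rightarrow> complex) \<Rightarrow> complex" where
  "quad_op N q b g = (\<Sum>n<N. \<Sum>l<N. \<Sum>j\<in>UNIV. q n l * (g n j * g l j)) + (\<Sum>n<N. \<Sum>j\<in>UNIV. b n j * g n j)"

lemma quad_op_sum:
  fixes M :: nat
  shows "(\<Sum>i<M. c i * quad_op N (q i) (b i) g) = quad_op N (\<lambda>n l. \<Sum>i<M. c i * q i n l) (\<lambda>n j. \<Sum>i<M. c i * b i n j) g"
proof (induction M)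
  case (Suc M)
  then show ?case by (simp add: quad_op_def distrib_left distrib_right sum.distrib sum_distrib_left mult.assoc)
qed (simp add: quad_op_def)

text \<open>Once the integrals over the source parameter are absorbed into coefficients, the operator is the
  Laplacian plus a quadratic polynomial in the gradient without constant term.\<close>
lemma L_op_quadratic:
  assumes "d > R"
  shows "\<exists>q b. (\<forall>m n j. continuous_on (closed_cube R) (b m n j)) \<and>
     (\<forall>V m x. x \<in> cube R \<longrightarrow> L_op R d a k N V m x = weak_laplacian (cube R) (V m) x +
        quad_op N (q m) (\<lambda>n j. b m n j x) (\<lambda>n j. wcderiv R (axis j 1) (V n) x))"
proof -
  define q0 where "q0 m n l = 2 * complex_of_real (integral {-a..a} (\<lambda>\<alpha>. Psi a m \<alpha> * Psi a n \<alpha> * deriv (Psi a l) \<alpha>))" for m n l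
  define b1 where "b1 m n j x = integral {-a..a} (\<lambda>\<alpha>. of_real (Psi a m \<alpha> * deriv (Psi a n) \<alpha>) * x_tilde k d x \<alpha> $ j)" for m n j x
  define b2 where "b2 m n j x = integral {-a..a} (\<lambda>\<alpha>. of_real (Psi a m \<alpha> * Psi a n \<alpha>) * x_hat k d x \<alpha> $ j)" for m n j x
  define b0 where "b0 m n j x = 2 * b1 m n j x + 2 * b2 m n j x" for m n j x
  have w1: "continuous_on UNIV (\<lambda>\<alpha>. Psi a m \<alpha> * deriv (Psi a n) \<alpha>)" for m n
    by (intro smooth1_continuous smooth1_mult smooth1_deriv smooth1_Psi)
  have w2: "continuous_on UNIV (\<lambda>\<alpha>. Psi a m \<alpha> * Psi a n \<alpha>)" for m n
    by (intro smooth1_continuous smooth1_mult smooth1_Psi)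
  note c1 = continuous_x_tilde[OF assms, of "{-a..a}" k] and c2 = continuous_x_hat[OF assms, of "{-a..a}" k]
  have bc: "continuous_on (closed_cube R) (b0 m n j)" for m n j
    unfolding b0_def[abs_def] b1_def b2_def
    by (intro continuous_intros weighted_cdot_integral(1)[OF w1 c1] weighted_cdot_integral(1)[OF w2 c2])
  have f: "f_op R d a k N V m x = quad_op N (q0 m) (\<lambda>n j. b0 m n j x) (\<lambda>n j. wcderiv R (axis j 1) (V n) x)"
    if "x \<in> cube R" for V m x
  proof -
    have x: "x \<in> closed_cube R" using that cube_subset_closed_cube by blast
    let ?g = "\<lambda>n j. wcderiv R (axis j 1) (V n) x"
    have g: "weak_grad (cube R) (V n) x $ j = ?g n j" for n j by (simp add: weak_grad_def)
    have 1: "integral {-a..a} (\<lambda>\<alpha>. of_real (Psi a m \<alpha> * deriv (Psi a n) \<alpha>) * cdot (weak_grad (cube R) (V n) x) (x_tilde k d x \<alpha>))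
       = (\<Sum>j\<in>UNIV. b1 m n j x * ?g n j)" for n
      unfolding weighted_cdot_integral(2)[OF w1 c1 x] b1_def g ..
    have 2: "integral {-a..a} (\<lambda>\<alpha>. of_real (Psi a m \<alpha> * Psi a n \<alpha>) * cdot (x_hat k d x \<alpha>) (weak_grad (cube R) (V n) x))
       = (\<Sum>j\<in>UNIV. b2 m n j x * ?g n j)" for n
      unfolding cdot_commute[of "x_hat k d x _"] weighted_cdot_integral(2)[OF w2 c2 x] b2_def g ..
    show ?thesis unfolding f_op_def 1 2 quad_op_def q0_def b0_def
      by (simp add: cdot_def g sum_distrib_left sum_distrib_right sum.distrib distrib_left distrib_right mult_ac)
  qed
  define s where "s m l = complex_of_real (the (mat_inverse (S_mat a N)) $$ (m, l))" for m l
  show ?thesis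
  proof (intro exI conjI allI impI)
    show "continuous_on (closed_cube R) ((\<lambda>m n j x. \<Sum>i<N. s m i * b0 i n j x) m n j)" for m n j
      by (intro continuous_intros bc)
    show "L_op R d a k N V m x = weak_laplacian (cube R) (V m) x +
        quad_op N ((\<lambda>m n l. \<Sum>i<N. s m i * q0 i n l) m) (\<lambda>n j. (\<lambda>m n j x. \<Sum>i<N. s m i * b0 i n j x) m n j x) (\<lambda>n j. wcderiv R (axis j 1) (V n) x)"
      if "x \<in> cube R" for V m x
      unfolding L_op_def K_op_def f[OF that] s_def[symmetric] quad_op_sum ..
  qed
qed

lemma quad_op_diff_bound:
  assumes q: "\<And>n l. n < N \<Longrightarrow> l < N \<Longrightarrow> cmod (q n l) \<le> Q" and b: "\<And>n j. n < N \<Longrightarrow> cmod (b n j) \<le> Q" and Q: "0 \<le> Q"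
  defines "S g \<equiv> (\<Sum>n<N. \<Sum>j\<in>UNIV. cmod (g n j))"
  shows "cmod (quad_op N q b (\<lambda>n j. g n j + h n j) - quad_op N q b g) \<le> Q * (2 * S g * S h) + Q * (S h)\<^sup>2 + Q * S h"
proof -
  have S0: "0 \<le> S g" for g :: "nat \<Rightarrow> 3 \<Rightarrow> complex" unfolding S_def by (intro sum_nonneg) auto
  have eq: "quad_op N q b (\<lambda>n j. g n j + h n j) - quad_op N q b g =
    (\<Sum>n<N. \<Sum>l<N. \<Sum>j\<in>UNIV. q n l * (g n j * h l j)) + (\<Sum>n<N. \<Sum>l<N. \<Sum>j\<in>UNIV. q n l * (h n j * g l j))
     + (\<Sum>n<N. \<Sum>l<N. \<Sum>j\<in>UNIV. q n l * (h n j * h l j)) + (\<Sum>n<N. \<Sum>j\<in>UNIV. b n j * h n j)"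
    by (simp add: quad_op_def distrib_left distrib_right sum.distrib)
  have bil: "cmod (\<Sum>n<N. \<Sum>l<N. \<Sum>j\<in>UNIV. q n l * (u n j * v l j)) \<le> Q * (S u * S v)" for u v
  proof -
    have "cmod (\<Sum>n<N. \<Sum>l<N. \<Sum>j\<in>UNIV. q n l * (u n j * v l j)) \<le> (\<Sum>n<N. \<Sum>l<N. \<Sum>j\<in>UNIV. Q * (cmod (u n j) * cmod (v l j)))"
      using q by (intro sum_norm_le) (auto simp: norm_mult intro!: mult_right_mono)
    also have "\<dots> \<le> (\<Sum>n<N. \<Sum>l<N. \<Sum>j\<in>UNIV. Q * (cmod (u n j) * (\<Sum>i\<in>UNIV. cmod (v l i))))"
      using Q by (intro sum_mono mult_left_mono member_le_sum) auto
    also have "\<dots> = Q * (S u * S v)"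
      unfolding S_def by (simp add: sum_distrib_left sum_distrib_right sum_product)
        (simp add: sum_distrib_left[symmetric] sum_distrib_right[symmetric] sum.swap[of _ "{..<N}" UNIV] mult_ac)
    finally show ?thesis .
  qed
  have lin: "cmod (\<Sum>n<N. \<Sum>j\<in>UNIV. b n j * h n j) \<le> Q * S h"
    unfolding S_def sum_distrib_left using b
    by (intro sum_norm_le) (auto simp: norm_mult intro!: mult_right_mono)
  have "cmod (quad_op N q b (\<lambda>n j. g n j + h n j) - quad_op N q b g) \<le> Q * (S g * S h) + Q * (S h * S g) + Q * (S h * S h) + Q * S h"
    unfolding eq by (intro norm_triangle_le add_mono bil lin)
  then show ?thesis by (simp add: power2_eq_square algebra_simps)
qed

section \<open>An energy estimate for increments of the operator\<close>

definition re_im :: "bool \<Rightarrow> (real^3 \<Rightarrow> complex) \<Rightarrow> real^3 \<Rightarrow> real" where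
  "re_im c v x = (if c then Re (v x) else Im (v x))"

lemma re_im_True: "re_im True v = (\<lambda>x. Re (v x))" and re_im_False: "re_im False v = (\<lambda>x. Im (v x))"
  by (simp_all add: re_im_def fun_eq_iff)

lemma in_sobolev_re_im: "V \<in> sobolev_vec \<Omega> s N \<Longrightarrow> n < N \<Longrightarrow> in_sobolev \<Omega> s (re_im c (V n))"
  by (cases c) (auto simp: sobolev_vec_def re_im_True re_im_False)

lemma sobolev_norm_re_im_le:
  assumes "n < N"
  shows "(sobolev_norm (cube R) s (re_im c (V n)))\<^sup>2 \<le> (sobolev_vec_norm (cube R) s N V)\<^sup>2"
proof -
  have "(sobolev_norm (cube R) s (re_im c (V n)))\<^sup>2 \<le> (sobolev_norm (cube R) s (\<lambda>x. Re (V n x)))\<^sup>2 + (sobolev_norm (cube R) s (\<lambda>x. Im (V n x)))\<^sup>2"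
    by (cases c) (auto simp: re_im_True re_im_False)
  also have "\<dots> \<le> (sobolev_vec_norm (cube R) s N V)\<^sup>2"
    unfolding sobolev_vec_norm_sq using assms by (intro member_le_sum) auto
  finally show ?thesis .
qed

definition energy :: "real \<Rightarrow> nat \<Rightarrow> nat \<Rightarrow> vecfun \<Rightarrow> real^3 \<Rightarrow> real" where
  "energy R N p V x = (\<Sum>n<N. \<Sum>j\<in>UNIV. (cmod (wcderiv R (axis j p) (V n) x))\<^sup>2)"

lemma energy_eq:
  "energy R N p V x = (\<Sum>(n, j, c)\<in>{..<N} \<times> UNIV \<times> UNIV. (wderiv R (axis j p) (re_im c (V n)) x)\<^sup>2)"
  unfolding energy_def weak_cderiv_def
  by (simp add: cmod_power2 UNIV_bool re_im_True re_im_False sum.cartesian_product[symmetric] add.commute)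

lemma energy_integrable:
  assumes R: "R > 0" and V: "V \<in> H3 R N" and p: "p \<le> 3"
  shows "integrable (leb_cube R) (energy R N p V)"
    and "(\<integral>x. energy R N p V x \<partial>leb_cube R) \<le> 6 * real N * (H3_norm R N V)\<^sup>2"
proof -
  let ?I = "{..<N} \<times> (UNIV :: 3 set) \<times> (UNIV :: bool set)"
  have i: "integrable (leb_cube R) (\<lambda>x. (wderiv R (axis j p) (re_im c (V n)) x)\<^sup>2)" if "n < N" for n j c
    using square_integrable_weak_deriv[OF R in_sobolev_re_im[OF V that], of "axis j p" c] p by (simp add: square_integrable_def)
  show "integrable (leb_cube R) (energy R N p V)"
    unfolding energy_eq[abs_def] by (intro Bochner_Integration.integrable_sum) (auto intro: i)
  have "(\<integral>x. energy R N p V x \<partial>leb_cube R) = (\<Sum>z\<in>?I. \<integral>x. (case z of (n, j, c) \<Rightarrow> (wderiv R (axis j p) (re_im c (V n)) x)\<^sup>2) \<partial>leb_cube R)"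
    unfolding energy_eq by (rule Bochner_Integration.integral_sum) (auto intro: i)
  also have "\<dots> \<le> (\<Sum>z\<in>?I. (H3_norm R N V)\<^sup>2)"
  proof (rule sum_mono)
    fix z assume "z \<in> ?I"
    then obtain n j c where z: "z = (n, j, c)" "n < N" by auto
    have "deriv_sq R (axis j p) (re_im c (V n)) \<le> (sobolev_norm (cube R) 3 (re_im c (V n)))\<^sup>2" by (rule deriv_sq_le) (simp add: p)
    also have "\<dots> \<le> (H3_norm R N V)\<^sup>2" by (rule sobolev_norm_re_im_le[OF z(2)])
    finally show "(\<integral>x. (case z of (n, j, c) \<Rightarrow> (wderiv R (axis j p) (re_im c (V n)) x)\<^sup>2) \<partial>leb_cube R) \<le> (H3_norm R N V)\<^sup>2"
      by (simp add: z deriv_sq_def)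
  qed
  also have "\<dots> = 6 * real N * (H3_norm R N V)\<^sup>2" by simp
  finally show "(\<integral>x. energy R N p V x \<partial>leb_cube R) \<le> 6 * real N * (H3_norm R N V)\<^sup>2" .
qed

lemma energy_nonneg: "0 \<le> energy R N p V x"
  unfolding energy_def by (intro sum_nonneg) auto

lemma energy_product_bound:
  assumes R: "R > 0"
  shows "\<exists>C>0. \<forall>U\<in>H3 R N. \<forall>V\<in>H3 R N.
    integrable (leb_cube R) (\<lambda>x. energy R N 1 U x * energy R N 1 V x) \<and>
    (\<integral>x. energy R N 1 U x * energy R N 1 V x \<partial>leb_cube R) \<le> C * (H3_norm R N U)\<^sup>2 * (H3_norm R N V)\<^sup>2"
proof (rule gradient_product_bound[OF R])
  fix C0 :: real
  let ?M = "leb_cube R"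
  assume C0: "C0 > 0" and b: "\<And>u v i j. in_sobolev (cube R) 3 u \<Longrightarrow> in_sobolev (cube R) 3 v \<Longrightarrow>
      integrable ?M (\<lambda>x. (wderiv R (axis i 1) u x)\<^sup>2 * (wderiv R (axis j 1) v x)\<^sup>2) \<and>
      (\<integral>x. (wderiv R (axis i 1) u x)\<^sup>2 * (wderiv R (axis j 1) v x)\<^sup>2 \<partial>?M)
        \<le> C0 * (sobolev_norm (cube R) 3 u)\<^sup>2 * (sobolev_norm (cube R) 3 v)\<^sup>2"
  let ?I = "{..<N} \<times> (UNIV :: 3 set) \<times> (UNIV :: bool set)"
  let ?C = "(6 * real N)\<^sup>2 * C0 + 1"
  show ?thesis
  proof (intro exI[of _ ?C] conjI ballI)
    have "0 \<le> (6 * real N)\<^sup>2 * C0" using C0 by simp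
    then show "?C > 0" by linarith
    fix U V assume U: "U \<in> H3 R N" and V: "V \<in> H3 R N"
    define D where "D W z x = (case z of (n, j, c) \<Rightarrow> (wderiv R (axis j 1) (re_im c (W n)) x)\<^sup>2)" for W :: vecfun and z :: "nat \<times> 3 \<times> bool" and x
    let ?u = "(H3_norm R N U)\<^sup>2" and ?v = "(H3_norm R N V)\<^sup>2"
    have D: "integrable ?M (\<lambda>x. D U z x * D V y x) \<and> (\<integral>x. D U z x * D V y x \<partial>?M) \<le> C0 * ?u * ?v" if zI: "z \<in> ?I" and yI: "y \<in> ?I" for z y
    proof -
      obtain n j c where z: "z = (n, j, c)" "n < N" using zI by auto
      obtain n' j' c' where y: "y = (n', j', c')" "n' < N" using yI by auto
      have *: "integrable ?M (\<lambda>x. D U z x * D V y x)"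
        "(\<integral>x. D U z x * D V y x \<partial>?M) \<le> C0 * (sobolev_norm (cube R) 3 (re_im c (U n)))\<^sup>2 * (sobolev_norm (cube R) 3 (re_im c' (V n')))\<^sup>2"
        using b[OF in_sobolev_re_im[OF U z(2)] in_sobolev_re_im[OF V y(2)]] by (auto simp: D_def z y)
      have "C0 * (sobolev_norm (cube R) 3 (re_im c (U n)))\<^sup>2 * (sobolev_norm (cube R) 3 (re_im c' (V n')))\<^sup>2 \<le> C0 * ?u * ?v"
        using C0 by (intro mult_mono sobolev_norm_re_im_le z y) auto
      with * show ?thesis by simp
    qed
    have E: "energy R N 1 U x * energy R N 1 V x = (\<Sum>z\<in>?I. \<Sum>y\<in>?I. D U z x * D V y x)" for x
      unfolding energy_eq D_def by (rule sum_product)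
    show "integrable ?M (\<lambda>x. energy R N 1 U x * energy R N 1 V x)"
      unfolding E using D by (intro Bochner_Integration.integrable_sum) blast
    have "(\<integral>x. energy R N 1 U x * energy R N 1 V x \<partial>?M) = (\<Sum>z\<in>?I. \<Sum>y\<in>?I. \<integral>x. D U z x * D V y x \<partial>?M)"
      unfolding E using D
      by (subst Bochner_Integration.integral_sum) (auto intro!: sum.cong Bochner_Integration.integral_sum Bochner_Integration.integrable_sum)
    also have "\<dots> \<le> (\<Sum>z\<in>?I. \<Sum>y\<in>?I. C0 * ?u * ?v)" using D by (intro sum_mono) blast
    also have "\<dots> = (6 * real N)\<^sup>2 * C0 * ?u * ?v" by (simp add: power2_eq_square)
    also have "\<dots> \<le> ?C * ?u * ?v" by (intro mult_right_mono) auto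
    finally show "(\<integral>x. energy R N 1 U x * energy R N 1 V x \<partial>?M) \<le> ?C * ?u * ?v" .
  qed
qed

lemma quad_op_cong:
  assumes "\<And>n j. n < N \<Longrightarrow> g n j = h n j" shows "quad_op N q b g = quad_op N q b h"
  unfolding quad_op_def using assms by (intro arg_cong2[of _ _ _ _ "(+)"] sum.cong) auto

lemma abs_sum_square_energy:
  "(\<Sum>n<N. \<Sum>j\<in>UNIV. cmod (wcderiv R (axis j p) (V n) x))\<^sup>2 \<le> 3 * real N * energy R N p V x"
proof -
  let ?I = "{..<N} \<times> (UNIV :: 3 set)"
  have "(\<Sum>z\<in>?I. cmod (wcderiv R (axis (snd z) p) (V (fst z)) x))\<^sup>2
     \<le> (\<Sum>z\<in>?I. (cmod (wcderiv R (axis (snd z) p) (V (fst z)) x))\<^sup>2) * card ?I"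
    by (rule sum_squared_le_sum_of_squares)
  then show ?thesis unfolding energy_def by (simp add: sum.cartesian_product case_prod_beta' mult.commute)
qed

lemma laplacian_energy:
  "(\<Sum>m<N. (cmod (weak_laplacian (cube R) (V m) x))\<^sup>2) \<le> 3 * energy R N 2 V x"
proof -
  have "(cmod (weak_laplacian (cube R) (V m) x))\<^sup>2 \<le> 3 * (\<Sum>j\<in>UNIV. (cmod (wcderiv R (axis j 2) (V m) x))\<^sup>2)" for m
  proof -
    have "(cmod (weak_laplacian (cube R) (V m) x))\<^sup>2 \<le> (\<Sum>j\<in>UNIV. cmod (wcderiv R (axis j 2) (V m) x))\<^sup>2"
      unfolding weak_laplacian_def by (intro power_mono norm_sum) auto
    also have "\<dots> \<le> (\<Sum>j\<in>UNIV. (cmod (wcderiv R (axis j 2) (V m) x))\<^sup>2) * card (UNIV :: 3 set)"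
      by (rule sum_squared_le_sum_of_squares)
    finally show ?thesis by simp
  qed
  then show ?thesis unfolding energy_def sum_distrib_left[of 3 _ "{..<N}"] by (intro sum_mono)
qed

text \<open>The difference is linear in the second derivatives of \<open>U\<close> and at most bilinear in the gradients of
  \<open>V\<close> and \<open>U\<close>. The squares of these terms are dominated by the energy of second order of \<open>U\<close>, the energy of
  first order of \<open>U\<close> and products of energies of first order; the latter are
  integrable by \<open>energy_product_bound\<close>.\<close>
lemma L_op_difference_bound:
  assumes R: "R > 0" and d: "d > R"
  shows "\<exists>K>0. \<forall>V\<in>H3 R N. \<forall>U\<in>H3 R N. \<exists>F.
    integrable (leb_cube R) F \<and>
    (\<integral>x. F x \<partial>leb_cube R) \<le> K * (H3_norm R N U)\<^sup>2 * (1 + (H3_norm R N V)\<^sup>2 + (H3_norm R N U)\<^sup>2) \<and>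
    (AE x in leb_cube R. (\<Sum>m<N. (cmod (L_op R d a k N (lin_vec 1 V 1 U) m x - L_op R d a k N V m x))\<^sup>2) \<le> F x)"
proof -
  let ?M = "leb_cube R"
  obtain q b where bc: "\<And>m n j. continuous_on (closed_cube R) (b m n j)" and
    L: "\<And>V m x. x \<in> cube R \<Longrightarrow> L_op R d a k N V m x = weak_laplacian (cube R) (V m) x +
        quad_op N (q m) (\<lambda>n j. b m n j x) (\<lambda>n j. wcderiv R (axis j 1) (V n) x)"
    using L_op_quadratic[OF d] by metis
  have "\<forall>m n j. \<exists>B. \<forall>x\<in>closed_cube R. cmod (b m n j x) \<le> B"
    using compact_imp_bounded[OF compact_continuous_image[OF bc compact_closed_cube]]
    unfolding bounded_iff by (metis imageI)
  then obtain B where B: "\<And>m n j x. x \<in> closed_cube R \<Longrightarrow> cmod (b m n j x) \<le> B m n j" by metis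
  let ?S = "(\<lambda>(m, n, l). cmod (q m n l)) ` ({..<N} \<times> {..<N} \<times> {..<N}) \<union> (\<lambda>(m, n, j). B m n j) ` ({..<N} \<times> {..<N} \<times> UNIV)"
  have "finite ?S" by auto
  then obtain Q0 where Q0: "\<And>y. y \<in> ?S \<Longrightarrow> y \<le> Q0" using bdd_above_finite[of ?S] unfolding bdd_above_def by blast
  define Q where "Q = max 0 Q0"
  have Q: "0 \<le> Q" by (simp add: Q_def)
  have qQ: "cmod (q m n l) \<le> Q" if "m < N" "n < N" "l < N" for m n l
  proof -
    have "cmod (q m n l) \<in> ?S" using that by force
    then show ?thesis using Q0 by (auto simp: Q_def le_max_iff_disj)
  qed
  have bQ: "cmod (b m n j x) \<le> Q" if "m < N" "n < N" "x \<in> cube R" for m n j x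
  proof -
    have "B m n j \<in> ?S" using that by force
    then have "B m n j \<le> Q" using Q0 by (auto simp: Q_def le_max_iff_disj)
    then show ?thesis using B[of x m n j] that(3) cube_subset_closed_cube by (meson order_trans subsetD)
  qed
  obtain C0 where C0: "C0 > 0" and Eb: "\<And>U V. U \<in> H3 R N \<Longrightarrow> V \<in> H3 R N \<Longrightarrow>
    integrable ?M (\<lambda>x. energy R N 1 U x * energy R N 1 V x) \<and>
    (\<integral>x. energy R N 1 U x * energy R N 1 V x \<partial>?M) \<le> C0 * (H3_norm R N U)\<^sup>2 * (H3_norm R N V)\<^sup>2"
    using energy_product_bound[OF R, of N] by blast
  define t where "t = 3 * real N"
  define c where "c = 4 * real N * Q\<^sup>2"
  have tc: "0 \<le> t" "0 \<le> c" by (auto simp: t_def c_def)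
  define K where "K = 72 * real N + 4 * c * t\<^sup>2 * C0 + c * t\<^sup>2 * C0 + c * t * (6 * real N) + 1"
  show ?thesis
  proof (intro exI[of _ K] conjI ballI)
    have "0 \<le> 72 * real N + 4 * c * t\<^sup>2 * C0 + c * t\<^sup>2 * C0 + c * t * (6 * real N)"
      using tc C0 by (intro add_nonneg_nonneg mult_nonneg_nonneg) auto
    then show "K > 0" by (simp add: K_def)
    fix V U assume V: "V \<in> H3 R N" and U: "U \<in> H3 R N"
    let ?W = "lin_vec 1 V 1 U"
    let ?u = "(H3_norm R N U)\<^sup>2" and ?v = "(H3_norm R N V)\<^sup>2"
    let ?EU = "energy R N 1 U" and ?EV = "energy R N 1 V"
    define F where "F x = 12 * energy R N 2 U x + 4 * c * t\<^sup>2 * (?EV x * ?EU x) + c * t\<^sup>2 * (?EU x * ?EU x) + c * t * ?EU x" for x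
    have i1: "integrable ?M (\<lambda>x. 12 * energy R N 2 U x)" "integrable ?M (\<lambda>x. 4 * c * t\<^sup>2 * (?EV x * ?EU x))"
       "integrable ?M (\<lambda>x. c * t\<^sup>2 * (?EU x * ?EU x))" "integrable ?M (\<lambda>x. c * t * ?EU x)"
      using energy_integrable(1)[OF R U] Eb[OF V U] Eb[OF U U] by auto
    show "\<exists>F. integrable ?M F \<and> (\<integral>x. F x \<partial>?M) \<le> K * ?u * (1 + ?v + ?u) \<and>
      (AE x in ?M. (\<Sum>m<N. (cmod (L_op R d a k N ?W m x - L_op R d a k N V m x))\<^sup>2) \<le> F x)"
    proof (intro exI[of _ F] conjI)
      show "integrable ?M F" unfolding F_def[abs_def] using i1 by (intro Bochner_Integration.integrable_add)
      have "(\<integral>x. F x \<partial>?M) = 12 * (\<integral>x. energy R N 2 U x \<partial>?M) + 4 * c * t\<^sup>2 * (\<integral>x. ?EV x * ?EU x \<partial>?M)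
         + c * t\<^sup>2 * (\<integral>x. ?EU x * ?EU x \<partial>?M) + c * t * (\<integral>x. ?EU x \<partial>?M)"
        unfolding F_def using i1 by (simp add: Bochner_Integration.integral_add Bochner_Integration.integrable_add del: Bochner_Integration.integrable_mult_right_iff Bochner_Integration.integrable_mult_left_iff)
      also have "\<dots> \<le> 12 * (6 * real N * ?u) + 4 * c * t\<^sup>2 * (C0 * ?v * ?u) + c * t\<^sup>2 * (C0 * ?u * ?u) + c * t * (6 * real N * ?u)"
        using energy_integrable(2)[OF R U, of 2] energy_integrable(2)[OF R U, of 1] Eb[OF V U] Eb[OF U U] tc
        by (intro add_mono mult_left_mono) auto
      also have "\<dots> = (72 * real N + c * t * (6 * real N)) * ?u + (4 * c * t\<^sup>2 * C0) * (?u * ?v) + (c * t\<^sup>2 * C0) * (?u * ?u)"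
        by (simp add: algebra_simps)
      also have "\<dots> \<le> K * ?u + K * (?u * ?v) + K * (?u * ?u)"
      proof (intro add_mono mult_right_mono)
        have "0 \<le> 72 * real N" "0 \<le> 4 * c * t\<^sup>2 * C0" "0 \<le> c * t\<^sup>2 * C0" "0 \<le> c * t * (6 * real N)"
          using tc C0 by (auto intro!: mult_nonneg_nonneg)
        then show "72 * real N + c * t * (6 * real N) \<le> K" "4 * c * t\<^sup>2 * C0 \<le> K" "c * t\<^sup>2 * C0 \<le> K"
          unfolding K_def by linarith+
      qed auto
      also have "\<dots> = K * ?u * (1 + ?v + ?u)" by (simp add: algebra_simps)
      finally show "(\<integral>x. F x \<partial>?M) \<le> K * ?u * (1 + ?v + ?u)" .
      have "AE x in ?M. \<forall>n\<in>{..<N}. \<forall>j\<in>UNIV. wcderiv R (axis j 1) (?W n) x = wcderiv R (axis j 1) (V n) x + wcderiv R (axis j 1) (U n) x"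
        using weak_cderiv_lin[OF R V U, of "axis _ 1" _ 1 1] by (intro AE_finite_allI) auto
      moreover have "AE x in ?M. \<forall>n\<in>{..<N}. \<forall>j\<in>UNIV. wcderiv R (axis j 2) (?W n) x = wcderiv R (axis j 2) (V n) x + wcderiv R (axis j 2) (U n) x"
        using weak_cderiv_lin[OF R V U, of "axis _ 2" _ 1 1] by (intro AE_finite_allI) auto
      moreover have "AE x in ?M. x \<in> cube R" by (rule AE_I2) (simp add: space_restrict_space)
      ultimately show "AE x in ?M. (\<Sum>m<N. (cmod (L_op R d a k N ?W m x - L_op R d a k N V m x))\<^sup>2) \<le> F x"
      proof eventually_elim
        case (elim x)
        let ?g = "\<lambda>n j. wcderiv R (axis j 1) (V n) x" and ?h = "\<lambda>n j. wcderiv R (axis j 1) (U n) x"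
        define Sg where "Sg = (\<Sum>n<N. \<Sum>j\<in>UNIV. cmod (?g n j))"
        define Sh where "Sh = (\<Sum>n<N. \<Sum>j\<in>UNIV. cmod (?h n j))"
        have SE: "Sg\<^sup>2 \<le> t * ?EV x" "Sh\<^sup>2 \<le> t * ?EU x"
          unfolding Sg_def Sh_def t_def by (rule abs_sum_square_energy)+
        have pw: "(cmod (L_op R d a k N ?W m x - L_op R d a k N V m x))\<^sup>2 \<le> 4 * (cmod (weak_laplacian (cube R) (U m) x))\<^sup>2
            + (4 * Q\<^sup>2) * (4 * (Sg\<^sup>2 * Sh\<^sup>2) + Sh\<^sup>2 * Sh\<^sup>2 + Sh\<^sup>2)" if m: "m < N" for m
        proof -
          have lap: "weak_laplacian (cube R) (?W m) x = weak_laplacian (cube R) (V m) x + weak_laplacian (cube R) (U m) x"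
            using elim(2) m by (simp add: weak_laplacian_def sum.distrib)
          have "L_op R d a k N ?W m x - L_op R d a k N V m x = weak_laplacian (cube R) (U m) x +
             (quad_op N (q m) (\<lambda>n j. b m n j x) (\<lambda>n j. ?g n j + ?h n j) - quad_op N (q m) (\<lambda>n j. b m n j x) ?g)"
            unfolding L[OF elim(3)] lap using elim(1)
            by (subst quad_op_cong[of N "\<lambda>n j. wcderiv R (axis j 1) (?W n) x" "\<lambda>n j. ?g n j + ?h n j"]) auto
          then have "cmod (L_op R d a k N ?W m x - L_op R d a k N V m x) \<le> cmod (weak_laplacian (cube R) (U m) x) +
              (Q * (2 * Sg * Sh) + Q * Sh\<^sup>2 + Q * Sh)"
            unfolding Sg_def Sh_def using qQ[OF m] bQ[OF m _ elim(3)] Q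
            by (auto intro!: norm_triangle_le add_left_mono quad_op_diff_bound)
          then have "(cmod (L_op R d a k N ?W m x - L_op R d a k N V m x))\<^sup>2 \<le>
             (cmod (weak_laplacian (cube R) (U m) x) + Q * (2 * Sg * Sh) + Q * Sh\<^sup>2 + Q * Sh)\<^sup>2"
            by (intro power_mono) (auto simp: add.assoc)
          also have "\<dots> \<le> 4 * ((cmod (weak_laplacian (cube R) (U m) x))\<^sup>2 + (Q * (2 * Sg * Sh))\<^sup>2 + (Q * Sh\<^sup>2)\<^sup>2 + (Q * Sh)\<^sup>2)"
            by (rule square_sum4_le)
          also have "\<dots> = 4 * (cmod (weak_laplacian (cube R) (U m) x))\<^sup>2 + (4 * Q\<^sup>2) * (4 * (Sg\<^sup>2 * Sh\<^sup>2) + Sh\<^sup>2 * Sh\<^sup>2 + Sh\<^sup>2)"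
            by (simp add: power2_eq_square algebra_simps)
          finally show ?thesis .
        qed
        have "(\<Sum>m<N. (cmod (L_op R d a k N ?W m x - L_op R d a k N V m x))\<^sup>2) \<le>
            (\<Sum>m<N. 4 * (cmod (weak_laplacian (cube R) (U m) x))\<^sup>2 + (4 * Q\<^sup>2) * (4 * (Sg\<^sup>2 * Sh\<^sup>2) + Sh\<^sup>2 * Sh\<^sup>2 + Sh\<^sup>2))"
          by (intro sum_mono pw) auto
        also have "\<dots> = 4 * (\<Sum>m<N. (cmod (weak_laplacian (cube R) (U m) x))\<^sup>2) + c * (4 * (Sg\<^sup>2 * Sh\<^sup>2) + Sh\<^sup>2 * Sh\<^sup>2 + Sh\<^sup>2)"
          by (simp add: sum.distrib sum_distrib_left c_def)
        also have "\<dots> \<le> 4 * (3 * energy R N 2 U x) + c * (4 * ((t * ?EV x) * (t * ?EU x)) + (t * ?EU x) * (t * ?EU x) + t * ?EU x)"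
          using tc by (intro add_mono mult_left_mono mult_mono laplacian_energy SE) (auto intro!: mult_nonneg_nonneg simp: energy_nonneg)
        also have "\<dots> = F x" unfolding F_def by (simp add: power2_eq_square algebra_simps)
        finally show ?case .
      qed
    qed
  qed
qed

section \<open>The residual and continuity of the functional\<close>

lemma weak_cderiv_measurable:
  assumes R: "R > 0" and V: "V \<in> sobolev_vec (cube R) s N" and n: "n < N" and \<beta>: "mi_order \<beta> \<le> s"
  shows "wcderiv R \<beta> (V n) \<in> borel_measurable (leb_cube R)"
proof -
  have [measurable]: "wderiv R \<beta> (re_im c (V n)) \<in> borel_measurable (leb_cube R)" for c
    using square_integrable_weak_deriv[OF R in_sobolev_re_im[OF V n] \<beta>] by (simp add: square_integrable_def)
  have "wcderiv R \<beta> (V n) = (\<lambda>x. of_real (wderiv R \<beta> (re_im True (V n)) x) + \<i> * of_real (wderiv R \<beta> (re_im False (V n)) x))"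
    by (auto simp: weak_cderiv_def re_im_True re_im_False complex_eq_iff)
  then show ?thesis by simp
qed

lemma L_op_measurable:
  assumes R: "R > 0" and d: "d > R" and V: "V \<in> H3 R N" and m: "m < N"
  shows "L_op R d a k N V m \<in> borel_measurable (leb_cube R)"
proof -
  obtain q b where bc: "\<And>m n j. continuous_on (closed_cube R) (b m n j)" and
    L: "\<And>V m x. x \<in> cube R \<Longrightarrow> L_op R d a k N V m x = weak_laplacian (cube R) (V m) x +
        quad_op N (q m) (\<lambda>n j. b m n j x) (\<lambda>n j. wcderiv R (axis j 1) (V n) x)"
    using L_op_quadratic[OF d] by metis
  have bm: "b m n j \<in> borel_measurable (leb_cube R)" for m n j
    using continuous_on_subset[OF bc cube_subset_closed_cube]
    by (intro continuous_imp_measurable_on_sets_lebesgue) auto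
  have "(\<lambda>x. weak_laplacian (cube R) (V m) x +
        quad_op N (q m) (\<lambda>n j. b m n j x) (\<lambda>n j. wcderiv R (axis j 1) (V n) x)) \<in> borel_measurable (leb_cube R)"
    unfolding weak_laplacian_def quad_op_def
    by (intro borel_measurable_add borel_measurable_sum borel_measurable_times borel_measurable_const bm weak_cderiv_measurable[OF R V])
       (auto simp: m)
  then show ?thesis by (subst measurable_cong[OF L]) (auto simp: space_restrict_space)
qed

definition residual :: "real \<Rightarrow> real \<Rightarrow> real \<Rightarrow> real \<Rightarrow> real \<Rightarrow> nat \<Rightarrow> real \<Rightarrow> vecfun \<Rightarrow> real" where
  "residual R d a k r N lam V = exp (- 2 * lam * (R + r)\<^sup>2) *
       (\<integral>x. (\<Sum>m<N. (cmod (L_op R d a k N V m x))\<^sup>2) * exp (2 * lam * (x $ 3 - r)\<^sup>2) \<partial>leb_cube R)"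

lemma J_fun_eq: "J_fun R d a k r N lam \<gamma> V = residual R d a k r N lam V + \<gamma> * (H3_norm R N V)\<^sup>2"
  by (simp add: J_fun_def residual_def)

text \<open>For positive \<open>lam\<close> and \<open>r\<close>, the normalization makes the weight at most 1 on the cube.\<close>
definition carleman_weight :: "real \<Rightarrow> real \<Rightarrow> real \<Rightarrow> real^3 \<Rightarrow> real" where
  "carleman_weight R r lam x = exp (- 2 * lam * (R + r)\<^sup>2) * exp (2 * lam * (x $ 3 - r)\<^sup>2)"

lemma carleman_weight_bounds:
  assumes "lam > 0" "r > 0" "x \<in> cube R"
  shows "0 \<le> carleman_weight R r lam x" "carleman_weight R r lam x \<le> 1"
proof -
  show "0 \<le> carleman_weight R r lam x" by (simp add: carleman_weight_def)
  have "\<bar>x $ 3\<bar> < R" using assms(3) by (simp add: cube_iff)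
  then have "\<bar>x $ 3 - r\<bar> \<le> \<bar>R + r\<bar>" using assms(2) by linarith
  then have "(x $ 3 - r)\<^sup>2 \<le> (R + r)\<^sup>2" by (rule abs_le_square_iff[THEN iffD1])
  then have "2 * lam * (x $ 3 - r)\<^sup>2 \<le> 2 * lam * (R + r)\<^sup>2" using assms(1) by simp
  then show "carleman_weight R r lam x \<le> 1" by (simp add: carleman_weight_def mult_exp_exp)
qed

lemma residual_eq:
  "residual R d a k r N lam V = (\<integral>x. (\<Sum>m<N. (cmod (L_op R d a k N V m x))\<^sup>2) * carleman_weight R r lam x \<partial>leb_cube R)"
  unfolding residual_def carleman_weight_def
  by (subst Bochner_Integration.integral_mult_right_zero[symmetric]) (simp add: mult_ac)

lemma residual_nonneg:
  "0 \<le> residual R d a k r N lam V"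
  unfolding residual_def by (intro mult_nonneg_nonneg Bochner_Integration.integral_nonneg sum_nonneg) auto

lemma carleman_weight_measurable: "carleman_weight R r lam \<in> borel_measurable (leb_cube R)"
  unfolding carleman_weight_def[abs_def]
  by (intro continuous_imp_measurable_on_sets_lebesgue continuous_intros) auto

lemma residual_integrable:
  assumes R: "R > 0" and d: "d > R" and r: "r > 0" and lam: "lam > 0" and V: "V \<in> H3 R N"
    and F: "integrable (leb_cube R) F" and le: "AE x in leb_cube R. (\<Sum>m<N. (cmod (L_op R d a k N V m x))\<^sup>2) \<le> F x"
  shows "integrable (leb_cube R) (\<lambda>x. (\<Sum>m<N. (cmod (L_op R d a k N V m x))\<^sup>2) * carleman_weight R r lam x)"
proof (rule Bochner_Integration.integrable_bound[OF F])
  have [measurable]: "L_op R d a k N V m \<in> borel_measurable (leb_cube R)" if "m < N" for m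
    by (rule L_op_measurable[OF R d V that])
  note carleman_weight_measurable[measurable]
  show "(\<lambda>x. (\<Sum>m<N. (cmod (L_op R d a k N V m x))\<^sup>2) * carleman_weight R r lam x) \<in> borel_measurable (leb_cube R)"
    by (intro borel_measurable_times borel_measurable_sum borel_measurable_power borel_measurable_norm L_op_measurable[OF R d V] carleman_weight_measurable) auto
  have "AE x in leb_cube R. x \<in> cube R" by (rule AE_I2) (simp add: space_restrict_space)
  with le show "AE x in leb_cube R. norm ((\<Sum>m<N. (cmod (L_op R d a k N V m x))\<^sup>2) * carleman_weight R r lam x) \<le> norm (F x)"
  proof eventually_elim
    case (elim x)
    let ?G = "\<Sum>m<N. (cmod (L_op R d a k N V m x))\<^sup>2"
    have G: "0 \<le> ?G" by (intro sum_nonneg) auto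
    have "?G * carleman_weight R r lam x \<le> ?G * 1"
      using carleman_weight_bounds[OF lam r elim(2)] G by (intro mult_left_mono)
    then show ?case using elim(1) G carleman_weight_bounds[OF lam r elim(2)] by simp
  qed
qed

text \<open>The square root of the residual is a weighted \<open>L\<^sup>2\<close> norm of \<open>L(V)\<close>, to which the triangle inequality in
  its quadratic form applies.\<close>
lemma residual_triangle:
  assumes R: "R > 0" and d: "d > R" and r: "r > 0" and lam: "lam > 0"
  shows "\<exists>K>0. \<forall>V\<in>H3 R N. \<forall>U\<in>H3 R N.
    sqrt (residual R d a k r N lam (lin_vec 1 V 1 U)) \<le> sqrt (residual R d a k r N lam V) +
      sqrt (K * (H3_norm R N U)\<^sup>2 * (1 + (H3_norm R N V)\<^sup>2 + (H3_norm R N U)\<^sup>2))"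
proof -
  let ?M = "leb_cube R"
  let ?L = "L_op R d a k N"
  obtain K where K: "K > 0" and KF: "\<And>V U. V \<in> H3 R N \<Longrightarrow> U \<in> H3 R N \<Longrightarrow> \<exists>F. integrable ?M F \<and>
    (\<integral>x. F x \<partial>?M) \<le> K * (H3_norm R N U)\<^sup>2 * (1 + (H3_norm R N V)\<^sup>2 + (H3_norm R N U)\<^sup>2) \<and>
    (AE x in ?M. (\<Sum>m<N. (cmod (?L (lin_vec 1 V 1 U) m x - ?L V m x))\<^sup>2) \<le> F x)"
    using L_op_difference_bound[OF R d, of N a k] by blast
  have young: "(\<Sum>m<N. (cmod (?L W m x))\<^sup>2) \<le> (1 + \<epsilon>) * (\<Sum>m<N. (cmod (?L V m x))\<^sup>2) + (1 + 1/\<epsilon>) * (\<Sum>m<N. (cmod (?L W m x - ?L V m x))\<^sup>2)"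
    if \<epsilon>: "\<epsilon> > 0" for \<epsilon> V W x
    unfolding sum_distrib_left sum.distrib[symmetric]
  proof (rule sum_mono)
    fix m
    have "cmod (?L W m x) \<le> cmod (?L V m x) + cmod (?L W m x - ?L V m x)"
      using norm_triangle_ineq[of "?L V m x" "?L W m x - ?L V m x"] by simp
    then have "(cmod (?L W m x))\<^sup>2 \<le> (cmod (?L V m x) + cmod (?L W m x - ?L V m x))\<^sup>2" by (intro power_mono) auto
    also have "\<dots> \<le> (1 + \<epsilon>) * (cmod (?L V m x))\<^sup>2 + (1 + 1/\<epsilon>) * (cmod (?L W m x - ?L V m x))\<^sup>2"
      by (rule young_square[OF \<epsilon>])
    finally show "(cmod (?L W m x))\<^sup>2 \<le> (1 + \<epsilon>) * (cmod (?L V m x))\<^sup>2 + (1 + 1/\<epsilon>) * (cmod (?L W m x - ?L V m x))\<^sup>2" .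
  qed
  \<comment> \<open>Comparing \<open>V\<close> with the zero function, at which \<open>L\<close> vanishes, shows that \<open>L(V)\<close> itself is square
    integrable.\<close>
  have int: "integrable ?M (\<lambda>x. (\<Sum>m<N. (cmod (?L V m x))\<^sup>2) * carleman_weight R r lam x)" if V: "V \<in> H3 R N" for V
  proof -
    let ?Z = "lin_vec 0 V 0 V"
    have Z: "?Z \<in> H3 R N" by (rule lin_vec_sobolev[OF V V])
    have VZ: "lin_vec 1 ?Z 1 V = V" by (simp add: lin_vec_def)
    obtain F where F: "integrable ?M F" "AE x in ?M. (\<Sum>m<N. (cmod (?L V m x - ?L ?Z m x))\<^sup>2) \<le> F x"
      using KF[OF Z V] unfolding VZ by blast
    obtain q b where L: "\<And>V m x. x \<in> cube R \<Longrightarrow> ?L V m x = weak_laplacian (cube R) (V m) x +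
        quad_op N (q m) (\<lambda>n j. b m n j x) (\<lambda>n j. wcderiv R (axis j 1) (V n) x)"
      using L_op_quadratic[OF d, of b] L_op_quadratic[OF d] by metis
    have "AE x in ?M. \<forall>n\<in>{..<N}. \<forall>j\<in>UNIV. wcderiv R (axis j 1) (?Z n) x = 0"
      using weak_cderiv_lin[OF R V V, of "axis _ 1" _ 0 0] by (intro AE_finite_allI) auto
    moreover have "AE x in ?M. \<forall>n\<in>{..<N}. \<forall>j\<in>UNIV. wcderiv R (axis j 2) (?Z n) x = 0"
      using weak_cderiv_lin[OF R V V, of "axis _ 2" _ 0 0] by (intro AE_finite_allI) auto
    moreover have "AE x in ?M. x \<in> cube R" by (rule AE_I2) (simp add: space_restrict_space)
    ultimately have "AE x in ?M. \<forall>m<N. ?L ?Z m x = 0"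
    proof eventually_elim
      case (elim x)
      then show ?case unfolding L[OF elim(3)] weak_laplacian_def
        by (subst quad_op_cong[of N _ "\<lambda>n j. 0"]) (auto simp: quad_op_def)
    qed
    with F(2) have "AE x in ?M. (\<Sum>m<N. (cmod (?L V m x))\<^sup>2) \<le> F x"
      by eventually_elim simp
    then show ?thesis by (rule residual_integrable[OF R d r lam V F(1)])
  qed
  show ?thesis
  proof (intro exI[of _ K] conjI ballI K)
    fix V U assume V: "V \<in> H3 R N" and U: "U \<in> H3 R N"
    let ?W = "lin_vec 1 V 1 U"
    let ?B = "K * (H3_norm R N U)\<^sup>2 * (1 + (H3_norm R N V)\<^sup>2 + (H3_norm R N U)\<^sup>2)"
    have W: "?W \<in> H3 R N" by (rule lin_vec_sobolev[OF V U])
    obtain F where F: "integrable ?M F" "(\<integral>x. F x \<partial>?M) \<le> ?B" "AE x in ?M. (\<Sum>m<N. (cmod (?L ?W m x - ?L V m x))\<^sup>2) \<le> F x"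
      using KF[OF V U] by blast
    have "sqrt (residual R d a k r N lam ?W) \<le> \<bar>1\<bar> * sqrt (residual R d a k r N lam V) + \<bar>1\<bar> * sqrt ?B"
    proof (rule sqrt_triangle_of_young)
      show "0 \<le> residual R d a k r N lam V" by (rule residual_nonneg)
      show "0 \<le> ?B" using K by (intro mult_nonneg_nonneg) auto
      fix \<epsilon> :: real assume \<epsilon>: "\<epsilon> > 0"
      have "residual R d a k r N lam ?W \<le> (\<integral>x. (1 + \<epsilon>) * ((\<Sum>m<N. (cmod (?L V m x))\<^sup>2) * carleman_weight R r lam x) + (1 + 1/\<epsilon>) * F x \<partial>?M)"
        unfolding residual_eq
      proof (rule integral_mono_AE)
        show "integrable ?M (\<lambda>x. (\<Sum>m<N. (cmod (?L ?W m x))\<^sup>2) * carleman_weight R r lam x)" by (rule int[OF W])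
        show "integrable ?M (\<lambda>x. (1 + \<epsilon>) * ((\<Sum>m<N. (cmod (?L V m x))\<^sup>2) * carleman_weight R r lam x) + (1 + 1/\<epsilon>) * F x)"
          using int[OF V] F(1) by auto
        have "AE x in ?M. x \<in> cube R" by (rule AE_I2) (simp add: space_restrict_space)
        with F(3) show "AE x in ?M. (\<Sum>m<N. (cmod (?L ?W m x))\<^sup>2) * carleman_weight R r lam x
            \<le> (1 + \<epsilon>) * ((\<Sum>m<N. (cmod (?L V m x))\<^sup>2) * carleman_weight R r lam x) + (1 + 1/\<epsilon>) * F x"
        proof eventually_elim
          case (elim x)
          let ?\<nu> = "carleman_weight R r lam x"
          let ?D = "\<Sum>m<N. (cmod (?L ?W m x - ?L V m x))\<^sup>2"
          note \<nu> = carleman_weight_bounds[OF lam r elim(2)]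
          have D: "0 \<le> ?D" by (intro sum_nonneg) auto
          have "(\<Sum>m<N. (cmod (?L ?W m x))\<^sup>2) * ?\<nu> \<le> ((1 + \<epsilon>) * (\<Sum>m<N. (cmod (?L V m x))\<^sup>2) + (1 + 1/\<epsilon>) * ?D) * ?\<nu>"
            by (rule mult_right_mono[OF young[OF \<epsilon>] \<nu>(1)])
          also have "\<dots> = (1 + \<epsilon>) * ((\<Sum>m<N. (cmod (?L V m x))\<^sup>2) * ?\<nu>) + (1 + 1/\<epsilon>) * (?D * ?\<nu>)" by (simp add: algebra_simps)
          also have "?D * ?\<nu> \<le> F x * 1" using elim(1) D \<nu> by (intro mult_mono) auto
          finally show ?case using \<epsilon> by (simp add: mult_left_mono)
        qed
      qed
      also have "\<dots> = (1 + \<epsilon>) * residual R d a k r N lam V + (1 + 1/\<epsilon>) * (\<integral>x. F x \<partial>?M)"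
        unfolding residual_eq using int[OF V] F(1) by (subst Bochner_Integration.integral_add) auto
      also have "\<dots> \<le> (1 + \<epsilon>) * residual R d a k r N lam V + (1 + 1/\<epsilon>) * ?B"
        using F(2) \<epsilon> by (intro add_left_mono mult_left_mono) auto
      finally show "residual R d a k r N lam ?W \<le> (1 + \<epsilon>) * 1\<^sup>2 * residual R d a k r N lam V + (1 + 1/\<epsilon>) * 1\<^sup>2 * ?B" by simp
    qed
    then show "sqrt (residual R d a k r N lam ?W) \<le> sqrt (residual R d a k r N lam V) + sqrt ?B" by simp
  qed
qed

text \<open>The triangle inequalities bound the value at \<open>V + U\<close> by a continuous function of the norm of \<open>U\<close>
  whose value at 0 is the value of the functional at \<open>V\<close>.\<close>
lemma J_fun_upper_semicontinuous:
  assumes R: "R > 0" and d: "d > R" and r: "r > 0" and lam: "lam > 0" and V: "V \<in> H3 R N" and \<gamma>: "0 \<le> \<gamma>" and \<eta>: "\<eta> > 0"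
  shows "\<exists>e>0. \<forall>U\<in>H3 R N. H3_norm R N U < e \<longrightarrow>
    J_fun R d a k r N lam \<gamma> (lin_vec 1 V 1 U) \<le> J_fun R d a k r N lam \<gamma> V + \<eta>"
proof -
  obtain K where K: "K > 0" and KT: "\<And>V U. V \<in> H3 R N \<Longrightarrow> U \<in> H3 R N \<Longrightarrow>
    sqrt (residual R d a k r N lam (lin_vec 1 V 1 U)) \<le> sqrt (residual R d a k r N lam V) +
      sqrt (K * (H3_norm R N U)\<^sup>2 * (1 + (H3_norm R N V)\<^sup>2 + (H3_norm R N U)\<^sup>2))"
    using residual_triangle[OF R d r lam, of N a k] by blast
  let ?A = "residual R d a k r N lam V" and ?v = "H3_norm R N V"
  define \<phi> where "\<phi> s = (sqrt ?A + sqrt (K * s\<^sup>2 * (1 + ?v\<^sup>2 + s\<^sup>2)))\<^sup>2 + \<gamma> * (?v + s)\<^sup>2" for s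
  have "isCont \<phi> 0" unfolding \<phi>_def by (intro continuous_intros)
  moreover have \<phi>0: "\<phi> 0 = J_fun R d a k r N lam \<gamma> V"
    by (simp add: \<phi>_def J_fun_eq residual_nonneg)
  ultimately obtain e where e: "e > 0" "\<And>s. \<bar>s - 0\<bar> < e \<Longrightarrow> \<bar>\<phi> s - \<phi> 0\<bar> < \<eta>"
    using \<eta> unfolding continuous_at_eps_delta dist_real_def by metis
  show ?thesis
  proof (intro exI[of _ e] conjI ballI impI e(1))
    fix U assume U: "U \<in> H3 R N" and small: "H3_norm R N U < e"
    let ?u = "H3_norm R N U" and ?W = "lin_vec 1 V 1 U"
    have "sqrt (residual R d a k r N lam ?W) ^ 2 \<le> (sqrt ?A + sqrt (K * ?u\<^sup>2 * (1 + ?v\<^sup>2 + ?u\<^sup>2)))\<^sup>2"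
      by (intro power_mono KT V U) (simp add: residual_nonneg)
    moreover have "(H3_norm R N ?W)\<^sup>2 \<le> (?v + ?u)\<^sup>2"
      using sobolev_vec_norm_lin[OF R V U, of 1 1] by (intro power_mono) (auto simp: sobolev_vec_norm_nonneg)
    ultimately have "J_fun R d a k r N lam \<gamma> ?W \<le> \<phi> ?u"
      unfolding J_fun_eq \<phi>_def using \<gamma> by (intro add_mono mult_left_mono) (auto simp: residual_nonneg)
    also have "\<dots> \<le> \<phi> 0 + \<eta>"
      using e(2)[of ?u] small sobolev_vec_norm_nonneg[of "cube R" 3 N U] by simp
    finally show "J_fun R d a k r N lam \<gamma> ?W \<le> J_fun R d a k r N lam \<gamma> V + \<eta>" by (simp add: \<phi>0)
  qed
qed

section \<open>Cauchy data and convexity\<close>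

lemma has_bdry_values_lin:
  assumes V: "has_bdry_values \<Omega> N S V p" and W: "has_bdry_values \<Omega> N S W q"
    and Z: "\<And>n. n < N \<Longrightarrow> AE x in lebesgue_on \<Omega>. Z n x = of_real a * V n x + of_real b * W n x"
  shows "has_bdry_values \<Omega> N S Z (lin_vec a p b q)"
  unfolding has_bdry_values_def
proof (intro allI impI)
  fix n assume n: "n < N"
  obtain v where v: "continuous_on (closure \<Omega>) v" "AE x in lebesgue_on \<Omega>. v x = V n x" "\<forall>x\<in>S. v x = p n x"
    using V n unfolding has_bdry_values_def by blast
  obtain w where w: "continuous_on (closure \<Omega>) w" "AE x in lebesgue_on \<Omega>. w x = W n x" "\<forall>x\<in>S. w x = q n x"
    using W n unfolding has_bdry_values_def by blast
  show "\<exists>w. continuous_on (closure \<Omega>) w \<and> (AE x in lebesgue_on \<Omega>. w x = Z n x) \<and> (\<forall>x\<in>S. w x = lin_vec a p b q n x)"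
  proof (intro exI[of _ "\<lambda>x. of_real a * v x + of_real b * w x"] conjI)
    show "continuous_on (closure \<Omega>) (\<lambda>x. of_real a * v x + of_real b * w x)" by (intro continuous_intros v w)
    show "AE x in lebesgue_on \<Omega>. of_real a * v x + of_real b * w x = Z n x"
      using v(2) w(2) Z[OF n] by eventually_elim simp
  qed (use v(3) w(3) in \<open>simp add: lin_vec_def\<close>)
qed

lemma cauchy_data_lin:
  assumes R: "R > 0" and V: "V \<in> H3 R N" "cauchy_data R N V p0 p1" and W: "W \<in> H3 R N" "cauchy_data R N W q0 q1"
  shows "cauchy_data R N (lin_vec a V b W) (lin_vec a p0 b q0) (lin_vec a p1 b q1)"
  unfolding cauchy_data_def
proof (intro conjI has_bdry_values_lin)
  show "has_bdry_values (cube R) N (frontier (cube R)) V p0" "has_bdry_values (cube R) N (frontier (cube R)) W q0"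
    "has_bdry_values (cube R) N (bottom_face R) (\<lambda>n. wcderiv R (axis 3 1) (V n)) p1"
    "has_bdry_values (cube R) N (bottom_face R) (\<lambda>n. wcderiv R (axis 3 1) (W n)) q1"
    using V(2) W(2) by (auto simp: cauchy_data_def)
  show "AE x in leb_cube R. lin_vec a V b W n x = of_real a * V n x + of_real b * W n x" for n
    by (simp add: lin_vec_def)
  show "AE x in leb_cube R. wcderiv R (axis 3 1) (lin_vec a V b W n) x =
      of_real a * wcderiv R (axis 3 1) (V n) x + of_real b * wcderiv R (axis 3 1) (W n) x" if "n < N" for n
    by (rule weak_cderiv_lin[OF R V(1) W(1) _ that]) simp
qed

lemma diff_eq_lin_vec: "V - W = lin_vec 1 V (-1) W"
  by (simp add: lin_vec_def fun_eq_iff)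

lemma B_set_subset_closure:
  assumes R: "R > 0" and "M \<le> M'" shows "B_set R N M p0 p1 \<subseteq> B_closure R N M' p0 p1"
proof
  fix V assume V: "V \<in> B_set R N M p0 p1"
  then have s: "V \<in> H3 R N" by (simp add: B_set_def)
  have "H3_norm R N (lin_vec 0 V 0 V) \<le> 0"
    using sobolev_vec_norm_lin[OF R s s, of 0 0] by simp
  then have "H3_norm R N (V - V) \<le> 0" unfolding diff_eq_lin_vec by (simp add: lin_vec_def)
  moreover have "V \<in> B_set R N M' p0 p1" using V assms(2) by (auto simp: B_set_def)
  ultimately show "V \<in> B_closure R N M' p0 p1"
    unfolding B_closure_def using s le_less_trans by blast
qed

lemma B_set_convex:
  assumes R: "R > 0" and V: "V \<in> B_set R N M p0 p1" and W: "W \<in> B_set R N M p0 p1" and t: "0 \<le> t" "t \<le> 1"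
  shows "lin_vec (1 - t) V t W \<in> B_set R N M p0 p1"
proof -
  have s: "V \<in> H3 R N" "W \<in> H3 R N" and c: "cauchy_data R N V p0 p1" "cauchy_data R N W p0 p1"
    and n: "H3_norm R N V < M" "H3_norm R N W < M"
    using V W by (auto simp: B_set_def)
  have "lin_vec (1 - t) p t p = p" for p
    by (simp add: lin_vec_def fun_eq_iff algebra_simps)
  then have "cauchy_data R N (lin_vec (1 - t) V t W) p0 p1"
    using cauchy_data_lin[OF R s(1) c(1) s(2) c(2), of "1 - t" t] by simp
  moreover have "H3_norm R N (lin_vec (1 - t) V t W) < M"
  proof -
    have "H3_norm R N (lin_vec (1 - t) V t W) \<le> (1 - t) * H3_norm R N V + t * H3_norm R N W"
      using sobolev_vec_norm_lin[OF R s, of "1 - t" t] t by simp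
    also have "\<dots> < M" using n t by (intro convex_bound_lt) auto
    finally show ?thesis .
  qed
  ultimately show ?thesis using lin_vec_sobolev[OF s] by (simp add: B_set_def)
qed

lemma scale_eq_lin_vec: "(\<lambda>n x. of_real c * h n x) = lin_vec c h 0 h"
  by (simp add: lin_vec_def)

lemma H30_scale:
  assumes R: "R > 0" and h: "h \<in> H30 R N" shows "lin_vec c h 0 h \<in> H30 R N"
proof -
  have s: "h \<in> H3 R N" and cd: "cauchy_data R N h (\<lambda>n x. 0) (\<lambda>n x. 0)" using h by (auto simp: H30_def)
  have "lin_vec c (\<lambda>n x. 0) 0 (\<lambda>n x. 0) = (\<lambda>n x. 0)" by (simp add: lin_vec_def)
  then show ?thesis using cauchy_data_lin[OF R s cd s cd, of c 0] lin_vec_sobolev[OF s s] by (simp add: H30_def)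
qed

text \<open>Strict convexity provides a derivative for each pair of points separately; uniqueness allows two such
  inequalities at the same base point to be added.\<close>
lemma frechet_deriv_H30_unique:
  assumes R: "R > 0" and D: "has_frechet_deriv_H30 R N J V D" and D': "has_frechet_deriv_H30 R N J V D'" and h: "h \<in> H30 R N"
  shows "D h = D' h"
proof -
  let ?n = "H3_norm R N"
  have s: "h \<in> H3 R N" using h by (auto simp: H30_def)
  have lin: "D (lin_vec c h 0 h) = c * D h" "D' (lin_vec c h 0 h) = c * D' h" for c
    using D D' h unfolding has_frechet_deriv_H30_def scale_eq_lin_vec by blast+
  have bound: "\<bar>D h - D' h\<bar> \<le> 2 * \<epsilon> * ?n h" if \<epsilon>: "\<epsilon> > 0" for \<epsilon>
  proof -
    obtain \<eta> where \<eta>: "\<eta> > 0" "\<And>g. g \<in> H30 R N \<Longrightarrow> ?n g < \<eta> \<Longrightarrow> \<bar>J (\<lambda>n x. V n x + g n x) - J V - D g\<bar> \<le> \<epsilon> * ?n g"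
      using D \<epsilon> unfolding has_frechet_deriv_H30_def by meson
    obtain \<eta>' where \<eta>': "\<eta>' > 0" "\<And>g. g \<in> H30 R N \<Longrightarrow> ?n g < \<eta>' \<Longrightarrow> \<bar>J (\<lambda>n x. V n x + g n x) - J V - D' g\<bar> \<le> \<epsilon> * ?n g"
      using D' \<epsilon> unfolding has_frechet_deriv_H30_def by meson
    \<comment> \<open>Small enough for \<open>t h\<close> to satisfy both estimates, also when \<open>h\<close> has norm zero.\<close>
    define t where "t = min \<eta> \<eta>' / (2 * (?n h + 1))"
    have n0: "0 \<le> ?n h" by (rule sobolev_vec_norm_nonneg)
    have t: "t > 0" using \<eta> \<eta>' n0 by (simp add: t_def)
    let ?g = "lin_vec t h 0 h"
    have gn: "?n ?g \<le> t * ?n h" using sobolev_vec_norm_lin[OF R s s, of t 0] t by simp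
    also have "t * ?n h < min \<eta> \<eta>'"
    proof -
      have "t * ?n h \<le> t * (?n h + 1)" using t by simp
      also have "\<dots> = min \<eta> \<eta>' / 2"
      proof -
        have "0 < 2 * (?n h + 1)" using n0 by (intro mult_pos_pos add_nonneg_pos) auto
        then have "t * (2 * (?n h + 1)) = min \<eta> \<eta>'" unfolding t_def by (intro nonzero_eq_divide_eq[THEN iffD1, OF _ refl] less_imp_neq[symmetric])
        then show ?thesis by (simp add: algebra_simps)
      qed
      also have "\<dots> < min \<eta> \<eta>'" using \<eta>(1) \<eta>'(1) by (auto simp: min_def)
      finally show ?thesis .
    qed
    finally have small: "?n ?g < \<eta>" "?n ?g < \<eta>'" by auto
    have g: "?g \<in> H30 R N" by (rule H30_scale[OF R h])
    have "\<bar>D ?g - D' ?g\<bar> \<le> 2 * (\<epsilon> * ?n ?g)"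
      using \<eta>(2)[OF g small(1)] \<eta>'(2)[OF g small(2)] by linarith
    also have "\<dots> \<le> 2 * (\<epsilon> * (t * ?n h))" using gn \<epsilon> by simp
    finally have "t * \<bar>D h - D' h\<bar> \<le> t * (2 * \<epsilon> * ?n h)"
      unfolding lin using t by (simp add: abs_mult right_diff_distrib[symmetric] mult_ac)
    then show ?thesis using t by simp
  qed
  have "\<bar>D h - D' h\<bar> \<le> 0 + e" if e: "e > 0" for e
  proof -
    have n0: "0 \<le> ?n h" by (rule sobolev_vec_norm_nonneg)
    have "\<bar>D h - D' h\<bar> \<le> 2 * (e / (2 * (?n h + 1))) * ?n h" by (rule bound) (use e n0 in auto)
    also have "\<dots> \<le> e" using e n0 by (simp add: field_simps)
    finally show ?thesis by simp
  qed
  then have "\<bar>D h - D' h\<bar> \<le> 0" by (rule field_le_epsilon)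
  then show ?thesis by simp
qed

text \<open>The increments from the midpoint to \<open>V\<close> and to \<open>W\<close> are opposite, so the derivative terms cancel in the
  sum of the two convexity inequalities.\<close>
lemma midpoint_convexity:
  assumes R: "R > 0" and V: "V \<in> B_set R N M p0 p1" and W: "W \<in> B_set R N M p0 p1"
    and conv: "\<And>V1 V2. V1 \<in> B_set R N M p0 p1 \<Longrightarrow> V2 \<in> B_set R N M p0 p1 \<Longrightarrow>
      \<exists>D. has_frechet_deriv_H30 R N J V1 D \<and> J V2 - J V1 - D (V2 - V1) \<ge> c * (sobolev_vec_norm (cube R) 2 N (V2 - V1))\<^sup>2"
    and c: "c > 0"
  shows "J V + J W - 2 * J (lin_vec (1/2) V (1/2) W) \<ge> c / 2 * (sobolev_vec_norm (cube R) 2 N (V - W))\<^sup>2"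
proof -
  let ?mid = "lin_vec (1/2) V (1/2) W" and ?h = "V - W"
  have s: "V \<in> H3 R N" "W \<in> H3 R N" and cd: "cauchy_data R N V p0 p1" "cauchy_data R N W p0 p1"
    using V W by (auto simp: B_set_def)
  have hs: "?h \<in> H3 R N" unfolding diff_eq_lin_vec by (rule lin_vec_sobolev[OF s])
  have hs2: "?h \<in> sobolev_vec (cube R) 2 N" using hs by (auto simp: sobolev_vec_def intro: in_sobolev_mono)
  have h: "?h \<in> H30 R N"
  proof -
    have "lin_vec 1 p (-1) p = (\<lambda>n x. 0)" for p by (simp add: lin_vec_def fun_eq_iff)
    then show ?thesis using cauchy_data_lin[OF R s(1) cd(1) s(2) cd(2), of 1 "-1"] hs by (simp add: H30_def diff_eq_lin_vec)
  qed
  have mid: "?mid \<in> B_set R N M p0 p1" using B_set_convex[OF R V W, of "1/2"] by simp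
  have scale: "(sobolev_vec_norm (cube R) 2 N (lin_vec b ?h 0 ?h))\<^sup>2 = b\<^sup>2 * (sobolev_vec_norm (cube R) 2 N ?h)\<^sup>2" if "b \<noteq> 0" for b
  proof -
    let ?b = "lin_vec b ?h 0 ?h"
    have bs: "?b \<in> sobolev_vec (cube R) 2 N" by (rule lin_vec_sobolev[OF hs2 hs2])
    have "sobolev_vec_norm (cube R) 2 N ?b \<le> \<bar>b\<bar> * sobolev_vec_norm (cube R) 2 N ?h"
      using sobolev_vec_norm_lin[OF R hs2 hs2, of b 0] by simp
    moreover have "lin_vec (1/b) ?b 0 ?b = ?h" using that by (simp add: lin_vec_def fun_eq_iff)
    then have "sobolev_vec_norm (cube R) 2 N ?h \<le> \<bar>1/b\<bar> * sobolev_vec_norm (cube R) 2 N ?b"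
      using sobolev_vec_norm_lin[OF R bs bs, of "1/b" 0] by simp
    then have "\<bar>b\<bar> * sobolev_vec_norm (cube R) 2 N ?h \<le> sobolev_vec_norm (cube R) 2 N ?b"
      using that by (simp add: field_simps)
    ultimately have "sobolev_vec_norm (cube R) 2 N ?b = \<bar>b\<bar> * sobolev_vec_norm (cube R) 2 N ?h" by simp
    then show ?thesis by (simp add: power_mult_distrib)
  qed
  have d1: "V - ?mid = lin_vec (1/2) ?h 0 ?h" and d2: "W - ?mid = lin_vec (-1/2) ?h 0 ?h"
    by (simp_all add: lin_vec_def fun_eq_iff field_simps)
  obtain D where D: "has_frechet_deriv_H30 R N J ?mid D" "J V - J ?mid - D (V - ?mid) \<ge> c * (sobolev_vec_norm (cube R) 2 N (V - ?mid))\<^sup>2"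
    using conv[OF mid V] by blast
  obtain D' where D': "has_frechet_deriv_H30 R N J ?mid D'" "J W - J ?mid - D' (W - ?mid) \<ge> c * (sobolev_vec_norm (cube R) 2 N (W - ?mid))\<^sup>2"
    using conv[OF mid W] by blast
  have "D (V - ?mid) = 1/2 * D ?h" "D' (W - ?mid) = - 1/2 * D' ?h"
    using D(1) D'(1) h unfolding has_frechet_deriv_H30_def scale_eq_lin_vec d1 d2 by blast+
  moreover have "D ?h = D' ?h" by (rule frechet_deriv_H30_unique[OF R D(1) D'(1) h])
  ultimately have "D (V - ?mid) + D' (W - ?mid) = 0" by simp
  moreover have "c * (sobolev_vec_norm (cube R) 2 N (V - ?mid))\<^sup>2 = c / 4 * (sobolev_vec_norm (cube R) 2 N ?h)\<^sup>2"
    "c * (sobolev_vec_norm (cube R) 2 N (W - ?mid))\<^sup>2 = c / 4 * (sobolev_vec_norm (cube R) 2 N ?h)\<^sup>2"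
    unfolding d1 d2 using scale[of "1/2"] scale[of "-1/2"] by (simp_all add: power2_eq_square)
  ultimately show ?thesis using D(2) D'(2) by linarith
qed

section \<open>Convergence of the minimizers\<close>

theorem theorem5p4:
  fixes R d a k r M :: real and N :: nat
    and lambda2 :: "real \<Rightarrow> nat \<Rightarrow> real \<Rightarrow> (real^3) set \<Rightarrow> real"
  assumes "R > 0" and "d > R" and "a > 0" and "k > 0" and "r > R" and "N \<ge> 1"
    and threshold: "\<And>M'. M' > 0 \<Longrightarrow>
          convexity_threshold R d a k r N M' (lambda2 M' N r (cube R))"
    and "M > 0"
    and "lambda2 (3 * M) N r (cube R) > lambda2 M N r (cube R)"
  shows "\<exists>C1>0. \<forall>\<delta> \<psi>0 \<psi>1 \<psi>0s \<psi>1s Vs G Gs Vmin.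
      0 < \<delta> \<and> \<delta> < 1 \<and>
      Vs \<in> sobolev_vec (cube R) 3 N \<and>
      (\<forall>m<N. AE x in lebesgue_on (cube R). L_op R d a k N Vs m x = 0) \<and>
      cauchy_data R N Vs \<psi>0s \<psi>1s \<and>
      G \<in> sobolev_vec (cube R) 3 N \<and> cauchy_data R N G \<psi>0 \<psi>1 \<and>
      Gs \<in> sobolev_vec (cube R) 3 N \<and> cauchy_data R N Gs \<psi>0s \<psi>1s \<and>
      sobolev_vec_norm (cube R) 3 N (G - Gs) < \<delta> \<and>
      sobolev_vec_norm (cube R) 3 N Vs < M - \<delta> \<and>
      sobolev_vec_norm (cube R) 3 N Gs < M - \<delta> \<and>
      is_arg_min (J_fun R d a k r N (lambda2 (3 * M) N r (cube R)) (\<delta>\<^sup>2))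
        (\<lambda>V. V \<in> B_closure R N M \<psi>0 \<psi>1) Vmin
      \<longrightarrow> sobolev_vec_norm (cube R) 2 N (Vmin - Vs) \<le> C1 * \<delta>"
proof -
  note R = \<open>R > 0\<close> and d = \<open>d > R\<close>
  have r: "r > 0" using assms by simp
  define lam where "lam = lambda2 (3 * M) N r (cube R)"
  have thr: "convexity_threshold R d a k r N (3 * M) lam"
    unfolding lam_def using threshold[of "3 * M"] \<open>M > 0\<close> by simp
  then have lam: "lam > 0" by (simp add: convexity_threshold_def)
  obtain c where c: "c > 0" and conv: "\<And>\<gamma> \<psi>0 \<psi>1 V1 V2. 0 < \<gamma> \<and> \<gamma> < 1 \<and> V1 \<in> B_closure R N (3 * M) \<psi>0 \<psi>1 \<and> V2 \<in> B_closure R N (3 * M) \<psi>0 \<psi>1 \<Longrightarrow>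
        \<exists>D. has_frechet_deriv_H30 R N (J_fun R d a k r N lam \<gamma>) V1 D \<and>
             J_fun R d a k r N lam \<gamma> V2 - J_fun R d a k r N lam \<gamma> V1 - D (V2 - V1)
               \<ge> c * (sobolev_vec_norm (cube R) 2 N (V2 - V1))\<^sup>2
                 + \<gamma> * (H3_norm R N (V2 - V1))\<^sup>2"
    using thr unfolding convexity_threshold_def by blast
  obtain K where K: "K > 0" and KT: "\<And>V U. V \<in> H3 R N \<Longrightarrow> U \<in> H3 R N \<Longrightarrow>
    sqrt (residual R d a k r N lam (lin_vec 1 V 1 U)) \<le> sqrt (residual R d a k r N lam V) +
      sqrt (K * (H3_norm R N U)\<^sup>2 * (1 + (H3_norm R N V)\<^sup>2 + (H3_norm R N U)\<^sup>2))"
    using residual_triangle[OF R d r lam, of N a k] by blast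
  define K2 where "K2 = K * (2 + M\<^sup>2) + M\<^sup>2"
  have K2: "K2 > 0" unfolding K2_def using K \<open>M > 0\<close> by (intro add_pos_pos mult_pos_pos) (auto intro: add_pos_nonneg)
  define C where "C = 2 + sqrt (2 * (K2 + 1) / c)"
  have C: "C > 0" unfolding C_def using K2 c by (intro add_pos_nonneg) auto
  show ?thesis
  proof (intro exI[of _ C] conjI allI impI C, elim conjE)
    fix \<delta> :: real and \<psi>0 \<psi>1 \<psi>0s \<psi>1s Vs G Gs Vmin :: vecfun
    let ?J = "J_fun R d a k r N lam (\<delta>\<^sup>2)" and ?n = "H3_norm R N" and ?n2 = "sobolev_vec_norm (cube R) 2 N"
    assume \<delta>: "0 < \<delta>" "\<delta> < 1" and Vs: "Vs \<in> H3 R N"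
      and sol: "\<forall>m<N. AE x in leb_cube R. L_op R d a k N Vs m x = 0" and dVs: "cauchy_data R N Vs \<psi>0s \<psi>1s"
      and G: "G \<in> H3 R N" and dG: "cauchy_data R N G \<psi>0 \<psi>1"
      and Gs: "Gs \<in> H3 R N" and dGs: "cauchy_data R N Gs \<psi>0s \<psi>1s"
      and GG: "?n (G - Gs) < \<delta>" and nVs: "?n Vs < M - \<delta>"
      and min: "is_arg_min (J_fun R d a k r N (lambda2 (3 * M) N r (cube R)) (\<delta>\<^sup>2)) (\<lambda>V. V \<in> B_closure R N M \<psi>0 \<psi>1) Vmin"
    have \<delta>2: "0 < \<delta>\<^sup>2" "\<delta>\<^sup>2 < 1" using \<delta> by (auto simp: power_less_one_iff)
    have Vmin: "Vmin \<in> B_closure R N M \<psi>0 \<psi>1" and minim: "\<And>V. V \<in> B_closure R N M \<psi>0 \<psi>1 \<Longrightarrow> ?J Vmin \<le> ?J V"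
      using min unfolding is_arg_min_def lam_def[symmetric] by (auto simp: not_less)
    define h where "h = G - Gs"
    have h: "h \<in> H3 R N" and nh: "?n h < \<delta>"
      using lin_vec_sobolev[OF G Gs, of 1 "-1"] GG by (simp_all add: h_def diff_eq_lin_vec)
    \<comment> \<open>The ideal solution is corrected so as to have the noisy data; this uses the room of \<open>\<delta>\<close> left
      in its norm.\<close>
    define V' where "V' = lin_vec 1 Vs 1 h"
    have V's: "V' \<in> H3 R N" unfolding V'_def by (rule lin_vec_sobolev[OF Vs h])
    have nV': "?n V' < M" using sobolev_vec_norm_lin[OF R Vs h, of 1 1] nh nVs by (simp add: V'_def)
    have V': "V' \<in> B_set R N M \<psi>0 \<psi>1"
    proof -
      have dh: "cauchy_data R N h (lin_vec 1 \<psi>0 (-1) \<psi>0s) (lin_vec 1 \<psi>1 (-1) \<psi>1s)"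
        unfolding h_def diff_eq_lin_vec by (rule cauchy_data_lin[OF R G dG Gs dGs])
      have "lin_vec 1 p 1 (lin_vec 1 q (-1) p) = q" for p q by (simp add: lin_vec_def)
      then have "cauchy_data R N V' \<psi>0 \<psi>1" using cauchy_data_lin[OF R Vs dVs h dh, of 1 1] by (simp add: V'_def)
      then show ?thesis using V's nV' by (simp add: B_set_def)
    qed
    have JV': "?J V' \<le> K2 * \<delta>\<^sup>2"
    proof -
      have "residual R d a k r N lam Vs = 0"
      proof -
        have "AE x in leb_cube R. \<forall>m\<in>{..<N}. L_op R d a k N Vs m x = 0"
          using sol by (intro AE_finite_allI) auto
        then have "AE x in leb_cube R. (\<Sum>m<N. (cmod (L_op R d a k N Vs m x))\<^sup>2) * carleman_weight R r lam x = 0"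
          by eventually_elim simp
        then show ?thesis unfolding residual_eq by (rule integral_eq_zero_AE)
      qed
      then have "sqrt (residual R d a k r N lam V') \<le> sqrt (K * (?n h)\<^sup>2 * (1 + (?n Vs)\<^sup>2 + (?n h)\<^sup>2))"
        using KT[OF Vs h] by (simp add: V'_def)
      then have "residual R d a k r N lam V' \<le> K * (?n h)\<^sup>2 * (1 + (?n Vs)\<^sup>2 + (?n h)\<^sup>2)" by simp
      also have "\<dots> \<le> K * \<delta>\<^sup>2 * (1 + M\<^sup>2 + 1\<^sup>2)"
        using K nh nVs \<delta> sobolev_vec_norm_nonneg[of "cube R" 3 N]
        by (intro mult_mono add_mono power_mono) (auto intro: less_imp_le order_trans)
      finally have "residual R d a k r N lam V' \<le> K * (2 + M\<^sup>2) * \<delta>\<^sup>2" by (simp add: algebra_simps)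
      moreover have "\<delta>\<^sup>2 * (?n V')\<^sup>2 \<le> \<delta>\<^sup>2 * M\<^sup>2"
        using nV' sobolev_vec_norm_nonneg[of "cube R" 3 N V'] by (intro mult_left_mono power_mono) auto
      ultimately show ?thesis unfolding J_fun_eq K2_def by (simp add: algebra_simps)
    qed
    have Vms: "Vmin \<in> H3 R N" using Vmin by (simp add: B_closure_def)
    obtain e where e: "e > 0" "\<And>U. U \<in> H3 R N \<Longrightarrow> ?n U < e \<Longrightarrow> ?J (lin_vec 1 Vmin 1 U) \<le> ?J Vmin + \<delta>\<^sup>2"
      using J_fun_upper_semicontinuous[OF R d r lam Vms _ \<delta>2(1), of "\<delta>\<^sup>2" a k] by auto
    \<comment> \<open>As an element of \<open>B(M)\<close>, \<open>W\<close> has the prescribed Cauchy data; for the minimizer this would ask for a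
      passage to the limit in the traces.\<close>
    obtain W where W: "W \<in> B_set R N M \<psi>0 \<psi>1" and nW: "?n (Vmin - W) < min e \<delta>"
    proof -
      have "0 < min e \<delta>" using e(1) \<delta>(1) by simp
      then show ?thesis using Vmin that unfolding B_closure_def by blast
    qed
    have Ws: "W \<in> H3 R N" using W by (simp add: B_set_def)
    have JW: "?J W \<le> ?J Vmin + \<delta>\<^sup>2"
    proof -
      let ?Z = "Vmin - W"
      have Z: "?Z \<in> H3 R N" unfolding diff_eq_lin_vec by (rule lin_vec_sobolev[OF Vms Ws])
      have "?n (lin_vec (-1) ?Z 0 ?Z) < e" using sobolev_vec_norm_lin[OF R Z Z, of "-1" 0] nW by simp
      moreover have "lin_vec 1 Vmin 1 (lin_vec (-1) ?Z 0 ?Z) = W" by (simp add: lin_vec_def fun_eq_iff)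
      ultimately show ?thesis using e(2)[OF lin_vec_sobolev[OF Z Z]] by metis
    qed
    have conv': "\<exists>D. has_frechet_deriv_H30 R N ?J V1 D \<and> ?J V2 - ?J V1 - D (V2 - V1) \<ge> c * (?n2 (V2 - V1))\<^sup>2"
      if V1: "V1 \<in> B_set R N M \<psi>0 \<psi>1" and V2: "V2 \<in> B_set R N M \<psi>0 \<psi>1" for V1 V2
    proof -
      have "V1 \<in> B_closure R N (3 * M) \<psi>0 \<psi>1" "V2 \<in> B_closure R N (3 * M) \<psi>0 \<psi>1"
        using B_set_subset_closure[OF R, of M "3 * M" N \<psi>0 \<psi>1] V1 V2 \<open>M > 0\<close> by auto
      then obtain D where D: "has_frechet_deriv_H30 R N ?J V1 D"
         "?J V2 - ?J V1 - D (V2 - V1) \<ge> c * (?n2 (V2 - V1))\<^sup>2 + \<delta>\<^sup>2 * (?n (V2 - V1))\<^sup>2"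
        using conv[of "\<delta>\<^sup>2" V1 \<psi>0 \<psi>1 V2] \<delta>2 by blast
      moreover have "0 \<le> \<delta>\<^sup>2 * (?n (V2 - V1))\<^sup>2" by simp
      ultimately show ?thesis by (intro exI[of _ D]) linarith
    qed
    have mid: "lin_vec (1/2) V' (1/2) W \<in> B_closure R N M \<psi>0 \<psi>1"
      using B_set_convex[OF R V' W, of "1/2"] B_set_subset_closure[OF R order_refl, of N M \<psi>0 \<psi>1] by auto
    have J0: "0 \<le> ?J Vmin" unfolding J_fun_eq by (simp add: residual_nonneg)
    have "c / 2 * (?n2 (V' - W))\<^sup>2 \<le> ?J V' + ?J W - 2 * ?J (lin_vec (1/2) V' (1/2) W)"
      by (rule midpoint_convexity[OF R V' W conv' c])
    also have "\<dots> \<le> (K2 + 1) * \<delta>\<^sup>2"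
      using JV' JW J0 minim[OF mid] by (simp add: algebra_simps)
    finally have "(?n2 (V' - W))\<^sup>2 \<le> 2 * (K2 + 1) / c * \<delta>\<^sup>2" using c by (simp add: field_simps)
    then have "sqrt ((?n2 (V' - W))\<^sup>2) \<le> sqrt (2 * (K2 + 1) / c * \<delta>\<^sup>2)" by (rule real_sqrt_le_mono)
    then have q: "?n2 (V' - W) \<le> sqrt (2 * (K2 + 1) / c) * \<delta>"
      unfolding real_sqrt_mult using \<delta> by (simp add: sobolev_vec_norm_nonneg)
    have s2: "X \<in> sobolev_vec (cube R) 2 N" if "X \<in> H3 R N" for X
      using that by (auto simp: sobolev_vec_def intro: in_sobolev_mono)
    have diff: "X - Y \<in> H3 R N" if "X \<in> H3 R N" "Y \<in> H3 R N" for X Y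
      unfolding diff_eq_lin_vec by (rule lin_vec_sobolev[OF that])
    note s = s2[OF diff[OF Vms Ws]] s2[OF diff[OF V's Ws]] s2[OF h]
    have "Vmin - Vs = lin_vec 1 (lin_vec 1 (Vmin - W) (-1) (V' - W)) 1 h"
      by (simp add: lin_vec_def V'_def fun_eq_iff)
    then have "?n2 (Vmin - Vs) \<le> ?n2 (lin_vec 1 (Vmin - W) (-1) (V' - W)) + ?n2 h"
      using sobolev_vec_norm_lin[OF R lin_vec_sobolev[OF s(1,2), of 1 "-1"] s(3), of 1 1] by simp
    moreover have "?n2 (lin_vec 1 (Vmin - W) (-1) (V' - W)) \<le> ?n2 (Vmin - W) + ?n2 (V' - W)"
      using sobolev_vec_norm_lin[OF R s(1,2), of 1 "-1"] by simp
    moreover have "?n2 (Vmin - W) \<le> \<delta>" using sobolev_vec_norm_mono[of 2 3 R N "Vmin - W"] nW by simp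
    moreover have "?n2 h \<le> \<delta>" using sobolev_vec_norm_mono[of 2 3 R N h] nh by simp
    moreover have "C * \<delta> = 2 * \<delta> + sqrt (2 * (K2 + 1) / c) * \<delta>" by (simp only: C_def distrib_right)
    ultimately show "?n2 (Vmin - Vs) \<le> C * \<delta>" using q by linarith
  qed
qed

end
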